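(* Let $\mathbf X$ and $Y$ be the state process and the CARMA process given by the state-space representation described in the context. Suppose that $\mathbb E L(1)=0$ and $\mathbb E|L(1)|^2=\sigma^2<\infty$, that $\mathbf X(0)$ is independent of $(L(t))_{t\ge 0}$, and that all eigenvalues of $\mathbf A$ have strictly negative real parts. Let $0<\omega_1<\dots<\omega_d$ be fixed frequencies. Then, as $T\to\infty$, the $\mathbb R^{2d}$-valued random vector $$\left[\Re\left(\mathcal F_T(Y)(\omega_j)\right),\Im\left(\mathcal F_T(Y)(\omega_j)\right)\right]^T_{j=1,\dots,d}$$ converges in distribution to $\mathcal N\left(0,\frac{\sigma^2}2\mathbf B\right)$ with $$\mathbf B=\operatorname{diag}\left(\left|\frac{b(i\omega_1)}{a(i\omega_1)}\right|^2,\left|\frac{b(i\omega_1)}{a(i\omega_1)}\right|^2,\dots,\left|\frac{b(i\omega_d)}{a(i\omega_d)}\right|^2,\left|\frac{b(i\omega_d)}{a(i\omega_d)}\right|^2\right),$$ and $\left[|\mathcal F_T(Y)(\omega_j)|^2\right]^T_{j=1,\dots,d}$ converges in distribution to a random vector whose coordinates are independent, the $j$-th one being $\operatorname{Exp}\left(\sigma^2\left|\frac{b(i\omega_j)}{a(i\omega_j)}\right|^2\right)$ distributed for $j=1,\dots,d$.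
   Context: Let $p>q\ge 0$ be integers, $a(z)=z^p+a_1z^{p-1}+\dots+a_p$ and $b(z)=b_0+b_1z+\dots+b_{p-1}z^{p-1}$ polynomials with real coefficients, with $b_q\ne 0$ and $b_j=0$ for $q<j<p$. Let $\mathbf A\in\mathbb R^{p\times p}$ be the companion matrix $$\mathbf A=\begin{pmatrix}0&1&0&\cdots&0\\0&0&1&\cdots&0\\ \vdots&\vdots&\vdots&\ddots&\vdots\\0&0&0&\cdots&1\\-a_p&-a_{p-1}&-a_{p-2}&\cdots&-a_1\end{pmatrix}$$ (with $\mathbf A=-a_1$ if $p=1$), $\mathbf e=[0,\dots,0,1]^T\in\mathbb R^p$, $\mathbf b=[b_0,b_1,\dots,b_{p-1}]^T\in\mathbb R^p$. Let $(L(t))_{t\ge 0}$ be a one-dimensional (real-valued) Lévy process with $L(0)=0$ a.s., on a filtered probability space satisfying the usual hypotheses. State-space representation: the $\mathbb R^p$-valued process $\mathbf X$ solves $d\mathbf X(t)=\mathbf A\mathbf X(t)\,dt+\mathbf e\,dL(t)$, i.e. $\mathbf X(t)=e^{\mathbf At}\mathbf X(0)+\int_0^te^{\mathbf A(t-u)}\mathbf e\,dL(u)$ for $t\ge 0$, and the CARMA process is $Y(t)=\mathbf b^T\mathbf X(t)$. The truncated Fourier transform of $Y$ at frequency $\omega\in\mathbb R$ is $\mathcal F_T(Y)(\omega)=\frac1{\sqrt T}\int_0^TY(t)e^{-i\omega t}\,dt$, $T>0$. $\operatorname{Exp}(\lambda)$ denotes the exponential distribution with mean $\lambda$ (the point mass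 at $0$ if $\lambda=0$). *)

theory Defs
  imports
    "HOL-Probability.Probability"
    "Jordan_Normal_Form.Char_Poly"
begin

text \<open>State vectors in \<open>\<real>\<^sup>p\<close> are vectors of dimension \<^term>\<open>p::nat\<close> with indices
  \<open>0, \<dots>, p - 1\<close>. Limit laws live on the Euclidean spaces \<^typ>\<open>real ^ 'n\<close>, where the type
  \<open>'n\<close> of class \<^class>\<open>finite\<close> plays the role of the index set.\<close>

section \<open>Filtered probability spaces and Levy processes\<close>

locale usual_filtered_prob_space = prob_space M + complete_measure M
  for M :: "'a measure" and F :: "real \<Rightarrow> 'a measure" +
  assumes filtration_subalgebra: "\<And>t. 0 \<le> t \<Longrightarrow> subalgebra M (F t)"
    and filtration_mono: "\<And>s t. 0 \<le> s \<Longrightarrow> s \<le> t \<Longrightarrow> sets (F s) \<subseteq> sets (F t)"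
    and filtration_right_continuous: "\<And>t. 0 \<le> t \<Longrightarrow> sets (F t) = (\<Inter>s\<in>{t<..}. sets (F s))"
    and filtration_null_sets: "null_sets M \<subseteq> sets (F 0)"

definition cadlag :: "(real \<Rightarrow> real) \<Rightarrow> bool" where
  "cadlag f \<longleftrightarrow> (\<forall>t\<ge>0. continuous (at_right t) f) \<and> (\<forall>t>0. \<exists>l. (f \<longlongrightarrow> l) (at_left t))"

text \<open>The time parameter of a process is a real number; only times \<open>t \<ge> 0\<close> matter.\<close>

locale levy_process = usual_filtered_prob_space M F
  for M :: "'a measure" and F :: "real \<Rightarrow> 'a measure" +
  fixes L :: "real \<Rightarrow> 'a \<Rightarrow> real"
  assumes adapted: "\<And>t. 0 \<le> t \<Longrightarrow> L t \<in> borel_measurable (F t)"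
    and starts_at_zero: "AE x in M. L 0 x = 0"
    and independent_increments: "\<And>s t. 0 \<le> s \<Longrightarrow> s \<le> t \<Longrightarrow>
      indep_set (sets (F s)) (sets (vimage_algebra (space M) (\<lambda>x. L t x - L s x) borel))"
    and stationary_increments: "\<And>s t. 0 \<le> s \<Longrightarrow> s \<le> t \<Longrightarrow>
      distr M borel (\<lambda>x. L t x - L s x) = distr M borel (L (t - s))"
    and stochastically_continuous: "\<And>t \<epsilon>. 0 \<le> t \<Longrightarrow> 0 < \<epsilon> \<Longrightarrow>
      ((\<lambda>s. prob {x \<in> space M. \<epsilon> < \<bar>L s x - L t x\<bar>}) \<longlongrightarrow> 0) (at t within {0..})"
    and cadlag_paths: "AE x in M. cadlag (\<lambda>t. L t x)"

section \<open>State-space representation of a CARMA process\<close>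

text \<open>The coefficient \<open>a\<^sub>k\<close> of \<open>a(z) = z^p + a\<^sub>1 z^(p-1) + \<dots> + a\<^sub>p\<close> is \<^term>\<open>coeff a (p - k)\<close>,
  so that the last row \<open>(-a\<^sub>p, \<dots>, -a\<^sub>1)\<close> of the companion matrix has the entry
  \<^term>\<open>- coeff a j\<close> in the column \<open>j \<in> {0, \<dots>, p - 1}\<close>.\<close>

definition companion_matrix :: "nat \<Rightarrow> real poly \<Rightarrow> real mat" where
  "companion_matrix p a = Matrix.mat p p (\<lambda>(i, j).
     if i + 1 < p then (if j = i + 1 then 1 else 0) else - coeff a j)"

definition noise_vector :: "nat \<Rightarrow> real Matrix.vec" where
  "noise_vector p = unit_vec p (p - 1)"

definition ma_vector :: "nat \<Rightarrow> real poly \<Rightarrow> real Matrix.vec" where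
  "ma_vector p b = Matrix.vec p (coeff b)"

text \<open>The stochastic differential equation \<open>dX(t) = A X(t) dt + e dL(t)\<close> means
  \<open>X(t) = X(0) + \<integral>\<^sub>0\<^sup>t A X(s) ds + e (L(t) - L(0))\<close> for all \<open>t \<ge> 0\<close>, almost surely. As the
  integrand \<open>e\<close> of \<open>dL\<close> is constant, the only integral to be formed is a pathwise Lebesgue
  integral. The pathwise solution from a given \<open>X(0)\<close> is unique; it is the cadlag version of
  \<open>e\<^sup>A\<^sup>t X(0) + \<integral>\<^sub>0\<^sup>t e\<^sup>A\<^sup>(\<^sup>t\<^sup>-\<^sup>u\<^sup>) e dL(u)\<close>.\<close>

definition solves_linear_sde ::
    "'a measure \<Rightarrow> nat \<Rightarrow> real mat \<Rightarrow> real Matrix.vec \<Rightarrow> (real \<Rightarrow> 'a \<Rightarrow> real) \<Rightarrow> (real \<Rightarrow> 'a \<Rightarrow> real Matrix.vec) \<Rightarrow> bool"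
  where
  "solves_linear_sde M p A e L X \<longleftrightarrow>
    (\<forall>t\<ge>0. \<forall>x\<in>space M. X t x \<in> carrier_vec p) \<and>
    (\<forall>t\<ge>0. \<forall>i<p. (\<lambda>x. vec_index (X t x) i) \<in> borel_measurable M) \<and>
    (AE x in M. \<forall>t\<ge>0. \<forall>i<p.
       set_integrable lborel {0..t} (\<lambda>s. vec_index (X s x) i) \<and>
       vec_index (X t x) i = vec_index (X 0 x) i
         + (LINT s:{0..t}|lborel. vec_index (A *\<^sub>v X s x) i)
         + vec_index e i * (L t x - L 0 x))"

definition initial_state_indep ::
    "'a measure \<Rightarrow> nat \<Rightarrow> (real \<Rightarrow> 'a \<Rightarrow> real) \<Rightarrow> (real \<Rightarrow> 'a \<Rightarrow> real Matrix.vec) \<Rightarrow> bool"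
  where
  "initial_state_indep M p L X \<longleftrightarrow>
    prob_space.indep_var M
      (PiM {..<p} (\<lambda>_. borel)) (\<lambda>x. \<lambda>i\<in>{..<p}. vec_index (X 0 x) i)
      (PiM {0..} (\<lambda>_. borel)) (\<lambda>x. \<lambda>t\<in>{0..}. L t x)"

definition carma :: "nat \<Rightarrow> real poly \<Rightarrow> (real \<Rightarrow> 'a \<Rightarrow> real Matrix.vec) \<Rightarrow> real \<Rightarrow> 'a \<Rightarrow> real" where
  "carma p b X t x = scalar_prod (ma_vector p b) (X t x)"

definition truncated_fourier :: "real \<Rightarrow> (real \<Rightarrow> real) \<Rightarrow> real \<Rightarrow> complex" where
  "truncated_fourier T y \<omega> =
     (1 / sqrt T) *\<^sub>R (LINT t:{0..T}|lborel. of_real (y t) * exp (- (\<i> * of_real (\<omega> * t))))"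

section \<open>Convergence in distribution and the limit laws\<close>

definition converges_in_distribution ::
    "'a measure \<Rightarrow> ('t \<Rightarrow> 'a \<Rightarrow> 'b::topological_space) \<Rightarrow> 'b measure \<Rightarrow> 't filter \<Rightarrow> bool"
  where
  "converges_in_distribution M Z \<mu> G \<longleftrightarrow>
    prob_space \<mu> \<and> sets \<mu> = sets borel \<and>
    (\<forall>\<^sub>F t in G. Z t \<in> borel_measurable M) \<and>
    (\<forall>f::'b \<Rightarrow> real. continuous_on UNIV f \<and> bounded (range f) \<longrightarrow>
       ((\<lambda>t. LINT x|M. f (Z t x)) \<longlongrightarrow> (LINT z|\<mu>. f z)) G)"

definition normal_law :: "real \<Rightarrow> real \<Rightarrow> real measure" where
  "normal_law m v =
     (if v = 0 then return borel m else density lborel (normal_density m (sqrt v)))"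

text \<open>The law \<open>N(m, \<Sigma>)\<close>, where \<open>\<Sigma>\<close> may be singular: every linear functional \<open>u\<close> has the
  univariate normal distribution with mean \<open>u\<^sup>T m\<close> and variance \<open>u\<^sup>T \<Sigma> u\<close>.\<close>

definition is_multivariate_normal :: "(real ^ 'n) measure \<Rightarrow> real ^ 'n \<Rightarrow> real ^ 'n ^ 'n \<Rightarrow> bool" where
  "is_multivariate_normal \<mu> m \<Sigma> \<longleftrightarrow>
    prob_space \<mu> \<and> sets \<mu> = sets borel \<and>
    (\<forall>u. distr \<mu> borel (\<lambda>z. inner u z) = normal_law (inner u m) (inner u (\<Sigma> *v u)))"

text \<open>Parametrised by the mean; the library's \<^const>\<open>exponential_density\<close> takes the rate.\<close>

definition exponential_law :: "real \<Rightarrow> real measure" where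
  "exponential_law l =
     (if l = 0 then return borel 0 else density lborel (exponential_density (1 / l)))"

definition has_independent_coordinates :: "(real ^ 'n) measure \<Rightarrow> ('n \<Rightarrow> real measure) \<Rightarrow> bool" where
  "has_independent_coordinates \<mu> \<kappa> \<longleftrightarrow>
    prob_space \<mu> \<and> sets \<mu> = sets borel \<and>
    prob_space.indep_vars \<mu> (\<lambda>_. borel) (\<lambda>j z. vec_nth z j) UNIV \<and>
    (\<forall>j. distr \<mu> borel (\<lambda>z. vec_nth z j) = \<kappa> j)"

definition diag_matrix :: "('n \<Rightarrow> real) \<Rightarrow> real ^ 'n ^ 'n" where
  "diag_matrix c = (\<chi> i j. if i = j then c i else 0)"

text \<open>The coordinates of \<open>\<real>\<^sup>2\<^sup>d\<close> are indexed by \<^typ>\<open>'d::finite \<times> 2\<close>: the index \<^term>\<open>(j, 1)\<close> carries the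
  real part and \<^term>\<open>(j, 2)\<close> the imaginary part at the \<open>j\<close>-th frequency.\<close>

definition re_im_vector :: "('d::finite \<Rightarrow> complex) \<Rightarrow> real ^ ('d \<times> 2)" where
  "re_im_vector c = (\<chi> k. if snd k = 1 then Re (c (fst k)) else Im (c (fst k)))"

definition power_transfer :: "real poly \<Rightarrow> real poly \<Rightarrow> real \<Rightarrow> real" where
  "power_transfer a b \<omega> =
     (cmod (poly (map_poly of_real b) (\<i> * of_real \<omega>)
            / poly (map_poly of_real a) (\<i> * of_real \<omega>)))\<^sup>2"

end

theory Submission
  imports Defs
begin

text \<open>Why the theorem holds. Let \<open>N\<^sub>T(\<xi>)\<close> be the integral of \<open>exp (- \<xi> t)\<close> against the noise
  \<open>L\<close> over \<open>[0, T]\<close>, and attach to a polynomial \<open>c\<close> of degree less than \<open>p\<close> the linear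
  functional \<open>S\<^sub>c = \<Sum>k. coeff c k * X\<^sub>k\<close> of the state. For a companion matrix the dynamics act
  on \<open>S\<^sub>c\<close> as multiplication of \<open>c\<close> by the variable \<open>z\<close> modulo \<open>a\<close>, so that integrating by
  parts against \<open>exp (- \<xi> t)\<close> amounts to multiplying \<open>c\<close> by \<open>z - \<xi>\<close> modulo \<open>a\<close>. The output is
  \<open>Y = S\<^sub>b\<close>. As \<open>a(\<xi>) b - b(\<xi>) a\<close> vanishes at \<open>\<xi>\<close>, it equals \<open>(z - \<xi>) c\<close> for some \<open>c\<close>, and
  therefore (lemma \<open>fourier_state_poly\<close>)
  \<open>a(\<xi>) * \<integral>\<^sub>0\<^sup>T exp (- \<xi> t) Y(t) dt = b(\<xi>) * N\<^sub>T(\<xi>) + exp (- \<xi> T) * S\<^sub>c(T) - S\<^sub>c(0)\<close>. With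
  \<open>\<xi> = i \<omega>\<close> this says that the truncated Fourier transform is \<open>b(i \<omega>) / a(i \<omega>)\<close> times
  \<open>N\<^sub>T(i \<omega>) / sqrt T\<close>, up to a boundary term.

  The boundary term is negligible because the state is stochastically bounded (lemma
  \<open>state_bounded\<close>): integrating by parts at a root \<open>\<xi>\<close> of \<open>a\<close> expresses \<open>S\<^sub>c\<close> by the
  functional of \<open>(z - \<xi>) c mod a\<close>, which becomes zero modulo \<open>a\<close> after multiplication by a
  factor of \<open>a\<close> of smaller degree, and \<open>Re \<xi> < 0\<close> gives bounds in \<open>L\<^sup>1\<close> that are uniform in
  \<open>T\<close>, on each event on which the initial state is bounded by a constant.

  For the noise, \<open>N\<^sub>T(i \<omega>)\<close> is replaced by a Riemann sum over a grid of step \<open>1 / m\<close> with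
  \<open>m = \<lfloor>T\<rfloor>\<^sup>2\<close>; the \<open>L\<^sup>1\<close> error stays bounded (lemma \<open>noise_near_noise_sum\<close>), so that it too
  disappears after division by \<open>sqrt T\<close>. A real linear combination of these sums at all
  frequencies is \<open>\<Sum>k. g(k / m) * (L((k + 1) / m) - L(k / m))\<close> for a real trigonometric sum
  \<open>g\<close>. The increments are independent, hence its characteristic function is a product of
  values of the characteristic function of \<open>L(1 / m)\<close>. Write \<open>\<phi> 1\<close> for the characteristic
  function of \<open>L(1)\<close>. Near the origin that of \<open>L(1 / m)\<close> is the \<open>m\<close>-th root
  \<open>exp (Ln (\<phi> 1 u) / m)\<close> (lemma \<open>\<phi>_root\<close>), and \<open>Ln (\<phi> 1 u)\<close> is \<open>- \<sigma>\<^sup>2 u\<^sup>2 / 2\<close> up to \<open>o(u\<^sup>2)\<close>.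
  The logarithm of the product is thus asymptotically \<open>- \<sigma>\<^sup>2 / 2\<close> times the mean of \<open>g\<^sup>2\<close> over
  the grid, and this mean converges to half the sum of the squared amplitudes, since the waves
  with frequencies \<open>\<omega>\<^sub>i - \<omega>\<^sub>j\<close> (\<open>i \<noteq> j\<close>) and \<open>\<omega>\<^sub>i + \<omega>\<^sub>j\<close> average out (lemma \<open>wave_sum_clt\<close>).

  Convergence of the characteristic functions at every vector gives convergence in distribution
  by a continuity theorem in Euclidean space (theorem \<open>levy_continuity_euclidean\<close>). The second
  assertion follows by applying the continuous map that takes squared moduli; if \<open>U\<close> and \<open>V\<close>
  are independent and \<open>N(0, v)\<close> distributed, then \<open>U\<^sup>2 + V\<^sup>2\<close> is exponential with mean \<open>2 v\<close>,
  because the area of a disc is proportional to its squared radius (lemma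
  \<open>distr_normal_pair\<close>).\<close>

section \<open>Convergence in distribution from characteristic functions\<close>

text \<open>Trigonometric polynomials with arbitrary frequency vectors. Their expectations are
  finite sums of values of the characteristic function, and they form an algebra.\<close>

inductive trig_poly :: "('b::euclidean_space \<Rightarrow> complex) \<Rightarrow> bool" where
  wave: "trig_poly (\<lambda>x. c * iexp (inner u x))"
| add: "trig_poly f \<Longrightarrow> trig_poly g \<Longrightarrow> trig_poly (\<lambda>x. f x + g x)"

lemma trig_poly_const: "trig_poly (\<lambda>x. c)"
  using trig_poly.wave[of c 0] by simp

lemma trig_poly_wave_mult:
  assumes "trig_poly g"
  shows "trig_poly (\<lambda>x. c * iexp (inner u x) * g x)"
  using assms
proof induction
  case (wave d v)
  have "(\<lambda>x. c * iexp (inner u x) * (d * iexp (inner v x))) = (\<lambda>x. (c * d) * iexp (inner (u + v) x))"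
    by (auto simp: fun_eq_iff inner_add_left exp_add algebra_simps)
  then show ?case using trig_poly.wave by metis
next
  case (add f g)
  then show ?case using trig_poly.add by (simp add: distrib_left)
qed

lemma trig_poly_mult:
  assumes "trig_poly f" "trig_poly g"
  shows "trig_poly (\<lambda>x. f x * g x)"
  using assms(1)
proof induction
  case (wave c u)
  then show ?case using trig_poly_wave_mult[OF assms(2)] by simp
next
  case (add f1 f2)
  then show ?case using trig_poly.add by (simp add: distrib_right)
qed

lemma trig_poly_sum:
  assumes "finite I" "\<And>i. i \<in> I \<Longrightarrow> trig_poly (f i)"
  shows "trig_poly (\<lambda>x. \<Sum>i\<in>I. f i x)"
  using assms by (induction I rule: finite_induct) (auto intro: trig_poly_const trig_poly.add)

lemma trig_poly_sin: "trig_poly (\<lambda>x. of_real (sin (inner u x)))"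
proof -
  have "complex_of_real (sin t) = (1 / (2 * \<i>)) * iexp t + (- 1 / (2 * \<i>)) * iexp (- t)" for t
    by (simp add: complex_eq_iff flip: cis_conv_exp of_real_minus)
  then have "(\<lambda>x. of_real (sin (inner u x))) =
      (\<lambda>x. (1 / (2 * \<i>)) * iexp (inner u x) + (- 1 / (2 * \<i>)) * iexp (inner (- u) x))"
    by (simp add: fun_eq_iff)
  moreover have "trig_poly \<dots>"
    by (intro trig_poly.add trig_poly.wave)
  ultimately show ?thesis by simp
qed

text \<open>The coordinate functions \<open>sin (inner x b / R)\<close> are sums of two waves, so every
  polynomial in them is again a finite sum of waves. Rescaled sines look like coordinates near
  the origin but stay bounded everywhere, which is what makes approximation on compact sets
  usable globally.\<close>

lemma trig_poly_polynomial_sin: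
  fixes p :: "'b::euclidean_space \<Rightarrow> real"
  assumes "real_polynomial_function p"
  shows "trig_poly (\<lambda>x. of_real (p (\<Sum>b\<in>Basis. sin (inner x b / R) *\<^sub>R b)))"
  using assms
proof induction
  case (linear f)
  interpret bounded_linear f by fact
  have "(\<lambda>x. complex_of_real (f (\<Sum>b\<in>Basis. sin (inner x b / R) *\<^sub>R b)))
      = (\<lambda>x. \<Sum>b\<in>Basis. of_real (f b) * of_real (sin (inner (b /\<^sub>R R) x)))"
    by (auto simp: fun_eq_iff sum scaleR inner_commute divide_inverse mult_ac)
  then show ?case
    by (simp only:) (intro trig_poly_sum trig_poly_mult trig_poly_const trig_poly_sin finite_Basis)
next
  case (const c)
  show ?case by (rule trig_poly_const)
next
  case (add f g)
  then show ?case using trig_poly.add by simp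
next
  case (mult f g)
  then show ?case using trig_poly_mult by simp
qed

lemma trig_poly_bounded_continuous:
  assumes "trig_poly f"
  shows "continuous_on UNIV f \<and> (\<exists>C. \<forall>x. norm (f x) \<le> C)"
  using assms
proof induction
  case (wave c u)
  have "norm (c * iexp (inner u x)) \<le> norm c" for x
    by (simp add: norm_mult)
  then show ?case by (auto intro!: continuous_intros)
next
  case (add f g)
  then obtain C D where "\<forall>x. norm (f x) \<le> C" "\<forall>x. norm (g x) \<le> D" by auto
  then have "norm (f x + g x) \<le> C + D" for x
    by (meson norm_triangle_le add_mono)
  then show ?case using add by (auto intro!: continuous_intros)
qed

lemma (in prob_space) integrable_bounded_continuous:
  fixes f :: "'b::euclidean_space \<Rightarrow> 'c::{banach, second_countable_topology}"
  assumes "X \<in> borel_measurable M" "continuous_on UNIV f" "\<And>x. norm (f x) \<le> C"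
  shows "integrable M (\<lambda>x. f (X x))"
  using assms
  by (intro integrable_const_bound[of _ C]) 
     (auto intro: measurable_compose[OF _ borel_measurable_continuous_onI])

text \<open>Convergence of characteristic functions extends to finite sums of waves by linearity.\<close>

lemma trig_poly_expectation_tendsto:
  fixes Z :: "nat \<Rightarrow> 'a \<Rightarrow> 'b::euclidean_space"
  assumes "prob_space M" and Z[measurable]: "\<And>n. Z n \<in> borel_measurable M"
    and "prob_space \<mu>" and sets[measurable_cong]: "sets \<mu> = sets borel"
    and lim: "\<And>u. (\<lambda>n. LINT x|M. iexp (inner u (Z n x))) \<longlonglongrightarrow> (LINT z|\<mu>. iexp (inner u z))"
    and "trig_poly f"
  shows "(\<lambda>n. LINT x|M. f (Z n x)) \<longlonglongrightarrow> (LINT z|\<mu>. f z)"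
  using \<open>trig_poly f\<close>
proof induction
  case (wave c u)
  show ?case using tendsto_mult_left[OF lim] by simp
next
  case (add f g)
  interpret prob_space M by fact
  interpret \<mu>: prob_space \<mu> by fact
  have id: "(\<lambda>z. z) \<in> borel_measurable \<mu>" by simp
  have "integrable M (\<lambda>x. f (Z n x))" "integrable M (\<lambda>x. g (Z n x))" for n
    using integrable_bounded_continuous[OF Z] trig_poly_bounded_continuous add.hyps by blast+
  moreover have "integrable \<mu> f" "integrable \<mu> g"
    using \<mu>.integrable_bounded_continuous[OF id] trig_poly_bounded_continuous add.hyps by blast+
  ultimately show ?case using tendsto_add[OF add.IH] by simp
qed

text \<open>A continuous substitute for the indicator of \<open>\<bar>y\<bar> > R\<close>.\<close>

definition tail_bump :: "nat \<Rightarrow> real \<Rightarrow> real" where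
  "tail_bump R y = min 1 (max 0 (\<bar>y\<bar> - real R))"

lemma tail_bump_bounds: "0 \<le> tail_bump R y" "tail_bump R y \<le> 1" "norm (tail_bump R y) \<le> 1"
  by (auto simp: tail_bump_def)

lemma isCont_tail_bump: "isCont (tail_bump R) y"
  unfolding tail_bump_def[abs_def] by (intro continuous_intros)

lemma borel_measurable_tail_bump[measurable]: "tail_bump R \<in> borel_measurable borel"
  unfolding tail_bump_def[abs_def] by measurable

lemma tail_bump_tendsto: "(\<lambda>R. tail_bump R y) \<longlonglongrightarrow> 0"
proof (rule tendsto_eventually)
  have "eventually (\<lambda>R. real R \<ge> \<bar>y\<bar>) sequentially"
    by real_asymp
  then show "\<forall>\<^sub>F R in sequentially. tail_bump R y = 0"
    by eventually_elim (auto simp: tail_bump_def)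
qed

text \<open>The coordinates converge weakly by the one-dimensional continuity theorem; this is the
  only source of tightness.\<close>

lemma coordinate_tail_tendsto:
  fixes Z :: "nat \<Rightarrow> 'a \<Rightarrow> 'b::euclidean_space"
  assumes "prob_space M" and Z[measurable]: "\<And>n. Z n \<in> borel_measurable M"
    and "prob_space \<mu>" and sets[measurable_cong]: "sets \<mu> = sets borel"
    and lim: "\<And>u. (\<lambda>n. LINT x|M. iexp (inner u (Z n x))) \<longlonglongrightarrow> (LINT z|\<mu>. iexp (inner u z))"
  shows "(\<lambda>n. LINT x|M. tail_bump R (inner (Z n x) b)) \<longlonglongrightarrow> (LINT z|\<mu>. tail_bump R (inner z b))"
proof -
  interpret prob_space M by fact
  interpret \<mu>: prob_space \<mu> by fact
  let ?M = "\<lambda>n. distr M borel (\<lambda>x. inner (Z n x) b)" and ?M' = "distr \<mu> borel (\<lambda>z. inner z b)"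
  have rd: "real_distribution (?M n)" for n by (rule real_distribution_distr) measurable
  have rd': "real_distribution ?M'" by (rule \<mu>.real_distribution_distr) measurable
  have "weak_conv_m ?M ?M'"
  proof (rule levy_continuity[OF rd rd'])
    fix t
    show "(\<lambda>n. char (?M n) t) \<longlonglongrightarrow> char ?M' t"
      using lim[of "t *\<^sub>R b"] by (simp add: char_def integral_distr inner_commute)
  qed
  then have "(\<lambda>n. integral\<^sup>L (?M n) (tail_bump R)) \<longlonglongrightarrow> integral\<^sup>L ?M' (tail_bump R)"
    by (intro weak_conv_imp_integral_bdd_continuous_conv[where B=1] rd rd' isCont_tail_bump tail_bump_bounds)
  then show ?thesis by (simp add: integral_distr)
qed

text \<open>On the cube of sines \<open>[-1, 1]\<^sup>n\<close> the function \<open>f\<close> composed with \<open>r * arcsin\<close> is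
  continuous and bounded by \<open>B\<close>, so the Stone-Weierstrass theorem gives a polynomial within
  \<open>e\<close> of it. Pulled back along \<open>x \<mapsto> sin (x / r)\<close>, this polynomial is close to \<open>f\<close> where all
  coordinates are at most \<open>r\<close> in modulus, and it is bounded by \<open>B + e\<close> everywhere. Outside the
  box one of the tail functions equals \<open>1\<close>.\<close>

lemma bounded_continuous_near_trig_poly:
  fixes f :: "'b::euclidean_space \<Rightarrow> real"
  assumes cont: "continuous_on UNIV f" and B: "\<And>z. \<bar>f z\<bar> \<le> B" and e: "0 < e"
  obtains p where "trig_poly (\<lambda>z. of_real (p z))"
    "\<And>z. \<bar>f z - p z\<bar> \<le> e + (2 * B + e) * (\<Sum>b\<in>Basis. tail_bump R (inner z b))"
proof -
  \<comment> \<open>The tail function reaches its maximum \<open>1\<close> at distance \<open>R + 1\<close> from the origin.\<close>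
  define r where "r = real R + 1"
  have r: "r > 0" by (simp add: r_def)
  \<comment> \<open>On the box of half-width \<open>r\<close> the map \<open>z \<mapsto> sin (z / r)\<close> is inverted by \<open>r * arcsin\<close>, as \<open>1 \<le> pi / 2\<close>.\<close>
  define F where "F s = f (\<Sum>b\<in>Basis. (r * arcsin (inner s b)) *\<^sub>R b)" for s :: 'b
  have "continuous_on (cbox (-One) One) F"
    unfolding F_def
    by (rule continuous_on_compose2[OF cont]) 
       (auto intro!: continuous_intros simp: mem_box)
  then obtain q where q: "real_polynomial_function q" "\<And>s. s \<in> cbox (-One) One \<Longrightarrow> \<bar>F s - q s\<bar> < e"
    using Stone_Weierstrass_real_polynomial_function[OF compact_cbox _ e] by blast
  define \<tau> where "\<tau> z = (\<Sum>b\<in>Basis. sin (inner z b / r) *\<^sub>R b)" for z :: 'b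
  have \<tau>b: "inner (\<tau> z) b = sin (inner z b / r)" if "b \<in> Basis" for z b
    using that by (simp add: \<tau>_def)
  have \<tau>: "\<tau> z \<in> cbox (-One) One" for z
    by (auto simp: mem_box \<tau>b)
  show thesis
  proof
    show "trig_poly (\<lambda>z. of_real (q (\<tau> z)))"
      unfolding \<tau>_def by (rule trig_poly_polynomial_sin[OF q(1)])
    fix z :: 'b
    have B0: "0 \<le> B" using B[of z] by linarith
    have S0: "0 \<le> (\<Sum>b\<in>Basis. tail_bump R (inner z b))"
      by (intro sum_nonneg tail_bump_bounds)
    have near: "\<bar>F (\<tau> z) - q (\<tau> z)\<bar> < e" using q(2)[OF \<tau>] .
    show "\<bar>f z - q (\<tau> z)\<bar> \<le> e + (2 * B + e) * (\<Sum>b\<in>Basis. tail_bump R (inner z b))"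
    proof (cases "\<forall>b\<in>Basis. \<bar>inner z b\<bar> \<le> r")
      case True
      have "r * arcsin (inner (\<tau> z) b) = inner z b" if b: "b \<in> Basis" for b
      proof -
        have "\<bar>inner z b / r\<bar> \<le> 1" using True b r by (simp add: abs_divide)
        then have "- (pi/2) \<le> inner z b / r" "inner z b / r \<le> pi/2" 
          using pi_ge_two by linarith+
        then show ?thesis unfolding \<tau>b[OF b] using r by (simp add: arcsin_sin)
      qed
      then have "F (\<tau> z) = f (\<Sum>b\<in>Basis. inner z b *\<^sub>R b)"
        unfolding F_def by (intro arg_cong[where f=f] sum.cong) simp_all
      then have "F (\<tau> z) = f z" by (simp add: euclidean_representation)
      then have "\<bar>f z - q (\<tau> z)\<bar> \<le> e" using near by simp
      also have "e \<le> e + (2 * B + e) * (\<Sum>b\<in>Basis. tail_bump R (inner z b))"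
        using S0 B0 e by simp
      finally show ?thesis .
    next
      case False
      then obtain b where b: "b \<in> Basis" "\<bar>inner z b\<bar> > r" by auto
      have "1 = tail_bump R (inner z b)" using b by (auto simp: tail_bump_def r_def)
      also have "\<dots> \<le> (\<Sum>b\<in>Basis. tail_bump R (inner z b))"
        using b by (intro member_le_sum tail_bump_bounds) auto
      finally have ge1: "1 \<le> (\<Sum>b\<in>Basis. tail_bump R (inner z b))" .
      have "\<bar>f z - q (\<tau> z)\<bar> \<le> \<bar>f z\<bar> + \<bar>F (\<tau> z)\<bar> + \<bar>F (\<tau> z) - q (\<tau> z)\<bar>" by arith
      also have "\<dots> \<le> B + B + e" using near B by (intro add_mono) (auto simp: F_def)
      also have "\<dots> = e + (2 * B + e) * 1 - e" by simp
      also have "\<dots> \<le> e + (2 * B + e) * (\<Sum>b\<in>Basis. tail_bump R (inner z b)) - 0"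
        using ge1 B0 e by (intro diff_mono add_left_mono mult_left_mono) auto
      finally show ?thesis by simp
    qed
  qed
qed

text \<open>Tightness controls the error of \<open>bounded_continuous_near_trig_poly\<close> outside a large box,
  uniformly in \<open>n\<close>; inside the box \<open>f\<close> may be replaced by a finite sum of waves.\<close>

theorem levy_continuity_euclidean:
  fixes Z :: "nat \<Rightarrow> 'a \<Rightarrow> 'b::euclidean_space"
  assumes M: "prob_space M" and Z[measurable]: "\<And>n. Z n \<in> borel_measurable M"
    and \<mu>: "prob_space \<mu>" and sets[measurable_cong]: "sets \<mu> = sets borel"
    and lim: "\<And>u. (\<lambda>n. LINT x|M. iexp (inner u (Z n x))) \<longlonglongrightarrow> (LINT z|\<mu>. iexp (inner u z))"
    and cont: "continuous_on UNIV f" and bdd: "bounded (range (f :: 'b \<Rightarrow> real))"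
  shows "(\<lambda>n. LINT x|M. f (Z n x)) \<longlonglongrightarrow> (LINT z|\<mu>. f z)"
proof (rule LIMSEQ_I)
  fix d :: real assume d: "0 < d"
  interpret prob_space M by fact
  interpret \<mu>: prob_space \<mu> by fact
  have [measurable]: "f \<in> borel_measurable borel" using cont by (rule borel_measurable_continuous_onI)
  obtain B where B: "\<And>z. \<bar>f z\<bar> \<le> B" using bdd unfolding bounded_iff by auto
  have B0: "0 \<le> B" using B[of 0] by linarith
  \<comment> \<open>The errors below sum up to \<open>3 * e + 2 * (2 * B + 1) * e = (4 * B + 5) * e\<close>.\<close>
  define e where "e = min 1 (d / (4 * B + 6))"
  have e: "0 < e" "e \<le> 1" using d B0 by (auto simp: e_def)
  have ed: "e * (4 * B + 6) \<le> d"
  proof -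
    have "e \<le> d / (4 * B + 6)" by (simp add: e_def)
    then show ?thesis using B0 by (simp add: pos_le_divide_eq)
  qed
  define H where "H R z = (\<Sum>b\<in>Basis. tail_bump R (inner z b))" for R and z :: 'b
  have [measurable]: "H R \<in> borel_measurable borel" for R unfolding H_def by measurable
  have intM: "integrable M (\<lambda>x. tail_bump R (inner (Z n x) b))" for R n b
    by (rule integrable_const_bound[of _ 1]) (auto simp: tail_bump_bounds)
  have int\<mu>: "integrable \<mu> (\<lambda>z. tail_bump R (inner z b))" for R b
    by (rule \<mu>.integrable_const_bound[of _ 1]) (auto simp: tail_bump_bounds)
  have H\<mu>: "(LINT z|\<mu>. H R z) = (\<Sum>b\<in>Basis. LINT z|\<mu>. tail_bump R (inner z b))" for R
    unfolding H_def by (rule Bochner_Integration.integral_sum) (rule int\<mu>)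
  have Hlim: "(\<lambda>n. LINT x|M. H R (Z n x)) \<longlonglongrightarrow> (LINT z|\<mu>. H R z)" for R
  proof -
    have "(LINT x|M. H R (Z n x)) = (\<Sum>b\<in>Basis. LINT x|M. tail_bump R (inner (Z n x) b))" for n
      unfolding H_def by (rule Bochner_Integration.integral_sum) (rule intM)
    then show ?thesis
      unfolding H\<mu> by (simp only:) (intro tendsto_sum coordinate_tail_tendsto[OF M Z \<mu> sets lim])
  qed
  have "(\<lambda>R. LINT z|\<mu>. tail_bump R (inner z b)) \<longlonglongrightarrow> (LINT z|\<mu>. 0)" for b
    by (rule integral_dominated_convergence[where w="\<lambda>_. 1"]) (auto simp: tail_bump_bounds tail_bump_tendsto)
  then have "(\<lambda>R. LINT z|\<mu>. H R z) \<longlonglongrightarrow> 0"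
    unfolding H\<mu> by (intro tendsto_null_sum) simp
  then have "\<forall>\<^sub>F R in sequentially. (LINT z|\<mu>. H R z) < e" using e by (auto dest: order_tendstoD)
  then obtain R where R: "(LINT z|\<mu>. H R z) < e" by (auto simp: eventually_sequentially)
  obtain p where p: "trig_poly (\<lambda>z. of_real (p z))"
    and fp: "\<And>z. \<bar>f z - p z\<bar> \<le> e + (2 * B + e) * H R z"
    using bounded_continuous_near_trig_poly[OF cont B e(1), of R] unfolding H_def by blast
  obtain C where p_cont: "continuous_on UNIV (\<lambda>z. complex_of_real (p z))" and C: "\<And>z. \<bar>p z\<bar> \<le> C"
    using trig_poly_bounded_continuous[OF p] unfolding norm_of_real by blast
  have p_cont: "continuous_on UNIV p" using continuous_on_Re[OF p_cont] by simp
  have close: "\<bar>(LINT x|N. f (X x)) - (LINT x|N. p (X x))\<bar> \<le> e + (2 * B + 1) * (LINT x|N. H R (X x))"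
    if "prob_space N" and X: "X \<in> borel_measurable N" for N :: "'c measure" and X
  proof -
    interpret N: prob_space N by fact
    note [measurable] = X
    have f: "integrable N (\<lambda>x. f (X x))" using N.integrable_bounded_continuous[OF X cont] B by auto
    have p: "integrable N (\<lambda>x. p (X x))" using N.integrable_bounded_continuous[OF X p_cont] C by auto
    have H: "integrable N (\<lambda>x. H R (X x))" unfolding H_def
      by (intro Bochner_Integration.integrable_sum, rule N.integrable_const_bound[of _ 1]) 
         (auto simp: tail_bump_bounds)
    have H0: "0 \<le> (LINT x|N. H R (X x))" by (intro Bochner_Integration.integral_nonneg) (auto simp: H_def sum_nonneg tail_bump_bounds)
    have "\<bar>(LINT x|N. f (X x)) - (LINT x|N. p (X x))\<bar> = \<bar>LINT x|N. f (X x) - p (X x)\<bar>"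
      using f p by simp
    also have "\<dots> \<le> (LINT x|N. \<bar>f (X x) - p (X x)\<bar>)" by (rule integral_abs_bound)
    also have "\<dots> \<le> (LINT x|N. e + (2 * B + e) * H R (X x))"
      using f p H fp by (intro integral_mono) auto
    also have "\<dots> = e + (2 * B + e) * (LINT x|N. H R (X x))" using H by (simp add: N.prob_space)
    also have "\<dots> \<le> e + (2 * B + 1) * (LINT x|N. H R (X x))" using H0 e by (intro add_left_mono mult_right_mono) auto
    finally show ?thesis .
  qed
  have "(\<lambda>n. LINT x|M. complex_of_real (p (Z n x))) \<longlonglongrightarrow> (LINT z|\<mu>. complex_of_real (p z))"
    by (rule trig_poly_expectation_tendsto[OF M Z \<mu> sets lim p])
  from tendsto_Re[OF this] have "(\<lambda>n. LINT x|M. p (Z n x)) \<longlonglongrightarrow> (LINT z|\<mu>. p z)" 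
    by simp
  from tendstoD[OF this e(1)] have "\<forall>\<^sub>F n in sequentially. \<bar>(LINT x|M. p (Z n x)) - (LINT z|\<mu>. p z)\<bar> < e"
    unfolding dist_real_def .
  moreover have "\<forall>\<^sub>F n in sequentially. (LINT x|M. H R (Z n x)) < e"
    using order_tendstoD(2)[OF Hlim R] .
  ultimately have "\<forall>\<^sub>F n in sequentially. norm ((LINT x|M. f (Z n x)) - (LINT z|\<mu>. f z)) < d"
  proof eventually_elim
    case (elim n)
    have *: "(2 * B + 1) * (LINT x|M. H R (Z n x)) \<le> (2 * B + 1) * e"
      "(2 * B + 1) * (LINT z|\<mu>. H R z) \<le> (2 * B + 1) * e"
      using elim(2) R B0 mult_left_mono[of _ e "2 * B + 1"] by auto
    have "\<bar>(LINT x|M. f (Z n x)) - (LINT x|M. p (Z n x))\<bar> \<le> e + (2 * B + 1) * e"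
      using close[OF M Z, of n] * by linarith
    moreover have "\<bar>(LINT z|\<mu>. f z) - (LINT z|\<mu>. p z)\<bar> \<le> e + (2 * B + 1) * e"
      using close[OF \<mu>, of "\<lambda>z. z"] * by (simp add: measurable_ident_sets[OF sets])
    ultimately have "\<bar>(LINT x|M. f (Z n x)) - (LINT z|\<mu>. f z)\<bar> < 3 * e + 2 * ((2 * B + 1) * e)"
      using elim by linarith
    also have "\<dots> = e * (4 * B + 5)" by (simp add: algebra_simps)
    also have "\<dots> \<le> e * (4 * B + 6)" using e by simp
    also have "\<dots> \<le> d" by (rule ed)
    finally show ?case by simp
  qed
  then show "\<exists>no. \<forall>n\<ge>no. norm ((LINT x|M. f (Z n x)) - (LINT z|\<mu>. f z)) < d"
    by (auto simp: eventually_sequentially)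
qed

text \<open>A limit along \<open>T \<rightarrow> \<infinity>\<close> is a limit along all sequences that tend to infinity.\<close>

lemma converges_in_distribution_char:
  fixes Z :: "real \<Rightarrow> 'a \<Rightarrow> 'b::euclidean_space"
  assumes M: "prob_space M" and Z: "\<And>T. Z T \<in> borel_measurable M"
    and \<mu>: "prob_space \<mu>" and sets: "sets \<mu> = sets borel"
    and lim: "\<And>u. ((\<lambda>T. LINT x|M. iexp (inner u (Z T x))) \<longlongrightarrow> (LINT z|\<mu>. iexp (inner u z))) at_top"
  shows "converges_in_distribution M Z \<mu> at_top"
  unfolding converges_in_distribution_def
proof (intro conjI allI impI \<mu> sets)
  show "\<forall>\<^sub>F T in at_top. Z T \<in> borel_measurable M" using Z by simp
  fix f :: "'b \<Rightarrow> real" assume f: "continuous_on UNIV f \<and> bounded (range f)"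
  show "((\<lambda>T. LINT x|M. f (Z T x)) \<longlongrightarrow> (LINT z|\<mu>. f z)) at_top"
  proof (rule tendsto_at_topI_sequentially)
    fix T :: "nat \<Rightarrow> real" assume T: "filterlim T at_top sequentially"
    have "(\<lambda>n. LINT x|M. iexp (inner u (Z (T n) x))) \<longlonglongrightarrow> (LINT z|\<mu>. iexp (inner u z))" for u
      by (rule filterlim_compose[OF lim T])
    then show "(\<lambda>n. LINT x|M. f (Z (T n) x)) \<longlonglongrightarrow> (LINT z|\<mu>. f z)"
      using f by (intro levy_continuity_euclidean[OF M Z \<mu> sets]) auto
  qed
qed

lemma converges_in_distribution_continuous_map:
  fixes g :: "'b::euclidean_space \<Rightarrow> 'c::euclidean_space"
  assumes conv: "converges_in_distribution M Z \<mu> G" and g: "continuous_on UNIV g"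
  shows "converges_in_distribution M (\<lambda>T x. g (Z T x)) (distr \<mu> borel g) G"
proof -
  have \<mu>: "prob_space \<mu>" "sets \<mu> = sets borel" and Z: "\<forall>\<^sub>F T in G. Z T \<in> borel_measurable M"
    and lim: "\<And>f :: 'b \<Rightarrow> real. continuous_on UNIV f \<Longrightarrow> bounded (range f) \<Longrightarrow> ((\<lambda>T. LINT x|M. f (Z T x)) \<longlongrightarrow> (LINT z|\<mu>. f z)) G"
    using conv unfolding converges_in_distribution_def by blast+
  have g_meas: "g \<in> borel_measurable borel" by (rule borel_measurable_continuous_onI[OF g])
  then have g_\<mu>: "g \<in> \<mu> \<rightarrow>\<^sub>M borel" using measurable_cong_sets[OF \<mu>(2) refl] by blast
  show ?thesis
    unfolding converges_in_distribution_def
  proof (intro conjI allI impI)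
    show "prob_space (distr \<mu> borel g)" by (rule prob_space.prob_space_distr[OF \<mu>(1) g_\<mu>])
    show "\<forall>\<^sub>F T in G. (\<lambda>x. g (Z T x)) \<in> borel_measurable M"
      using Z by (rule eventually_mono) (rule measurable_compose[OF _ g_meas])
    fix f :: "'c \<Rightarrow> real" assume f: "continuous_on UNIV f \<and> bounded (range f)"
    have "continuous_on UNIV (\<lambda>z. f (g z))"
      using f by (intro continuous_on_compose2[OF _ g]) auto
    moreover have "bounded (range (\<lambda>z. f (g z)))" using f by (auto intro: bounded_subset)
    ultimately have "((\<lambda>T. LINT x|M. f (g (Z T x))) \<longlongrightarrow> (LINT z|\<mu>. f (g z))) G" by (rule lim)
    moreover have "f \<in> borel_measurable borel" using f by (auto intro: borel_measurable_continuous_onI)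
    ultimately show "((\<lambda>T. LINT x|M. f (g (Z T x))) \<longlongrightarrow> (LINT z|distr \<mu> borel g. f z)) G"
      by (simp add: integral_distr[OF g_\<mu>])
  qed simp
qed

text \<open>Completeness of the measure is what transfers measurability to a version.\<close>

lemma converges_in_distribution_AE_cong:
  fixes Z :: "'t \<Rightarrow> 'a \<Rightarrow> 'b::topological_space"
  assumes M: "complete_measure M" and conv: "converges_in_distribution M Z \<mu> G"
    and eq: "\<forall>\<^sub>F T in G. AE x in M. Z T x = Z' T x"
  shows "converges_in_distribution M Z' \<mu> G"
proof -
  have Z': "Z' T \<in> borel_measurable M" if Z: "Z T \<in> borel_measurable M" and eq: "AE x in M. Z T x = Z' T x" for T
  proof (rule measurableI)
    fix A :: "'b set" assume A: "A \<in> sets borel"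
    have "AE x in M. x \<in> Z T -` A \<inter> space M \<longleftrightarrow> x \<in> Z' T -` A \<inter> space M"
      using eq by eventually_elim simp
    then show "Z' T -` A \<inter> space M \<in> sets M"
      using measurable_sets[OF Z A] complete_measure.in_sets_AE[OF M] by blast
  qed simp
  have \<mu>: "prob_space \<mu>" "sets \<mu> = sets borel" and Z: "\<forall>\<^sub>F T in G. Z T \<in> borel_measurable M"
    and lim: "\<And>f :: 'b \<Rightarrow> real. continuous_on UNIV f \<Longrightarrow> bounded (range f) \<Longrightarrow> ((\<lambda>T. LINT x|M. f (Z T x)) \<longlongrightarrow> (LINT z|\<mu>. f z)) G"
    using conv unfolding converges_in_distribution_def by blast+
  show ?thesis
    unfolding converges_in_distribution_def
  proof (intro conjI allI impI \<mu>)
    show "\<forall>\<^sub>F T in G. Z' T \<in> borel_measurable M" using Z eq by eventually_elim (rule Z')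
    fix f :: "'b \<Rightarrow> real" assume f: "continuous_on UNIV f \<and> bounded (range f)"
    then have f_meas: "f \<in> borel_measurable borel" by (auto intro: borel_measurable_continuous_onI)
    have "\<forall>\<^sub>F T in G. (LINT x|M. f (Z T x)) = (LINT x|M. f (Z' T x))"
      using Z eq
    proof eventually_elim
      case (elim T)
      show ?case
        by (intro integral_cong_AE measurable_compose[OF elim(1) f_meas] measurable_compose[OF Z'[OF elim] f_meas])
           (use elim(2) in \<open>eventually_elim, simp\<close>)
    qed
    then show "((\<lambda>T. LINT x|M. f (Z' T x)) \<longlongrightarrow> (LINT z|\<mu>. f z)) G"
      using f by (intro Lim_transform_eventually[OF lim]) auto
  qed
qed

section \<open>Gaussian vectors and their squared moduli\<close>

lemma prob_space_normal_law: "0 \<le> v \<Longrightarrow> prob_space (normal_law m v)"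
  unfolding normal_law_def by (auto intro: prob_space_normal_density prob_space_return)

lemma sets_normal_law[simp, measurable_cong]: "sets (normal_law m v) = sets borel"
  by (simp add: normal_law_def)

lemma space_normal_law[simp]: "space (normal_law m v) = UNIV"
  by (simp add: normal_law_def)

lemma real_distribution_normal_law: "0 \<le> v \<Longrightarrow> real_distribution (normal_law m v)"
  using prob_space_normal_law by (auto simp: real_distribution_def real_distribution_axioms_def)

text \<open>For \<open>v = 0\<close> the law is a point mass; otherwise it is the standard normal law scaled by
  \<open>sqrt v\<close>.\<close>

lemma integral_iexp_normal_law:
  assumes "0 \<le> v"
  shows "(LINT x|normal_law 0 v. iexp (t * x)) = of_real (exp (- (v * t\<^sup>2 / 2)))"
proof (cases "v = 0")
  case True
  then show ?thesis by (simp add: normal_law_def integral_return)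
next
  case False
  then have v: "0 < v" using assms by simp
  interpret std: real_distribution std_normal_distribution by (rule real_dist_normal_dist)
  have "distributed std_normal_distribution lborel (\<lambda>x. x) (normal_density 0 1)"
    by (auto simp: distributed_def intro!: distr_id2)
  then have "distributed std_normal_distribution lborel (\<lambda>x. 0 + sqrt v * x) (normal_density (0 + sqrt v * 0) (\<bar>sqrt v\<bar> * 1))"
    using v by (intro std.normal_density_affine) auto
  then have "distr std_normal_distribution lborel (\<lambda>x. sqrt v * x) = normal_law 0 v"
    using v by (simp add: distributed_def normal_law_def)
  then have "(LINT x|normal_law 0 v. iexp (t * x)) = (LINT x|distr std_normal_distribution lborel (\<lambda>x. sqrt v * x). iexp (t * x))"
    by simp
  also have "\<dots> = (LINT x|std_normal_distribution. iexp ((t * sqrt v) * x))"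
    by (subst integral_distr) (auto simp: mult_ac)
  also have "\<dots> = char std_normal_distribution (t * sqrt v)" by (simp add: char_def)
  also have "\<dots> = of_real (exp (- (v * t\<^sup>2 / 2)))"
    using v by (simp add: char_std_normal_distribution power_mult_distrib mult.commute)
  finally show ?thesis .
qed

lemma char_normal_law: "0 \<le> v \<Longrightarrow> char (normal_law 0 v) t = of_real (exp (- (v * t\<^sup>2 / 2)))"
  unfolding char_def by (rule integral_iexp_normal_law)

text \<open>Polar coordinates in the plane reduced to their measure-theoretic content: a disc of
  squared radius \<open>a\<close> has area \<open>pi * a\<close>, so the squared norm carries planar Lebesgue measure to
  \<open>pi\<close> times Lebesgue measure on the half-line.\<close>

lemma distr_norm_square_lborel:
  "distr lborel borel (\<lambda>p :: real \<times> real. (norm p)\<^sup>2) = density lborel (\<lambda>r. ennreal pi * indicator {0..} r)"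
proof (rule measure_eqI_generator_eq[where E="range (\<lambda>a::real. {..a})" and \<Omega>=UNIV and A="\<lambda>i. {..real i}"])
  show "Int_stable (range (\<lambda>a::real. {..a}))" by (auto simp: Int_stable_def Int_atMost)
  fix B :: "real set" assume "B \<in> range (\<lambda>a. {..a})"
  then obtain a where B: "B = {..a}" by auto
  have "emeasure (distr lborel borel (\<lambda>p :: real \<times> real. (norm p)\<^sup>2)) {..a} = emeasure lborel {p :: real \<times> real. (norm p)\<^sup>2 \<le> a}"
    by (subst emeasure_distr) (auto simp: vimage_def)
  also have "\<dots> = ennreal (pi * max 0 a)"
  proof (cases "0 \<le> a")
    case True
    then have "{p :: real \<times> real. (norm p)\<^sup>2 \<le> a} = cball 0 (sqrt a)"
      by (auto simp: real_le_rsqrt) (metis norm_ge_zero power_mono real_sqrt_pow2)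
    then show ?thesis using True by (simp add: emeasure_cball unit_ball_vol_2)
  next
    case False
    then have empty: "{p :: real \<times> real. (norm p)\<^sup>2 \<le> a} = {}" by (auto dest: order_trans[OF zero_le_power2])
    show ?thesis unfolding empty using False by simp
  qed
  also have "\<dots> = emeasure (density lborel (\<lambda>r. ennreal pi * indicator {0..} r)) {..a}"
  proof -
    have "emeasure (density lborel (\<lambda>r. ennreal pi * indicator {0..} r)) {..a} = (\<integral>\<^sup>+r. ennreal pi * indicator {0..a} r \<partial>lborel)"
      by (subst emeasure_density) (auto intro!: nn_integral_cong simp: indicator_def)
    also have "\<dots> = ennreal pi * emeasure lborel {0..a}" by (rule nn_integral_cmult_indicator) simp
    also have "\<dots> = ennreal (pi * max 0 a)" by (cases "0 \<le> a") (auto simp: ennreal_mult)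
    finally show ?thesis ..
  qed
  finally show "emeasure (distr lborel borel (\<lambda>p :: real \<times> real. (norm p)\<^sup>2)) B
      = emeasure (density lborel (\<lambda>r. ennreal pi * indicator {0..} r)) B"
    unfolding B .
next
  fix i :: nat
  have "emeasure (distr lborel borel (\<lambda>p :: real \<times> real. (norm p)\<^sup>2)) {..real i} = emeasure lborel {p :: real \<times> real. (norm p)\<^sup>2 \<le> real i}"
    by (subst emeasure_distr) (auto simp: vimage_def)
  also have "{p :: real \<times> real. (norm p)\<^sup>2 \<le> real i} = cball 0 (sqrt (real i))"
    by (auto simp: real_le_rsqrt) (metis norm_ge_zero power_mono real_sqrt_pow2 of_nat_0_le_iff)
  finally show "emeasure (distr lborel borel (\<lambda>p :: real \<times> real. (norm p)\<^sup>2)) {..real i} \<noteq> \<infinity>"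
    by (simp add: emeasure_cball)
qed (auto simp: borel_eq_atMost intro: real_arch_simple)

abbreviation normal_pair :: "real \<Rightarrow> (real \<times> real) measure" where
  "normal_pair v \<equiv> normal_law 0 v \<Otimes>\<^sub>M normal_law 0 v"

lemma prob_space_normal_pair: 
  assumes "0 \<le> v" shows "prob_space (normal_pair v)"
proof -
  interpret N: prob_space "normal_law 0 v" by (rule prob_space_normal_law[OF assms])
  interpret pair_prob_space "normal_law 0 v" "normal_law 0 v" ..
  show ?thesis by unfold_locales
qed

lemma sets_normal_pair: "sets (normal_pair v) = sets borel"
proof -
  have "sets (normal_pair v) = sets (borel \<Otimes>\<^sub>M borel)" by (intro sets_pair_measure_cong) auto
  then show ?thesis unfolding borel_prod .
qed

text \<open>The density of the pair is a function of the squared norm, hence it can be moved through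
  the image of Lebesgue measure under the squared norm.\<close>

lemma distr_normal_pair:
  assumes v: "0 \<le> v"
  shows "distr (normal_pair v) borel (\<lambda>p. (norm p)\<^sup>2) = exponential_law (2 * v)"
proof (cases "v = 0")
  case True
  have "normal_pair v = return borel (0, 0)"
  proof (rule measure_eqI)
    interpret N: prob_space "normal_law 0 v" by (rule prob_space_normal_law[OF assms])
    fix A assume A: "A \<in> sets (normal_pair v)"
    have "emeasure (normal_pair v) A = (\<integral>\<^sup>+x. emeasure (normal_law 0 v) (Pair x -` A) \<partial>normal_law 0 v)"
      by (rule N.emeasure_pair_measure_alt[OF A])
    also have "\<dots> = emeasure (normal_law 0 v) (Pair 0 -` A)"
      using N.measurable_emeasure_Pair[OF A] True by (simp add: normal_law_def nn_integral_return)
    also have "\<dots> = indicator A (0, 0)"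
      using sets_Pair1[OF A, of 0] True by (simp add: normal_law_def indicator_def)
    finally show "emeasure (normal_pair v) A = emeasure (return borel (0, 0)) A"
      using A unfolding sets_normal_pair by (simp add: emeasure_return)
  qed (rule trans[OF sets_normal_pair], simp)
  then show ?thesis using True by (simp add: distr_return exponential_law_def)
next
  case False
  then have v: "0 < v" using assms by simp
  define g where "g r = ennreal (1 / (2 * pi * v) * exp (- r / (2 * v)))" for r :: real
  have [measurable]: "g \<in> borel_measurable borel" unfolding g_def by measurable
  have "sigma_finite_measure (density lborel (normal_density 0 (sqrt v)))"
    using prob_space_normal_density[of "sqrt v" 0] v prob_space_imp_sigma_finite by simp
  then have "normal_pair v = density (lborel \<Otimes>\<^sub>M lborel) (\<lambda>(x, y). ennreal (normal_density 0 (sqrt v) x) * ennreal (normal_density 0 (sqrt v) y))"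
    using v unfolding normal_law_def by (simp add: pair_measure_density lborel.sigma_finite_measure_axioms)
  also have "\<dots> = density lborel (\<lambda>p. g ((norm p)\<^sup>2))"
    unfolding lborel_prod
  proof (intro density_cong AE_I2)
    have "(\<lambda>(x, y). ennreal (normal_density 0 (sqrt v) x) * ennreal (normal_density 0 (sqrt v) y)) \<in> borel_measurable (borel \<Otimes>\<^sub>M borel)"
      by measurable
    then show "(\<lambda>(x, y). ennreal (normal_density 0 (sqrt v) x) * ennreal (normal_density 0 (sqrt v) y)) \<in> borel_measurable lborel"
      unfolding borel_prod by simp
    show "(\<lambda>p :: real \<times> real. g ((norm p)\<^sup>2)) \<in> borel_measurable lborel"
      by measurable
    fix p :: "real \<times> real"
    obtain x y where p: "p = (x, y)" by (cases p)
    have "normal_density 0 (sqrt v) x * normal_density 0 (sqrt v) y = 1 / (2 * pi * v) * exp (- (x\<^sup>2 + y\<^sup>2) / (2 * v))"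
      using v by (simp add: normal_density_def exp_add[symmetric] add_divide_distrib field_simps)
    then show "(case p of (x, y) \<Rightarrow> ennreal (normal_density 0 (sqrt v) x) * ennreal (normal_density 0 (sqrt v) y)) = g ((norm p)\<^sup>2)"
      by (simp add: p g_def norm_Pair ennreal_mult'[symmetric])
  qed
  finally have "distr (normal_pair v) borel (\<lambda>p. (norm p)\<^sup>2)
      = distr (density lborel (\<lambda>p :: real \<times> real. g ((norm p)\<^sup>2))) borel (\<lambda>p. (norm p)\<^sup>2)"
    by simp
  also have "\<dots> = density (distr lborel borel (\<lambda>p :: real \<times> real. (norm p)\<^sup>2)) g"
    by (rule density_distr[symmetric]) measurable
  also have "\<dots> = density lborel (\<lambda>r. ennreal pi * indicator {0..} r * g r)"
    unfolding distr_norm_square_lborel by (rule density_density_eq) measurable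
  also have "\<dots> = density lborel (exponential_density (1 / (2 * v)))"
  proof (intro density_cong AE_I2)
    fix r :: real
    show "ennreal pi * indicator {0..} r * g r = ennreal (exponential_density (1 / (2 * v)) r)"
      using v by (auto simp: g_def exponential_density_def indicator_def ennreal_mult'[symmetric] field_simps)
  qed measurable
  finally show ?thesis using v by (simp add: exponential_law_def)
qed

lemma integral_iexp_normal_pair:
  assumes v: "0 \<le> v"
  shows "(LINT p|normal_pair v. iexp (s * fst p + t * snd p)) = of_real (exp (- (v * (s\<^sup>2 + t\<^sup>2) / 2)))"
proof -
  interpret N: prob_space "normal_law 0 v" by (rule prob_space_normal_law[OF assms])
  interpret P: pair_prob_space "normal_law 0 v" "normal_law 0 v" ..
  have "integrable (normal_pair v) (\<lambda>p. iexp (s * fst p + t * snd p))"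
    by (rule P.integrable_iexp) auto
  then have "(LINT p|normal_pair v. iexp (s * fst p + t * snd p))
      = (LINT x|normal_law 0 v. LINT y|normal_law 0 v. iexp (s * x + t * y))"
    using P.integral_fst'[of "\<lambda>p. iexp (s * fst p + t * snd p)"] by simp
  also have "\<dots> = (LINT x|normal_law 0 v. iexp (s * x) * (LINT y|normal_law 0 v. iexp (t * y)))"
    by (simp add: distrib_left exp_add)
  also have "\<dots> = of_real (exp (- (v * s\<^sup>2 / 2))) * of_real (exp (- (v * t\<^sup>2 / 2)))"
    by (simp only: integral_iexp_normal_law[OF v] integral_mult_left_zero)
  also have "\<dots> = of_real (exp (- (v * (s\<^sup>2 + t\<^sup>2) / 2)))"
    unfolding of_real_mult[symmetric] exp_add[symmetric] by (simp add: algebra_simps add_divide_distrib)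
  finally show ?thesis .
qed

text \<open>The two coordinates that belong to one frequency are kept together as one component of
  the product; independence of the squared moduli is then independence of the components.\<close>

definition normal_pairs :: "('d::finite \<Rightarrow> real) \<Rightarrow> ('d \<Rightarrow> real \<times> real) measure" where
  "normal_pairs v = PiM UNIV (\<lambda>j. normal_pair (v j))"

definition pairs_vector :: "('d::finite \<Rightarrow> real \<times> real) \<Rightarrow> real ^ ('d \<times> 2)" where
  "pairs_vector f = (\<chi> k. if snd k = 1 then fst (f (fst k)) else snd (f (fst k)))"

definition gaussian_law :: "('d::finite \<Rightarrow> real) \<Rightarrow> (real ^ ('d \<times> 2)) measure" where
  "gaussian_law v = distr (normal_pairs v) borel pairs_vector"

definition squared_moduli :: "real ^ ('d::finite \<times> 2) \<Rightarrow> real ^ 'd" where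
  "squared_moduli z = (\<chi> j. (vec_nth z (j, 1))\<^sup>2 + (vec_nth z (j, 2))\<^sup>2)"

context
  fixes v :: "'d::finite \<Rightarrow> real"
  assumes v: "\<And>j. 0 \<le> v j"
begin

interpretation K: product_prob_space "\<lambda>j. normal_pair (v j)" UNIV
  by (intro product_prob_spaceI prob_space_normal_pair v)

lemma prob_space_normal_pairs: "prob_space (normal_pairs v)"
  unfolding normal_pairs_def by (intro prob_space_PiM prob_space_normal_pair v)

lemma measurable_normal_pairs_component[measurable]: "(\<lambda>f. f j) \<in> normal_pairs v \<rightarrow>\<^sub>M borel"
proof -
  have "(\<lambda>f. f j) \<in> normal_pairs v \<rightarrow>\<^sub>M normal_pair (v j)" unfolding normal_pairs_def by measurable
  then show ?thesis unfolding measurable_cong_sets[OF refl sets_normal_pair] .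
qed

lemma measurable_pairs_vector[measurable]: "pairs_vector \<in> normal_pairs v \<rightarrow>\<^sub>M borel"
proof (rule borel_measurable_euclidean_space[THEN iffD2], intro ballI)
  fix i :: "real ^ ('d \<times> 2)" assume "i \<in> Basis"
  then obtain k where i: "i = axis k 1" by (auto simp: Basis_vec_def)
  have "(\<lambda>f. if snd k = 1 then fst (f (fst k)) else snd (f (fst k))) \<in> borel_measurable (normal_pairs v)"
    by (cases "snd k = 1") (auto intro!: measurable_compose[OF measurable_normal_pairs_component]
          borel_measurable_continuous_onI continuous_on_fst continuous_on_snd continuous_on_id)
  then show "(\<lambda>f. inner (pairs_vector f) i) \<in> borel_measurable (normal_pairs v)"
    by (simp add: i inner_axis pairs_vector_def)
qed

lemma prob_space_gaussian_law: "prob_space (gaussian_law v)"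
  unfolding gaussian_law_def by (rule prob_space.prob_space_distr[OF prob_space_normal_pairs]) measurable

lemma sets_gaussian_law[measurable_cong, simp]: "sets (gaussian_law v) = sets borel"
  by (simp add: gaussian_law_def)

lemma inner_pairs_vector:
  "inner u (pairs_vector f) = (\<Sum>j\<in>UNIV. vec_nth u (j, 1) * fst (f j) + vec_nth u (j, 2) * snd (f j))"
  unfolding inner_vec_def UNIV_Times_UNIV[symmetric] sum.cartesian_product' sum_2
  by (simp add: pairs_vector_def)

lemma integral_iexp_gaussian_law:
  "(LINT z|gaussian_law v. iexp (inner u z))
     = of_real (exp (- (\<Sum>j\<in>UNIV. v j * ((vec_nth u (j, 1))\<^sup>2 + (vec_nth u (j, 2))\<^sup>2) / 2)))"
proof -
  let ?f = "\<lambda>j p. iexp (vec_nth u (j, 1) * fst p + vec_nth u (j, 2) * snd p)"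
  have "(LINT z|gaussian_law v. iexp (inner u z)) = (LINT f|normal_pairs v. iexp (inner u (pairs_vector f)))"
    unfolding gaussian_law_def by (rule integral_distr) measurable
  also have "\<dots> = (LINT f|normal_pairs v. (\<Prod>j\<in>UNIV. ?f j (f j)))"
    unfolding inner_pairs_vector by (simp add: exp_sum sum_distrib_left)
  also have "\<dots> = (\<Prod>j\<in>UNIV. LINT p|normal_pair (v j). ?f j p)"
    unfolding normal_pairs_def
    by (intro K.product_integral_prod prob_space.integrable_iexp prob_space_normal_pair v) auto
  also have "\<dots> = of_real (exp (- (\<Sum>j\<in>UNIV. v j * ((vec_nth u (j, 1))\<^sup>2 + (vec_nth u (j, 2))\<^sup>2) / 2)))"
    unfolding integral_iexp_normal_pair[OF v] of_real_prod[symmetric] by (simp add: exp_sum sum_negf[symmetric])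
  finally show ?thesis .
qed

text \<open>Each linear functional has the characteristic function of the required normal law.\<close>

lemma is_multivariate_normal_gaussian_law:
  "is_multivariate_normal (gaussian_law v) 0 (diag_matrix (\<lambda>k. v (fst k)))"
  unfolding is_multivariate_normal_def
proof (intro conjI allI prob_space_gaussian_law sets_gaussian_law)
  fix u :: "real ^ ('d \<times> 2)"
  have "inner u (diag_matrix (\<lambda>k. v (fst k)) *v u) = (\<Sum>k\<in>UNIV. vec_nth u k * (v (fst k) * vec_nth u k))"
    unfolding inner_vec_def matrix_vector_mult_def diag_matrix_def
    by (simp add: if_distrib[where f="\<lambda>y. y * c" for c] cong: if_cong)
  also have "\<dots> = (\<Sum>j\<in>UNIV. v j * ((vec_nth u (j, 1))\<^sup>2 + (vec_nth u (j, 2))\<^sup>2))"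
    unfolding UNIV_Times_UNIV[symmetric] sum.cartesian_product' sum_2
    by (simp add: power2_eq_square algebra_simps)
  finally have var: "inner u (diag_matrix (\<lambda>k. v (fst k)) *v u) = \<dots>" .
  have var0: "0 \<le> inner u (diag_matrix (\<lambda>k. v (fst k)) *v u)" unfolding var using v by (intro sum_nonneg) auto
  interpret G: prob_space "gaussian_law v" by (rule prob_space_gaussian_law)
  have "distr (gaussian_law v) borel (\<lambda>z. inner u z) = normal_law 0 (inner u (diag_matrix (\<lambda>k. v (fst k)) *v u))"
  proof (rule Levy_uniqueness)
    show "real_distribution (distr (gaussian_law v) borel (\<lambda>z. inner u z))"
      by (rule G.real_distribution_distr) measurable
    show "real_distribution (normal_law 0 (inner u (diag_matrix (\<lambda>k. v (fst k)) *v u)))"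
      by (rule real_distribution_normal_law[OF var0])
    show "char (distr (gaussian_law v) borel (inner u)) = char (normal_law 0 (inner u (diag_matrix (\<lambda>k. v (fst k)) *v u)))"
    proof
      fix t
      have "char (distr (gaussian_law v) borel (inner u)) t = (LINT z|gaussian_law v. iexp (inner (t *\<^sub>R u) z))"
        unfolding char_def by (subst integral_distr) auto
      also have "\<dots> = of_real (exp (- (inner u (diag_matrix (\<lambda>k. v (fst k)) *v u) * t\<^sup>2 / 2)))"
        unfolding integral_iexp_gaussian_law var sum_distrib_right sum_divide_distrib
        by (intro arg_cong[where f="\<lambda>y. complex_of_real (exp (- y))"] sum.cong) (auto simp: power_mult_distrib field_simps)
      finally show "char (distr (gaussian_law v) borel (inner u)) t = char (normal_law 0 (inner u (diag_matrix (\<lambda>k. v (fst k)) *v u))) t"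
        unfolding char_normal_law[OF var0] .
    qed
  qed
  then show "distr (gaussian_law v) borel (\<lambda>z. inner u z) = normal_law (inner u 0) (inner u (diag_matrix (\<lambda>k. v (fst k)) *v u))"
    by simp
qed

lemma continuous_squared_moduli: "continuous_on UNIV (squared_moduli :: real ^ ('d \<times> 2) \<Rightarrow> _)"
  unfolding squared_moduli_def by (intro continuous_intros)

lemma measurable_squared_moduli[measurable]: "(squared_moduli :: real ^ ('d \<times> 2) \<Rightarrow> _) \<in> borel_measurable borel"
  by (rule borel_measurable_continuous_onI[OF continuous_squared_moduli])

lemma measurable_vec_nth[measurable]: "(\<lambda>z :: real ^ 'd. vec_nth z j) \<in> borel_measurable borel"
  by (intro borel_measurable_continuous_onI continuous_intros)

text \<open>The squared moduli are obtained from the components of a product measure one by one, so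
  their joint law is again a product measure.\<close>

lemma has_independent_coordinates_squared_moduli:
  "has_independent_coordinates (distr (gaussian_law v) borel squared_moduli) (\<lambda>j. exponential_law (2 * v j))"
proof -
  let ?\<nu> = "distr (gaussian_law v) borel squared_moduli"
  let ?\<rho> = "\<lambda>p :: real \<times> real. (norm p)\<^sup>2"
  interpret P: prob_space "normal_pairs v" by (rule prob_space_normal_pairs)
  interpret nu: prob_space ?\<nu>
    by (rule prob_space.prob_space_distr[OF prob_space_gaussian_law]) measurable
  have exp_prob: "prob_space (exponential_law (2 * v j))" for j
    unfolding distr_normal_pair[OF v, symmetric]
    by (rule prob_space.prob_space_distr[OF prob_space_normal_pair[OF v]])
       (unfold measurable_cong_sets[OF sets_normal_pair refl], measurable)
  have exp_sets: "sets (exponential_law l) = sets borel" for l by (simp add: exponential_law_def)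
  have sq: "squared_moduli (pairs_vector f) = (\<chi> j. ?\<rho> (f j))" for f :: "'d \<Rightarrow> real \<times> real"
    by (simp add: squared_moduli_def pairs_vector_def vec_eq_iff norm_prod_def)
  have nu: "?\<nu> = distr (normal_pairs v) borel (\<lambda>f. \<chi> j. ?\<rho> (f j))"
    unfolding gaussian_law_def by (subst distr_distr) (auto simp: comp_def sq)
  have [measurable]: "(\<lambda>f. \<chi> j. ?\<rho> (f j)) \<in> borel_measurable (normal_pairs v)"
    using measurable_compose[OF measurable_pairs_vector measurable_squared_moduli] unfolding sq .
  have coord: "distr ?\<nu> borel (\<lambda>z. vec_nth z j) = exponential_law (2 * v j)" for j
  proof -
    have "distr ?\<nu> borel (\<lambda>z. vec_nth z j) = distr (normal_pairs v) borel (\<lambda>f. ?\<rho> (f j))"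
      unfolding nu by (subst distr_distr) (auto simp: comp_def)
    also have "\<dots> = distr (distr (normal_pairs v) (normal_pair (v j)) (\<lambda>f. f j)) borel ?\<rho>"
    proof (subst distr_distr)
      show "?\<rho> \<in> normal_pair (v j) \<rightarrow>\<^sub>M borel"
        unfolding measurable_cong_sets[OF sets_normal_pair refl] by measurable
      show "(\<lambda>f. f j) \<in> normal_pairs v \<rightarrow>\<^sub>M normal_pair (v j)" unfolding normal_pairs_def by measurable
    qed (simp add: comp_def)
    also have "distr (normal_pairs v) (normal_pair (v j)) (\<lambda>f. f j) = normal_pair (v j)"
      unfolding normal_pairs_def by (rule distr_PiM_component[OF prob_space_normal_pair[OF v]]) simp
    finally show ?thesis by (simp add: distr_normal_pair[OF v])
  qed
  have "nu.indep_vars (\<lambda>_. borel) (\<lambda>j z. vec_nth z j) UNIV"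
  proof (subst nu.indep_vars_iff_distr_eq_PiM')
    have m: "?\<rho> \<in> normal_pair (v j) \<rightarrow>\<^sub>M exponential_law (2 * v j)" for j
      unfolding measurable_cong_sets[OF sets_normal_pair exp_sets] by measurable
    have "distr ?\<nu> (\<Pi>\<^sub>M i\<in>UNIV. borel) (\<lambda>z. \<lambda>i\<in>UNIV. vec_nth z i)
        = distr (normal_pairs v) (\<Pi>\<^sub>M i\<in>UNIV. borel) (compose UNIV ?\<rho>)"
    proof (unfold nu, subst distr_distr)
      show "(\<lambda>z :: real ^ 'd. \<lambda>i\<in>UNIV. vec_nth z i) \<in> borel \<rightarrow>\<^sub>M (\<Pi>\<^sub>M i\<in>UNIV. borel)"
        by (rule measurable_restrict) measurable
      show "distr (normal_pairs v) (\<Pi>\<^sub>M i\<in>UNIV. borel) ((\<lambda>z. \<lambda>i\<in>UNIV. vec_nth z i) \<circ> (\<lambda>f. \<chi> j. (norm (f j))\<^sup>2))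
          = distr (normal_pairs v) (\<Pi>\<^sub>M i\<in>UNIV. borel) (compose UNIV ?\<rho>)"
        by (intro distr_cong refl) (simp add: compose_def fun_eq_iff)
    qed measurable
    also have "\<dots> = distr (normal_pairs v) (\<Pi>\<^sub>M j\<in>UNIV. exponential_law (2 * v j)) (compose UNIV ?\<rho>)"
      by (intro distr_cong refl sets_PiM_cong) (auto simp: exp_sets)
    also have "\<dots> = (\<Pi>\<^sub>M j\<in>UNIV. distr (normal_pair (v j)) (exponential_law (2 * v j)) ?\<rho>)"
      unfolding normal_pairs_def
      by (rule distr_PiM_finite_prob_space') (auto intro: prob_space_normal_pair v exp_prob m)
    also have "\<dots> = (\<Pi>\<^sub>M j\<in>UNIV. distr ?\<nu> borel (\<lambda>z. vec_nth z j))"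
    proof (rule PiM_cong[OF refl])
      fix j
      have "distr (normal_pair (v j)) (exponential_law (2 * v j)) ?\<rho> = distr (normal_pair (v j)) borel ?\<rho>"
        by (intro distr_cong refl exp_sets)
      then show "distr (normal_pair (v j)) (exponential_law (2 * v j)) ?\<rho> = distr ?\<nu> borel (\<lambda>z. vec_nth z j)"
        by (simp only: coord distr_normal_pair[OF v])
    qed
    finally show "distr ?\<nu> (\<Pi>\<^sub>M i\<in>UNIV. borel) (\<lambda>z. \<lambda>i\<in>UNIV. vec_nth z i) = (\<Pi>\<^sub>M j\<in>UNIV. distr ?\<nu> borel (\<lambda>z. vec_nth z j))" .
  qed auto
  then show ?thesis
    unfolding has_independent_coordinates_def using coord nu.prob_space_axioms by simp
qed

end

text \<open>Linear functionals of the vector of real and imaginary parts in complex form; their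
  coefficients play the role of amplitudes below.\<close>

lemma inner_re_im_vector:
  "inner u (re_im_vector c) = Re (\<Sum>j\<in>UNIV. cnj (Complex (vec_nth u (j, 1)) (vec_nth u (j, 2))) * c j)"
proof -
  have "inner u (re_im_vector c) = (\<Sum>j\<in>UNIV. vec_nth u (j, 1) * Re (c j) + vec_nth u (j, 2) * Im (c j))"
    unfolding inner_vec_def UNIV_Times_UNIV[symmetric] sum.cartesian_product' sum_2
    by (simp add: re_im_vector_def)
  then show ?thesis by simp
qed

lemma squared_moduli_re_im_vector: "squared_moduli (re_im_vector c) = (\<chi> j. (cmod (c j))\<^sup>2)"
  by (simp add: squared_moduli_def re_im_vector_def vec_eq_iff cmod_power2)

lemma measurable_re_im_vector:
  fixes c :: "'a \<Rightarrow> 'd::finite \<Rightarrow> complex"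
  assumes "\<And>j. (\<lambda>x. c x j) \<in> borel_measurable M"
  shows "(\<lambda>x. re_im_vector (c x)) \<in> borel_measurable M"
proof (rule borel_measurable_euclidean_space[THEN iffD2], intro ballI)
  fix i :: "real ^ ('d \<times> 2)" assume "i \<in> Basis"
  then obtain k where i: "i = axis k 1" by (auto simp: Basis_vec_def)
  note [measurable] = assms
  have "(\<lambda>x. if snd k = 1 then Re (c x (fst k)) else Im (c x (fst k))) \<in> borel_measurable M"
    by (cases "snd k = 1") auto
  then show "(\<lambda>x. inner (re_im_vector (c x)) i) \<in> borel_measurable M"
    by (simp add: i inner_axis re_im_vector_def)
qed

section \<open>Square-integrable Levy processes\<close>

text \<open>Cauchy's functional equation. After subtraction of the linear function, the remainder
  vanishes at all naturals; it is therefore periodic with period one, and bounded on \<open>[0, 1]\<close>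
  since local bounds extend by additivity. A bounded additive function vanishes. The lemma is
  applied to the mean and to the variance of \<open>L(t)\<close>.\<close>

lemma additive_locally_bounded_imp_linear:
  fixes f :: "real \<Rightarrow> real"
  assumes add: "\<And>s t. 0 \<le> s \<Longrightarrow> 0 \<le> t \<Longrightarrow> f (s + t) = f s + f t"
    and "0 < \<delta>" and bdd: "\<And>h. 0 \<le> h \<Longrightarrow> h \<le> \<delta> \<Longrightarrow> \<bar>f h\<bar> \<le> C"
    and t: "0 \<le> t"
  shows "f t = t * f 1"
proof -
  define g where "g t = f t - t * f 1" for t
  have g_add: "g (s + t) = g s + g t" if "0 \<le> s" "0 \<le> t" for s t
    using add[OF that] by (simp add: g_def algebra_simps)
  have f_mult: "g (real n * h) = real n * g h" if "0 \<le> h" for n h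
  proof (induction n)
    case 0
    show ?case using g_add[of 0 0] by simp
  next
    case (Suc n)
    then show ?case using g_add[of h "real n * h"] that by (simp add: algebra_simps)
  qed
  have g_nat: "g (real n) = 0" for n using f_mult[of 1 n] by (simp add: g_def)
  obtain k :: nat where k: "k > 0" "1 / \<delta> \<le> real k"
    by (metis less_eq_real_def not_gr_zero of_nat_0_less_iff reals_Archimedean2 order_trans zero_less_divide_1_iff \<open>0 < \<delta>\<close> less_le_trans)
  define D where "D = real k * (C + \<delta> * \<bar>f 1\<bar>)"
  have g_bdd: "\<bar>g x\<bar> \<le> D" if x: "0 \<le> x" "x \<le> 1" for x
  proof -
    have "x / k \<le> 1 / k" using x by (simp add: divide_right_mono)
    also have "1 / k \<le> \<delta>" using k \<open>0 < \<delta>\<close> by (simp add: field_simps)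
    finally have xk: "0 \<le> x / k" "x / k \<le> \<delta>" using x by auto
    have "\<bar>g (x / k)\<bar> \<le> \<bar>f (x / k)\<bar> + \<bar>(x / k) * f 1\<bar>" unfolding g_def by (rule abs_triangle_ineq4)
    also have "\<dots> \<le> C + \<delta> * \<bar>f 1\<bar>"
      unfolding abs_mult using xk bdd[OF xk] by (intro add_mono mult_mono) auto
    finally have "real k * \<bar>g (x / k)\<bar> \<le> D" unfolding D_def by (rule mult_left_mono) simp
    moreover have "g x = real k * g (x / k)" using f_mult[OF xk(1), of k] k by simp
    ultimately show ?thesis by (simp add: abs_mult)
  qed
  have n_bdd: "real n * \<bar>g t\<bar> \<le> D" for n
  proof -
    define y where "y = real n * t"
    have y: "0 \<le> y" using t by (simp add: y_def)
    have "g y = g (frac y + real (nat \<lfloor>y\<rfloor>))" using y by (simp add: frac_def)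
    also have "\<dots> = g (frac y)" using g_add[of "frac y" "real (nat \<lfloor>y\<rfloor>)"] by (simp add: g_nat)
    finally have "\<bar>g y\<bar> \<le> D" using g_bdd[of "frac y"] frac_lt_1[of y] by simp
    then show ?thesis using f_mult[OF t, of n] by (simp add: y_def abs_mult)
  qed
  have "g t = 0"
  proof (rule ccontr)
    assume "g t \<noteq> 0"
    then obtain n :: nat where "D < real n * \<bar>g t\<bar>"
      using reals_Archimedean3[of "\<bar>g t\<bar>"] by auto
    then show False using n_bdd[of n] by simp
  qed
  then show ?thesis by (simp add: g_def)
qed

lemma integrable_square_add:
  fixes X Y :: "'a \<Rightarrow> real"
  assumes [measurable]: "X \<in> borel_measurable M" "Y \<in> borel_measurable M"
    and "integrable M (\<lambda>x. (X x)\<^sup>2)" "integrable M (\<lambda>x. (Y x)\<^sup>2)"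
  shows "integrable M (\<lambda>x. (X x + Y x)\<^sup>2)"
proof (rule Bochner_Integration.integrable_bound)
  show "integrable M (\<lambda>x. 2 * (X x)\<^sup>2 + 2 * (Y x)\<^sup>2)" using assms by simp
  have "(x + y)\<^sup>2 \<le> 2 * x\<^sup>2 + 2 * y\<^sup>2" for x y :: real
    using zero_le_power2[of "x - y"] by (simp add: power2_sum power2_diff)
  then show "AE x in M. norm ((X x + Y x)\<^sup>2) \<le> norm (2 * (X x)\<^sup>2 + 2 * (Y x)\<^sup>2)"
    by simp
qed simp

text \<open>By Fubini, \<open>(d + X)\<^sup>2\<close> is integrable for almost every value \<open>d\<close> of \<open>D\<close>, so for at least
  one, and a constant shift does not affect square integrability.\<close>

lemma (in prob_space) square_integrable_indep_summand:
  fixes D X :: "'a \<Rightarrow> real"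
  assumes indep: "indep_var borel D borel X" and int: "integrable M (\<lambda>x. (D x + X x)\<^sup>2)"
  shows "integrable M (\<lambda>x. (X x)\<^sup>2)"
proof -
  have [measurable]: "D \<in> borel_measurable M" "X \<in> borel_measurable M"
    using indep indep_var_rv1 indep_var_rv2 by blast+
  interpret D: prob_space "distr M borel D" by (rule prob_space_distr) measurable
  interpret X: prob_space "distr M borel X" by (rule prob_space_distr) measurable
  interpret P: pair_prob_space "distr M borel D" "distr M borel X" ..
  have "integrable (distr M (borel \<Otimes>\<^sub>M borel) (\<lambda>x. (D x, X x))) (\<lambda>p. (fst p + snd p)\<^sup>2)"
    using int by (subst integrable_distr_eq) auto
  also have "distr M (borel \<Otimes>\<^sub>M borel) (\<lambda>x. (D x, X x)) = distr M borel D \<Otimes>\<^sub>M distr M borel X"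
    using indep by (simp add: indep_var_distribution_eq)
  finally have "AE d in distr M borel D. integrable (distr M borel X) (\<lambda>x. (d + x)\<^sup>2)"
    using P.AE_integrable_fst' by fastforce
  then have "\<exists>d. integrable (distr M borel X) (\<lambda>x. (d + x)\<^sup>2)"
    by (rule contrapos_pp) (simp add: D.AE_False)
  then obtain d where "integrable (distr M borel X) (\<lambda>x. (d + x)\<^sup>2)" ..
  then have int_d: "integrable M (\<lambda>x. (d + X x)\<^sup>2)" by (simp add: integrable_distr_eq)
  have "integrable M (\<lambda>x. ((d + X x) + (- d))\<^sup>2)"
    by (rule integrable_square_add) (use int_d in auto)
  then show ?thesis by simp
qed

locale centered_levy_process = levy_process +
  fixes \<sigma> :: real
  assumes integrable_L1: "integrable M (L 1)" and mean_L1: "(LINT x|M. L 1 x) = 0"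
    and square_integrable_L1: "integrable M (\<lambda>x. (L 1 x)\<^sup>2)"
    and variance_L1: "(LINT x|M. (L 1 x)\<^sup>2) = \<sigma>\<^sup>2"

context levy_process
begin

lemma measurable_L: "0 \<le> t \<Longrightarrow> L t \<in> borel_measurable M"
  using adapted filtration_subalgebra measurable_from_subalg by blast

lemma adapted_later: "0 \<le> s \<Longrightarrow> s \<le> t \<Longrightarrow> L s \<in> borel_measurable (F t)"
  using adapted[of s] filtration_mono[of s t] filtration_subalgebra[of s] filtration_subalgebra[of t]
  unfolding measurable_def subalgebra_def by auto

lemma indep_increment:
  assumes "0 \<le> s" "s \<le> t" and Y: "Y \<in> borel_measurable (F s)"
  shows "indep_var borel Y borel (\<lambda>x. L t x - L s x)"
proof -
  have [measurable]: "L s \<in> borel_measurable M" "L t \<in> borel_measurable M"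
    using assms by (auto intro: measurable_L)
  have sub: "subalgebra M (F s)" using filtration_subalgebra assms by simp
  have "sigma_sets (space M) {Y -` A \<inter> space M |A. A \<in> sets borel} \<subseteq> sets (F s)"
  proof -
    have "{Y -` A \<inter> space (F s) |A. A \<in> sets borel} \<subseteq> sets (F s)"
      using Y by (auto simp: measurable_def)
    then have "sigma_sets (space (F s)) {Y -` A \<inter> space (F s) |A. A \<in> sets borel} \<subseteq> sets (F s)"
      by (rule sets.sigma_sets_subset)
    then show ?thesis using sub by (simp add: subalgebra_def)
  qed
  then have "indep_set (sigma_sets (space M) {Y -` A \<inter> space M |A. A \<in> sets borel})
      (sets (vimage_algebra (space M) (\<lambda>x. L t x - L s x) borel))"
    using independent_increments[OF assms(1,2)] unfolding indep_sets2_eq by blast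
  then show ?thesis
    unfolding indep_var_eq sets_vimage_algebra 
    using measurable_from_subalg[OF sub Y] by simp
qed

lemma integral_increment:
  fixes f :: "real \<Rightarrow> 'c::{banach, second_countable_topology}"
  assumes "0 \<le> s" "s \<le> t" and f[measurable]: "f \<in> borel_measurable borel"
  shows "(LINT x|M. f (L t x - L s x)) = (LINT x|M. f (L (t - s) x))"
    and "integrable M (\<lambda>x. f (L t x - L s x)) \<longleftrightarrow> integrable M (\<lambda>x. f (L (t - s) x))"
proof -
  have [measurable]: "L s \<in> borel_measurable M" "L t \<in> borel_measurable M" "L (t - s) \<in> borel_measurable M"
    using assms by (auto intro: measurable_L)
  note eq = stationary_increments[OF assms(1,2)]
  show "(LINT x|M. f (L t x - L s x)) = (LINT x|M. f (L (t - s) x))"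
    using arg_cong[OF eq, of "\<lambda>N. integral\<^sup>L N f"] by (simp add: integral_distr)
  show "integrable M (\<lambda>x. f (L t x - L s x)) \<longleftrightarrow> integrable M (\<lambda>x. f (L (t - s) x))"
    using arg_cong[OF eq, of "\<lambda>N. integrable N f"] by (simp add: integrable_distr_eq)
qed

text \<open>The characteristic function of \<open>L t\<close>.\<close>

definition \<phi> :: "real \<Rightarrow> real \<Rightarrow> complex" where
  "\<phi> t u = (LINT x|M. iexp (u * L t x))"

lemma \<phi>_char: "0 \<le> t \<Longrightarrow> \<phi> t = char (distr M borel (L t))"
  by (auto simp: fun_eq_iff \<phi>_def char_def integral_distr measurable_L)

lemma iexp_add_increment:
  assumes "0 \<le> s" "s \<le> t" and Y: "Y \<in> borel_measurable (F s)"
  shows "(LINT x|M. iexp (Y x + c * (L t x - L s x))) = (LINT x|M. iexp (Y x)) * \<phi> (t - s) c"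
proof -
  have [measurable]: "L s \<in> borel_measurable M" "L t \<in> borel_measurable M" "Y \<in> borel_measurable M"
    using assms measurable_from_subalg[OF filtration_subalgebra Y] by (auto intro: measurable_L)
  have "(LINT x|M. iexp (Y x + c * (L t x - L s x))) = (LINT x|M. iexp (Y x) * iexp (c * (L t x - L s x)))"
    by (simp add: distrib_left exp_add)
  also have "\<dots> = (LINT x|M. iexp (Y x)) * (LINT x|M. iexp (c * (L t x - L s x)))"
  proof (rule indep_var_lebesgue_integral)
    have "indep_var borel (iexp \<circ> Y) borel ((\<lambda>y. iexp (c * y)) \<circ> (\<lambda>x. L t x - L s x))"
      by (rule indep_var_compose[OF indep_increment[OF assms]]) measurable
    then show "indep_var borel (\<lambda>x. iexp (Y x)) borel (\<lambda>x. iexp (c * (L t x - L s x)))"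
      by (simp add: comp_def)
  qed (intro integrable_iexp; simp)+
  also have "(LINT x|M. iexp (c * (L t x - L s x))) = \<phi> (t - s) c"
    unfolding \<phi>_def using integral_increment(1)[OF assms(1,2), of "\<lambda>y. iexp (c * y)"] by simp
  finally show ?thesis .
qed

lemma \<phi>_add:
  assumes "0 \<le> s" "0 \<le> t"
  shows "\<phi> (s + t) u = \<phi> s u * \<phi> t u"
  using iexp_add_increment[of s "s + t" "\<lambda>x. u * L s x" u] assms adapted[of s]
  by (simp add: \<phi>_def algebra_simps)

lemma \<phi>_0: "\<phi> 0 u = 1"
proof -
  have [measurable]: "L 0 \<in> borel_measurable M" by (rule measurable_L) simp
  have "\<phi> 0 u = (LINT x|M. 1)"
    unfolding \<phi>_def using starts_at_zero by (intro integral_cong_AE) auto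
  then show ?thesis by (simp add: prob_space)
qed

text \<open>Independence is only given between an increment and the past, so the product is built up
  from the left, one increment at a time.\<close>

lemma iexp_increments:
  assumes h: "0 \<le> h"
  shows "(LINT x|M. iexp (\<Sum>k<n. c k * (L (real (Suc k) * h) x - L (real k * h) x))) = (\<Prod>k<n. \<phi> h (c k))"
proof (induction n)
  case 0
  show ?case by (simp add: prob_space)
next
  case (Suc n)
  have *: "0 \<le> real n * h" "real n * h \<le> real (Suc n) * h" using h by (auto intro: mult_right_mono)
  have "L (real k * h) \<in> borel_measurable (F (real n * h))" if "k \<le> n" for k
    using h that by (intro adapted_later) (auto intro: mult_right_mono)
  then have "(\<lambda>x. \<Sum>k<n. c k * (L (real (Suc k) * h) x - L (real k * h) x)) \<in> borel_measurable (F (real n * h))"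
    by (intro borel_measurable_sum borel_measurable_times borel_measurable_const borel_measurable_diff)
       (auto simp del: of_nat_Suc)
  note step = iexp_add_increment[OF * this, of "c n"]
  have "real (Suc n) * h - real n * h = h" by (simp add: algebra_simps)
  then show ?case
    unfolding sum.lessThan_Suc prod.lessThan_Suc step Suc.IH by (simp only:)
qed

end

context centered_levy_process
begin

text \<open>At integer times \<open>L(n)\<close> is a sum of copies of \<open>L(1)\<close>. At other times \<open>L(t)\<close> has the law
  of the last increment of \<open>L(n)\<close> for some \<open>n \<ge> t\<close>.\<close>

lemma square_integrable_L:
  assumes "0 \<le> t" shows "integrable M (\<lambda>x. (L t x)\<^sup>2)"
proof -
  have nat: "integrable M (\<lambda>x. (L (real n) x)\<^sup>2)" for n
  proof (induction n)
    case 0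
    have "integrable M (\<lambda>x. (L 0 x)\<^sup>2) \<longleftrightarrow> integrable M (\<lambda>x. 0 :: real)"
      using starts_at_zero by (intro integrable_cong_AE) (auto intro: borel_measurable_power measurable_L)
    then show ?case by simp
  next
    case (Suc n)
    have [measurable]: "L (real n) \<in> borel_measurable M" "L (real (Suc n)) \<in> borel_measurable M"
      by (auto intro: measurable_L)
    have "integrable M (\<lambda>x. (L (real (Suc n)) x - L (real n) x)\<^sup>2)"
      using integral_increment(2)[of "real n" "real (Suc n)" "\<lambda>y. y\<^sup>2"] square_integrable_L1 by simp
    with Suc have "integrable M (\<lambda>x. ((L (real (Suc n)) x - L (real n) x) + L (real n) x)\<^sup>2)"
      by (subst integrable_square_add) (simp_all del: of_nat_Suc)
    then show ?case by (simp del: of_nat_Suc)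
  qed
  define n where "n = nat \<lceil>t\<rceil>"
  have n: "t \<le> real n" using assms by (simp add: n_def)
  have r: "0 \<le> real n - t" "real n - t \<le> real n" "real n - (real n - t) = t" using n assms by auto
  have "integrable M (\<lambda>x. (L (real n) x - L (real n - t) x)\<^sup>2)"
  proof (rule square_integrable_indep_summand)
    show "indep_var borel (L (real n - t)) borel (\<lambda>x. L (real n) x - L (real n - t) x)"
      using r by (intro indep_increment adapted)
    show "integrable M (\<lambda>x. (L (real n - t) x + (L (real n) x - L (real n - t) x))\<^sup>2)"
      using nat[of n] by simp
  qed
  then show ?thesis
    unfolding integral_increment(2)[OF r(1,2), of "\<lambda>y. y\<^sup>2", simplified] r(3) .
qed

lemma integrable_L: "0 \<le> t \<Longrightarrow> integrable M (L t)"
  by (rule square_integrable_imp_integrable[OF _ square_integrable_L]) (auto intro: measurable_L)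

lemma mean_add:
  assumes "0 \<le> s" "0 \<le> t"
  shows "expectation (L (s + t)) = expectation (L s) + expectation (L t)"
proof -
  have "expectation (\<lambda>x. L (s + t) x - L s x) = expectation (L t)"
    using integral_increment(1)[of s "s + t" "\<lambda>y. y"] assms by simp
  then show ?thesis using integrable_L[of s] integrable_L[of "s + t"] assms by simp
qed

lemma variance_add:
  assumes "0 \<le> s" "0 \<le> t"
  shows "variance (L (s + t)) = variance (L s) + variance (L t)"
proof -
  let ?D = "\<lambda>x. L (s + t) x - L s x"
  have st: "s \<le> s + t" using assms by simp
  have indep: "indep_var borel (L s) borel ?D"
    by (rule indep_increment) (use assms adapted in auto)
  have D: "integrable M ?D" "integrable M (\<lambda>x. (?D x)\<^sup>2)"
    using integral_increment(2)[OF assms(1) st, of "\<lambda>y. y"] integral_increment(2)[OF assms(1) st, of "\<lambda>y. y\<^sup>2"]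
      integrable_L[OF assms(2)] square_integrable_L[OF assms(2)] by simp_all
  have ED: "expectation ?D = expectation (L t)" "expectation (\<lambda>x. (?D x)\<^sup>2) = expectation (\<lambda>x. (L t x)\<^sup>2)"
    using integral_increment(1)[OF assms(1) st, of "\<lambda>y. y"] integral_increment(1)[OF assms(1) st, of "\<lambda>y. y\<^sup>2"]
    by simp_all
  have s: "integrable M (L s)" "integrable M (\<lambda>x. (L s x)\<^sup>2)" 
    using integrable_L square_integrable_L assms by auto
  have st': "integrable M (L (s + t))" "integrable M (\<lambda>x. (L (s + t) x)\<^sup>2)" 
    using integrable_L square_integrable_L assms by auto
  have mix: "integrable M (\<lambda>x. L s x * ?D x)" "expectation (\<lambda>x. L s x * ?D x) = expectation (L s) * expectation ?D"
    using indep_var_integrable[OF indep s(1) D(1)] indep_var_lebesgue_integral[OF indep s(1) D(1)] by auto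
  have "expectation (\<lambda>x. (L (s + t) x)\<^sup>2) = expectation (\<lambda>x. (L s x)\<^sup>2 + (2 * (L s x * ?D x) + (?D x)\<^sup>2))"
    by (rule Bochner_Integration.integral_cong) (auto simp: power2_eq_square algebra_simps)
  also have "\<dots> = expectation (\<lambda>x. (L s x)\<^sup>2) + (2 * (expectation (L s) * expectation ?D) + expectation (\<lambda>x. (?D x)\<^sup>2))"
    by (simp only: Bochner_Integration.integral_add integrable_mult_right Bochner_Integration.integrable_add integral_mult_right_zero s D mix)
  finally have "expectation (\<lambda>x. (L (s + t) x)\<^sup>2) = \<dots>" .
  note second_moment = this[unfolded ED]
  have V: "variance (L r) = expectation (\<lambda>x. (L r x)\<^sup>2) - (expectation (L r))\<^sup>2" if "0 \<le> r" for r
    using that by (intro variance_eq integrable_L square_integrable_L)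
  have st0: "0 \<le> s + t" using assms by simp
  show ?thesis
    unfolding V[OF st0] V[OF assms(1)] V[OF assms(2)]
    unfolding second_moment mean_add[OF assms] by (simp add: power2_sum)
qed

lemma variance_mono:
  assumes "0 \<le> s" "s \<le> t" shows "variance (L s) \<le> variance (L t)"
  using variance_add[of s "t - s"] assms variance_positive[of "L (t - s)"] by simp

text \<open>The mean is additive in \<open>t\<close>, so it suffices to bound it near \<open>0\<close>. By Chebyshev's
  inequality \<open>L(s)\<close> is within \<open>a\<close> of its mean with probability more than one half, and by
  stochastic continuity it is within \<open>1\<close> of \<open>0\<close> with probability more than one half; both
  happen at once with positive probability.\<close>

lemma mean_L: 
  assumes "0 \<le> t" shows "expectation (L t) = 0"
proof -
  \<comment> \<open>Any \<open>a\<close> with \<open>\<sigma>\<^sup>2 / a\<^sup>2 < 1/2\<close> would do.\<close>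
  define a where "a = 2 * \<bar>\<sigma>\<bar> + 1"
  have a: "a > 0" "\<sigma>\<^sup>2 / a\<^sup>2 < 1/2"
  proof -
    show "a > 0" by (simp add: a_def)
    have "a\<^sup>2 = 2 * \<sigma>\<^sup>2 + (2 * \<sigma>\<^sup>2 + 4 * \<bar>\<sigma>\<bar> + 1)"
      by (simp add: a_def power2_sum power_mult_distrib)
    then have "2 * \<sigma>\<^sup>2 < a\<^sup>2" using zero_le_power2[of \<sigma>] by linarith
    then show "\<sigma>\<^sup>2 / a\<^sup>2 < 1/2" using \<open>a > 0\<close> by (simp add: divide_simps)
  qed
  have "((\<lambda>s. prob {x \<in> space M. 1 < \<bar>L s x - L 0 x\<bar>}) \<longlongrightarrow> 0) (at 0 within {0..})"
    by (rule stochastically_continuous) auto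
  then have "\<forall>\<^sub>F s in at 0 within {0..}. prob {x \<in> space M. 1 < \<bar>L s x - L 0 x\<bar>} < 1/2"
    by (rule order_tendstoD) simp
  then obtain \<delta> where \<delta>: "\<delta> > 0" 
    "\<And>s. 0 < s \<Longrightarrow> s < \<delta> \<Longrightarrow> prob {x \<in> space M. 1 < \<bar>L s x - L 0 x\<bar>} < 1/2"
    unfolding eventually_at by (auto simp: dist_real_def)
  have mean0: "expectation (L 0) = 0" using mean_add[of 0 0] by simp
  have bdd: "\<bar>expectation (L s)\<bar> \<le> a + 1" if s: "0 \<le> s" "s \<le> min (\<delta>/2) 1" for s
  proof (cases "s = 0")
    case True then show ?thesis using mean0 a by simp
  next
    case False
    have [measurable]: "L s \<in> borel_measurable M" "L 0 \<in> borel_measurable M" using s by (auto intro: measurable_L)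
    let ?A = "{x \<in> space M. 1 < \<bar>L s x - L 0 x\<bar>}" and ?B = "{x \<in> space M. a \<le> \<bar>L s x - expectation (L s)\<bar>}"
    have A: "prob ?A < 1/2" using \<delta> s False by auto
    have "prob ?B \<le> variance (L s) / a\<^sup>2"
      using s a by (intro Chebyshev_inequality square_integrable_L) auto
    also have "\<dots> \<le> \<sigma>\<^sup>2 / a\<^sup>2"
      using variance_mono[of s 1] s a by (intro divide_right_mono) (auto simp: mean_L1 variance_L1)
    also have "\<dots> < 1/2" by (rule a)
    finally have B: "prob ?B < 1/2" .
    have "prob (?A \<union> ?B) \<le> prob ?A + prob ?B" by (rule measure_Un_le) auto
    then have lt: "prob (?A \<union> ?B) < 1" using A B by linarith
    have "\<not> (AE x in M. x \<in> ?A \<union> ?B)"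
    proof
      assume "AE x in M. x \<in> ?A \<union> ?B"
      then have "prob (?A \<union> ?B) = 1" by (subst prob_eq_1) auto
      then show False using lt by simp
    qed
    moreover have "AE x in M. x \<in> ?A \<union> ?B" if "\<forall>x\<in>space M. L 0 x = 0 \<longrightarrow> x \<in> ?A \<union> ?B"
      using starts_at_zero AE_space by eventually_elim (use that in blast)
    ultimately obtain x where "x \<in> space M" "x \<notin> ?A \<union> ?B" "L 0 x = 0"
      by blast
    then show ?thesis by auto
  qed
  have "expectation (L t) = t * expectation (L 1)"
    by (rule additive_locally_bounded_imp_linear[where f="\<lambda>t. expectation (L t)" and \<delta>="min (\<delta>/2) 1", OF mean_add _ bdd])
       (use \<delta> assms in auto)
  then show ?thesis by (simp add: mean_L1)
qed

lemma second_moment_L: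
  assumes "0 \<le> t" shows "expectation (\<lambda>x. (L t x)\<^sup>2) = \<sigma>\<^sup>2 * t"
proof -
  have "variance (L t) = t * variance (L 1)"
  proof (rule additive_locally_bounded_imp_linear[where f="\<lambda>t. variance (L t)" and \<delta>=1 and C="\<sigma>\<^sup>2", OF variance_add])
    fix h :: real assume h: "0 \<le> h" "h \<le> 1"
    then show "\<bar>variance (L h)\<bar> \<le> \<sigma>\<^sup>2"
      using variance_mono[OF h] variance_positive[of "L h"] by (simp add: mean_L1 variance_L1 abs_of_nonneg)
  qed (use assms in auto)
  then show ?thesis using mean_L[OF assms] by (simp add: mean_L1 variance_L1 mult.commute)
qed

lemma first_absolute_moment_increment:
  assumes "0 \<le> s" "s \<le> t"
  shows "integrable M (\<lambda>x. L t x - L s x)" 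
    and "expectation (\<lambda>x. \<bar>L t x - L s x\<bar>) \<le> \<bar>\<sigma>\<bar> * sqrt (t - s)"
proof -
  have ts: "0 \<le> t - s" using assms by simp
  show "integrable M (\<lambda>x. L t x - L s x)"
    using integrable_L[of s] integrable_L[of t] assms by simp
  have sq: "integrable M (\<lambda>x. \<bar>L (t - s) x\<bar> ^ 2)" using square_integrable_L[OF ts] by simp
  have ab: "integrable M (\<lambda>x. \<bar>L (t - s) x\<bar>)" using integrable_L[OF ts] by (rule integrable_abs)
  have "(expectation (\<lambda>x. \<bar>L (t - s) x\<bar>))\<^sup>2 \<le> expectation (\<lambda>x. \<bar>L (t - s) x\<bar> ^ 2)"
    using variance_positive[of "\<lambda>x. \<bar>L (t - s) x\<bar>"] variance_eq[OF ab sq] by linarith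
  also have "\<dots> = (\<bar>\<sigma>\<bar> * sqrt (t - s))\<^sup>2"
    using second_moment_L[OF ts] ts by (simp add: power_mult_distrib)
  finally have "expectation (\<lambda>x. \<bar>L (t - s) x\<bar>) \<le> \<bar>\<sigma>\<bar> * sqrt (t - s)"
    by (rule power2_le_imp_le) (use ts in simp)
  then show "expectation (\<lambda>x. \<bar>L t x - L s x\<bar>) \<le> \<bar>\<sigma>\<bar> * sqrt (t - s)"
    using integral_increment(1)[OF assms, of abs] by simp
qed

lemma norm_\<phi>_minus_1:
  assumes "0 \<le> t" shows "norm (\<phi> t u - 1) \<le> \<bar>u\<bar> * \<bar>\<sigma>\<bar> * sqrt t"
proof -
  have [measurable]: "L t \<in> borel_measurable M" using assms by (rule measurable_L)
  have int: "integrable M (\<lambda>x. iexp (u * L t x))" by (intro integrable_iexp) auto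
  have ab: "expectation (\<lambda>x. \<bar>L t x\<bar>) \<le> \<bar>\<sigma>\<bar> * sqrt t"
  proof -
    have "expectation (\<lambda>x. \<bar>L t x\<bar>) = expectation (\<lambda>x. \<bar>L t x - L 0 x\<bar>)"
      using integral_increment(1)[of 0 t abs] assms by simp
    then show ?thesis using first_absolute_moment_increment(2)[of 0 t] assms by simp
  qed
  have "norm (\<phi> t u - 1) = norm (LINT x|M. iexp (u * L t x) - 1)"
    unfolding \<phi>_def using int by (simp add: prob_space)
  also have "\<dots> \<le> (LINT x|M. norm (iexp (u * L t x) - 1))" by (rule integral_norm_bound)
  also have "\<dots> \<le> (LINT x|M. \<bar>u\<bar> * \<bar>L t x\<bar>)"
  proof (rule integral_mono)
    show "integrable M (\<lambda>x. norm (iexp (u * L t x) - 1))" using int by simp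
    show "integrable M (\<lambda>x. \<bar>u\<bar> * \<bar>L t x\<bar>)" using integrable_L[OF assms] by simp
    show "norm (iexp (u * L t x) - 1) \<le> \<bar>u\<bar> * \<bar>L t x\<bar>" for x
      using iexp_approx1[of "u * L t x" 0] by (simp add: abs_mult)
  qed
  also have "\<dots> \<le> \<bar>u\<bar> * (\<bar>\<sigma>\<bar> * sqrt t)" using ab by (simp add: mult_left_mono)
  finally show ?thesis by (simp add: mult.assoc)
qed

text \<open>For \<open>t\<close> in \<open>[0, 1]\<close> the values \<open>\<phi> t u\<close> stay in the disc of radius \<open>1/2\<close> around \<open>1\<close>, on
  which the principal logarithm turns the product rule of characteristic functions into an
  exact sum. Without a choice of branches, no representation of infinitely divisible laws
  enters.\<close>

lemma \<phi>_root:
  assumes u: "\<bar>u\<bar> * \<bar>\<sigma>\<bar> \<le> 1/2" and m: "0 < m"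
  shows "\<phi> (1 / real m) u = exp (Ln (\<phi> 1 u) / of_nat m)"
proof -
  define h where "h = 1 / real m"
  have Re: "0 < Re (\<phi> t u)" if t: "0 \<le> t" "t \<le> 1" for t
  proof -
    have "norm (\<phi> t u - 1) \<le> \<bar>u\<bar> * \<bar>\<sigma>\<bar> * sqrt t" by (rule norm_\<phi>_minus_1) fact
    also have "\<dots> \<le> 1/2 * 1" using t by (intro mult_mono u) auto
    finally have "\<bar>Re (\<phi> t u - 1)\<bar> \<le> 1/2" using abs_Re_le_cmod[of "\<phi> t u - 1"] by linarith
    then have "\<bar>Re (\<phi> t u) - 1\<bar> \<le> 1/2" by simp
    then show ?thesis by linarith
  qed
  have kh: "real k * h \<le> 1" if "k \<le> m" for k using that m by (simp add: h_def)
  have h0: "0 \<le> h" by (simp add: h_def)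
  have "k \<le> m \<Longrightarrow> Ln (\<phi> (real k * h) u) = of_nat k * Ln (\<phi> h u)" for k
  proof (induction k)
    case 0 show ?case by (simp add: \<phi>_0)
  next
    case (Suc k)
    have r1: "0 < Re (\<phi> (real k * h) u)" using Suc.prems h0 by (intro Re kh) auto
    have r2: "0 < Re (\<phi> h u)" using m h0 kh[of 1] by (intro Re) auto
    have nz: "\<phi> (real k * h) u \<noteq> 0" "\<phi> h u \<noteq> 0" using r1 r2 by auto
    have "\<bar>Im (Ln (\<phi> (real k * h) u))\<bar> < pi/2" "\<bar>Im (Ln (\<phi> h u))\<bar> < pi/2"
      using Re_Ln_pos_lt[OF nz(1)] Re_Ln_pos_lt[OF nz(2)] r1 r2 by blast+
    then have "Ln (\<phi> (real k * h) u * \<phi> h u) = Ln (\<phi> (real k * h) u) + Ln (\<phi> h u)"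
      by (intro Ln_times_simple nz) linarith+
    moreover have "\<phi> (real (Suc k) * h) u = \<phi> (real k * h) u * \<phi> h u"
      using \<phi>_add[of "real k * h" h u] h0 by (simp add: algebra_simps)
    ultimately show ?case using Suc by (simp add: algebra_simps)
  qed
  from this[of m] have "Ln (\<phi> 1 u) = of_nat m * Ln (\<phi> h u)" using m by (simp add: h_def)
  moreover have "\<phi> h u \<noteq> 0" using Re[OF h0] kh[of 1] m by force
  ultimately show ?thesis using m unfolding h_def[symmetric] by simp
qed

text \<open>The second-order expansion of \<open>\<phi>\<close> at \<open>0\<close> has an error \<open>u\<^sup>2 * \<kappa> u\<close> with \<open>\<kappa>\<close> tending to
  \<open>0\<close> by dominated convergence; the logarithm adds an error of order \<open>u\<^sup>4\<close>.\<close>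

lemma Ln_\<phi>_quadratic:
  assumes "0 < \<epsilon>"
  shows "\<exists>\<delta>>0. \<forall>u. \<bar>u\<bar> \<le> \<delta> \<longrightarrow> norm (Ln (\<phi> 1 u) + of_real (\<sigma>\<^sup>2 * u\<^sup>2 / 2)) \<le> \<epsilon> * u\<^sup>2"
proof -
  have [measurable]: "L 1 \<in> borel_measurable M" by (rule measurable_L) simp
  define \<kappa> where "\<kappa> u = expectation (\<lambda>x. min (6 * (L 1 x)\<^sup>2) (\<bar>u\<bar> * \<bar>L 1 x\<bar>^3)) / 6" for u
  have int: "integrable M (\<lambda>x. min (6 * (L 1 x)\<^sup>2) (\<bar>u\<bar> * \<bar>L 1 x\<bar>^3))" for u
  proof (rule Bochner_Integration.integrable_bound)
    show "integrable M (\<lambda>x. 6 * (L 1 x)\<^sup>2)" using square_integrable_L1 by simp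
  qed (auto intro!: AE_I2)
  have \<kappa>_mono: "\<kappa> u \<le> \<kappa> v" if "\<bar>u\<bar> \<le> \<bar>v\<bar>" for u v
    unfolding \<kappa>_def by (intro divide_right_mono integral_mono int min.mono mult_right_mono that) auto
  have "(\<lambda>n. expectation (\<lambda>x. min (6 * (L 1 x)\<^sup>2) (\<bar>1 / real (Suc n)\<bar> * \<bar>L 1 x\<bar>^3)))
      \<longlonglongrightarrow> expectation (\<lambda>x. 0)"
  proof (rule integral_dominated_convergence[where w="\<lambda>x. 6 * (L 1 x)\<^sup>2"])
    have "(\<lambda>n. min (6 * y\<^sup>2) (\<bar>1 / real (Suc n)\<bar> * \<bar>y\<bar>^3)) \<longlonglongrightarrow> min (6 * y\<^sup>2) (0 * \<bar>y\<bar>^3)" for y :: real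
      by (intro tendsto_intros) real_asymp
    then show "AE x in M. (\<lambda>n. min (6 * (L 1 x)\<^sup>2) (\<bar>1 / real (Suc n)\<bar> * \<bar>L 1 x\<bar>^3)) \<longlonglongrightarrow> 0"
      by (simp add: min_absorb2)
  qed (use square_integrable_L1 in auto)
  then have "(\<lambda>n. \<kappa> (1 / real (Suc n))) \<longlonglongrightarrow> 0"
    unfolding \<kappa>_def by (intro tendsto_divide_zero) simp
  moreover define \<eta> where "\<eta> = min 1 (\<epsilon> / 2)"
  ultimately have "\<forall>\<^sub>F n in sequentially. \<kappa> (1 / real (Suc n)) < \<eta>"
    using assms by (intro order_tendstoD) auto
  then obtain N where N: "\<kappa> (1 / real (Suc N)) < \<eta>" by (auto simp: eventually_sequentially)
  define B where "B = \<sigma>\<^sup>2 / 2 + 1"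
  have B: "1 \<le> B" by (simp add: B_def)
  define \<delta> where "\<delta> = min (1 / real (Suc N)) (min (1 / (2 * B)) (\<epsilon> / (4 * B\<^sup>2)))"
  have \<delta>: "0 < \<delta>" using B assms by (simp add: \<delta>_def)
  show ?thesis
  proof (intro exI[of _ \<delta>] conjI allI impI \<delta>)
    fix u :: real assume u: "\<bar>u\<bar> \<le> \<delta>"
    let ?w = "\<phi> 1 u - 1"
    have "\<kappa> u \<le> \<kappa> (1 / real (Suc N))" using u by (intro \<kappa>_mono) (simp add: \<delta>_def)
    then have \<kappa>u: "\<kappa> u \<le> 1" "\<kappa> u \<le> \<epsilon> / 2" using N by (auto simp: \<eta>_def)
    have "norm (\<phi> 1 u - (1 - u\<^sup>2 * \<sigma>\<^sup>2 / 2)) \<le> u\<^sup>2 * \<kappa> u"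
      using char_approx3'[OF _ integrable_L1 square_integrable_L1 mean_L1, of "\<sigma>\<^sup>2" _ u]
      by (simp add: \<phi>_char \<kappa>_def mean_L1 variance_L1)
    then have quad: "norm (?w + of_real (\<sigma>\<^sup>2 * u\<^sup>2 / 2)) \<le> u\<^sup>2 * \<kappa> u"
      by (simp add: algebra_simps)
    have "norm ?w \<le> norm (?w + of_real (\<sigma>\<^sup>2 * u\<^sup>2 / 2)) + norm (of_real (\<sigma>\<^sup>2 * u\<^sup>2 / 2) :: complex)"
      using norm_triangle_ineq4[of "?w + of_real (\<sigma>\<^sup>2 * u\<^sup>2 / 2)" "of_real (\<sigma>\<^sup>2 * u\<^sup>2 / 2)"] by simp
    also have "\<dots> \<le> u\<^sup>2 * 1 + \<sigma>\<^sup>2 * u\<^sup>2 / 2"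
      using quad mult_left_mono[OF \<kappa>u(1), of "u\<^sup>2"] unfolding norm_of_real by (intro add_mono) auto
    also have "\<dots> = B * u\<^sup>2" by (simp add: B_def algebra_simps)
    finally have w: "norm ?w \<le> B * u\<^sup>2" .
    have u1: "\<bar>u\<bar> \<le> 1" using u by (auto simp: \<delta>_def intro: order_trans)
    have u2: "u\<^sup>2 \<le> \<bar>u\<bar>" using mult_right_mono[OF u1, of "\<bar>u\<bar>"] by (simp add: power2_eq_square)
    have "u\<^sup>2 \<le> 1 / (2 * B)" "u\<^sup>2 \<le> \<epsilon> / (4 * B\<^sup>2)" using u u2 by (auto simp: \<delta>_def)
    then have Bu: "B * u\<^sup>2 \<le> 1/2" "4 * B\<^sup>2 * u\<^sup>2 \<le> \<epsilon>" using B by (auto simp: field_simps)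
    have w2: "norm ?w \<le> 1/2" using w Bu by simp
    have "norm (Ln (\<phi> 1 u) - ?w) \<le> (norm ?w)\<^sup>2 / (1 - norm ?w)"
      using Ln_approx_linear[of ?w] w2 by simp
    also have "\<dots> \<le> (norm ?w)\<^sup>2 / (1/2)" using w2 by (intro divide_left_mono) auto
    also have "\<dots> = 2 * (norm ?w)\<^sup>2" by simp
    also have "\<dots> \<le> 2 * (B * u\<^sup>2)\<^sup>2" using w by (intro mult_left_mono power_mono) auto
    also have "\<dots> = (4 * B\<^sup>2 * u\<^sup>2) * u\<^sup>2 / 2" by (simp add: power2_eq_square)
    also have "\<dots> \<le> \<epsilon> * u\<^sup>2 / 2" by (intro divide_right_mono mult_right_mono Bu(2)) auto
    finally have "norm (Ln (\<phi> 1 u) - ?w) \<le> \<epsilon> * u\<^sup>2 / 2" .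
    moreover have "norm (?w + of_real (\<sigma>\<^sup>2 * u\<^sup>2 / 2)) \<le> \<epsilon> * u\<^sup>2 / 2"
    proof -
      have "u\<^sup>2 * \<kappa> u \<le> u\<^sup>2 * (\<epsilon> / 2)" by (intro mult_left_mono \<kappa>u) auto
      then show ?thesis using quad by (simp add: mult.commute)
    qed
    ultimately have "norm ((Ln (\<phi> 1 u) - ?w) + (?w + of_real (\<sigma>\<^sup>2 * u\<^sup>2 / 2))) \<le> \<epsilon> * u\<^sup>2 / 2 + \<epsilon> * u\<^sup>2 / 2"
      by (rule norm_triangle_mono)
    then show "norm (Ln (\<phi> 1 u) + of_real (\<sigma>\<^sup>2 * u\<^sup>2 / 2)) \<le> \<epsilon> * u\<^sup>2" by simp
  qed
qed

end

section \<open>Central limit theorem for waves integrated against the noise\<close>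

text \<open>The number of grid points per unit of time. A step of \<open>1 / \<lfloor>T\<rfloor>\<^sup>2\<close> is small enough for
  the Riemann sums to stay within bounded \<open>L\<^sup>1\<close> distance of the integrals against the noise.\<close>

definition mesh :: "real \<Rightarrow> nat" where "mesh T = (nat \<lfloor>T\<rfloor>)\<^sup>2"
definition cells :: "real \<Rightarrow> nat" where "cells T = nat \<lfloor>T\<rfloor> * mesh T"

definition grid_mean :: "real \<Rightarrow> (real \<Rightarrow> 'b::real_vector) \<Rightarrow> 'b" where
  "grid_mean T f = (1 / (T * real (mesh T))) *\<^sub>R (\<Sum>k<cells T. f (real k / real (mesh T)))"

lemma mesh_at_top: "filterlim (\<lambda>T. real (mesh T)) at_top at_top"
  unfolding mesh_def by real_asymp

lemma eventually_mesh_ge: "\<forall>\<^sub>F T in at_top. c \<le> real (mesh T)"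
  using mesh_at_top unfolding filterlim_at_top by blast

lemma norm_cis_minus_1_ge:
  assumes "\<bar>\<theta>\<bar> \<le> 1" shows "\<bar>\<theta>\<bar> / 2 \<le> norm (cis \<theta> - 1)"
proof -
  have "norm (cis \<theta> - 1 - \<i> * \<theta>) \<le> \<bar>\<theta>\<bar>\<^sup>2 / 2"
    using iexp_approx1[of \<theta> 1] by (simp add: cis_conv_exp diff_diff_eq numeral_2_eq_2)
  also have "\<dots> \<le> \<bar>\<theta>\<bar> / 2"
    using mult_left_mono[OF assms, of "\<bar>\<theta>\<bar>"] by (simp add: power2_eq_square)
  finally have "norm (\<i> * \<theta>) - norm (cis \<theta> - 1) \<le> \<bar>\<theta>\<bar> / 2"
    using norm_triangle_ineq2[of "\<i> * \<theta>" "cis \<theta> - 1"] by (simp add: norm_minus_commute)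
  then show ?thesis by (simp add: norm_mult)
qed

text \<open>A geometric sum is bounded by \<open>2 / \<bar>q - 1\<bar>\<close>, which for \<open>q = cis (\<nu> / m)\<close> is of order
  \<open>m\<close>, whereas the normalisation is \<open>T * m\<close>.\<close>

lemma grid_mean_wave:
  assumes "\<nu> \<noteq> 0"
  shows "((\<lambda>T. grid_mean T (\<lambda>t. cis (\<nu> * t))) \<longlongrightarrow> 0) at_top"
proof (rule Lim_null_comparison)
  show "((\<lambda>T. 4 / (T * \<bar>\<nu>\<bar>)) \<longlongrightarrow> 0) at_top"
    using assms by real_asymp
  show "\<forall>\<^sub>F T in at_top. norm (grid_mean T (\<lambda>t. cis (\<nu> * t))) \<le> 4 / (T * \<bar>\<nu>\<bar>)"
    using eventually_mesh_ge[of "\<bar>\<nu>\<bar>"] eventually_mesh_ge[of 1] eventually_ge_at_top[of 1]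
  proof eventually_elim
    case (elim T)
    define m where "m = real (mesh T)"
    define q where "q = cis (\<nu> / m)"
    have m: "1 \<le> m" "\<bar>\<nu>\<bar> \<le> m" using elim by (auto simp: m_def)
    have q: "\<bar>\<nu>\<bar> / (2 * m) \<le> norm (q - 1)"
      using norm_cis_minus_1_ge[of "\<nu> / m"] m by (simp add: q_def abs_divide mult.commute)
    have "0 < \<bar>\<nu>\<bar> / (2 * m)" using m assms by simp
    then have q1: "q \<noteq> 1" using q by auto
    have "(\<Sum>k<cells T. cis (\<nu> * (real k / m))) = (\<Sum>k<cells T. q ^ k)"
      unfolding q_def Complex.DeMoivre by (intro sum.cong refl arg_cong[where f=cis]) simp
    also have "\<dots> = (q ^ cells T - 1) / (q - 1)" using q1 by (rule geometric_sum)
    finally have "norm (\<Sum>k<cells T. cis (\<nu> * (real k / m))) = norm (q ^ cells T - 1) / norm (q - 1)"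
      by (simp add: norm_divide)
    also have "\<dots> \<le> 2 / (\<bar>\<nu>\<bar> / (2 * m))"
    proof (rule frac_le)
      show "norm (q ^ cells T - 1) \<le> 2"
        using norm_triangle_ineq4[of "q ^ cells T" 1] by (simp add: norm_power q_def)
    qed (use q \<open>0 < \<bar>\<nu>\<bar> / (2 * m)\<close> in auto)
    finally have sum_le: "norm (\<Sum>k<cells T. cis (\<nu> * (real k / m))) \<le> 2 / (\<bar>\<nu>\<bar> / (2 * m))" .
    have "norm (grid_mean T (\<lambda>t. cis (\<nu> * t))) = (1 / (T * m)) * norm (\<Sum>k<cells T. cis (\<nu> * (real k / m)))"
      using m elim by (simp add: grid_mean_def m_def)
    also have "\<dots> \<le> (1 / (T * m)) * (2 / (\<bar>\<nu>\<bar> / (2 * m)))"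
      using m elim by (intro mult_left_mono sum_le) auto
    also have "\<dots> = 4 / (T * \<bar>\<nu>\<bar>)" using m by (simp add: field_simps)
    finally show ?case .
  qed
qed

lemma grid_mean_1: "((\<lambda>T. grid_mean T (\<lambda>t. 1 :: complex)) \<longlongrightarrow> 1) at_top"
proof (rule Lim_transform_eventually)
  have "((\<lambda>T. real (nat \<lfloor>T\<rfloor>) / T) \<longlongrightarrow> 1) at_top" by real_asymp
  then show "((\<lambda>T. complex_of_real (real (nat \<lfloor>T\<rfloor>) / T)) \<longlongrightarrow> 1) at_top"
    using tendsto_of_real[of "\<lambda>T. real (nat \<lfloor>T\<rfloor>) / T" 1 at_top, where 'a=complex] by simp
  show "\<forall>\<^sub>F T in at_top. complex_of_real (real (nat \<lfloor>T\<rfloor>) / T) = grid_mean T (\<lambda>t. 1)"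
    using eventually_mesh_ge[of 1] by eventually_elim (simp add: grid_mean_def cells_def scaleR_conv_of_real)
qed

lemma grid_mean_sum: "grid_mean T (\<lambda>t. \<Sum>i\<in>I. f i t) = (\<Sum>i\<in>I. grid_mean T (f i))"
  by (simp add: grid_mean_def sum.swap[of _ I] scaleR_sum_right)

lemma grid_mean_add: "grid_mean T (\<lambda>t. f t + g t) = grid_mean T f + grid_mean T g"
  by (simp add: grid_mean_def sum.distrib scaleR_add_right)

lemma grid_mean_mult: "grid_mean T (\<lambda>t. c * f t) = c * grid_mean T (f :: real \<Rightarrow> complex)"
  by (simp add: grid_mean_def sum_distrib_left[symmetric])

lemma grid_mean_Re: "Re (grid_mean T f) = grid_mean T (\<lambda>t. Re (f t))"
  by (simp add: grid_mean_def)

definition wave :: "('d::finite \<Rightarrow> real) \<Rightarrow> ('d \<Rightarrow> complex) \<Rightarrow> real \<Rightarrow> real" where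
  "wave \<omega> d t = Re (\<Sum>j\<in>UNIV. d j * cis (- (\<omega> j * t)))"

lemma wave_bound: "\<bar>wave \<omega> d t\<bar> \<le> (\<Sum>j\<in>UNIV. norm (d j))"
  unfolding wave_def by (rule order_trans[OF abs_Re_le_cmod sum_norm_le]) (simp add: norm_mult)

text \<open>From \<open>(Re w)\<^sup>2 = (\<bar>w\<bar>\<^sup>2 + Re (w\<^sup>2)) / 2\<close>: the first summand produces the differences and
  the second one the sums of the frequencies.\<close>

lemma wave_square:
  "(wave \<omega> d t)\<^sup>2 = Re (\<Sum>i\<in>UNIV. \<Sum>j\<in>UNIV. (d i * cnj (d j) / 2) * cis ((\<omega> j - \<omega> i) * t)
      + (d i * d j / 2) * cis (- (\<omega> i + \<omega> j) * t))"
proof -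
  define z where "z j = d j * cis (- (\<omega> j * t))" for j
  have "(Re w)\<^sup>2 = Re (w * cnj w / 2 + w * w / 2)" for w
    by (simp add: power2_eq_square field_simps)
  then have "(wave \<omega> d t)\<^sup>2 = Re ((\<Sum>i\<in>UNIV. z i) * cnj (\<Sum>i\<in>UNIV. z i) / 2 + (\<Sum>i\<in>UNIV. z i) * (\<Sum>i\<in>UNIV. z i) / 2)"
    unfolding wave_def z_def .
  also have "(\<Sum>i\<in>UNIV. z i) * cnj (\<Sum>i\<in>UNIV. z i) / 2 + (\<Sum>i\<in>UNIV. z i) * (\<Sum>i\<in>UNIV. z i) / 2
     = (\<Sum>i\<in>UNIV. \<Sum>j\<in>UNIV. z i * cnj (z j) / 2 + z i * z j / 2)"
    by (simp add: sum_product sum_divide_distrib sum.distrib)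
  also have "\<dots> = (\<Sum>i\<in>UNIV. \<Sum>j\<in>UNIV. (d i * cnj (d j) / 2) * cis ((\<omega> j - \<omega> i) * t)
      + (d i * d j / 2) * cis (- (\<omega> i + \<omega> j) * t))"
  proof (intro sum.cong refl arg_cong2[where f="(+)"])
    fix i j
    have "cis (- (\<omega> i * t)) * cis (\<omega> j * t) = cis ((\<omega> j - \<omega> i) * t)"
      by (simp add: cis_mult algebra_simps)
    then show "z i * cnj (z j) / 2 = (d i * cnj (d j) / 2) * cis ((\<omega> j - \<omega> i) * t)"
      by (simp add: z_def cis_cnj mult_ac)
    have "cis (- (\<omega> i * t)) * cis (- (\<omega> j * t)) = cis (- (\<omega> i + \<omega> j) * t)"
      by (simp add: cis_mult algebra_simps)
    then show "z i * z j / 2 = (d i * d j / 2) * cis (- (\<omega> i + \<omega> j) * t)"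
      by (simp add: z_def mult_ac)
  qed
  finally show ?thesis .
qed

text \<open>Distinct positive frequencies have nonzero sums and differences, so only the diagonal
  terms, of frequency \<open>0\<close>, survive the averaging.\<close>

lemma grid_mean_wave_square:
  assumes "inj \<omega>" and pos: "\<And>j. 0 < \<omega> j"
  shows "((\<lambda>T. grid_mean T (\<lambda>t. (wave \<omega> d t)\<^sup>2)) \<longlongrightarrow> (\<Sum>j\<in>UNIV. (norm (d j))\<^sup>2) / 2) at_top"
proof -
  have diff: "((\<lambda>T. grid_mean T (\<lambda>t. cis ((\<omega> j - \<omega> i) * t))) \<longlongrightarrow> (if i = j then 1 else 0)) at_top" for i j
  proof (cases "i = j")
    case False
    then have "\<omega> j - \<omega> i \<noteq> 0" using injD[OF \<open>inj \<omega>\<close>, of j i] by auto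
    then show ?thesis using False grid_mean_wave by simp
  qed (simp add: grid_mean_1)
  have sum: "((\<lambda>T. grid_mean T (\<lambda>t. cis (- (\<omega> i + \<omega> j) * t))) \<longlongrightarrow> 0) at_top" for i j
    using grid_mean_wave[of "- (\<omega> i + \<omega> j)"] pos[of i] pos[of j] by auto
  have "((\<lambda>T. \<Sum>i\<in>UNIV. \<Sum>j\<in>UNIV. (d i * cnj (d j) / 2) * grid_mean T (\<lambda>t. cis ((\<omega> j - \<omega> i) * t))
      + (d i * d j / 2) * grid_mean T (\<lambda>t. cis (- (\<omega> i + \<omega> j) * t)))
     \<longlongrightarrow> (\<Sum>i\<in>UNIV. \<Sum>j\<in>UNIV. (d i * cnj (d j) / 2) * (if i = j then 1 else 0) + (d i * d j / 2) * 0)) at_top"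
    by (intro tendsto_intros diff sum)
  also have "(\<Sum>i\<in>UNIV. \<Sum>j\<in>UNIV. (d i * cnj (d j) / 2) * (if i = j then 1 else 0) + (d i * d j / 2) * 0)
      = of_real ((\<Sum>j\<in>UNIV. (norm (d j))\<^sup>2) / 2)"
    by (simp add: if_distrib[where f="\<lambda>y. c * y" for c] complex_norm_square[symmetric] sum_divide_distrib cong: if_cong)
  finally show ?thesis
    unfolding wave_square grid_mean_Re[symmetric] grid_mean_sum grid_mean_add grid_mean_mult
    by (auto dest: tendsto_Re simp del: plus_complex.sel)
qed

definition wave_sum :: "(real \<Rightarrow> 'a \<Rightarrow> real) \<Rightarrow> ('d::finite \<Rightarrow> real) \<Rightarrow> ('d \<Rightarrow> complex) \<Rightarrow> real \<Rightarrow> 'a \<Rightarrow> real" where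
  "wave_sum L \<omega> d T x = (\<Sum>k<cells T. wave \<omega> d (real k / mesh T) *
      (L (real (Suc k) / mesh T) x - L (real k / mesh T) x))"

text \<open>All arguments \<open>g(k / m) / sqrt T\<close> of the characteristic function tend to \<open>0\<close> uniformly
  in \<open>k\<close>, so the quadratic expansion of \<open>Ln \<phi>\<close> may be summed over the grid.\<close>

lemma (in centered_levy_process) wave_sum_clt:
  fixes \<omega> :: "'d::finite \<Rightarrow> real"
  assumes "inj \<omega>" and pos: "\<And>j. 0 < \<omega> j"
  shows "((\<lambda>T. LINT x|M. iexp (wave_sum L \<omega> d T x / sqrt T))
      \<longlongrightarrow> of_real (exp (- \<sigma>\<^sup>2 / 4 * (\<Sum>j\<in>UNIV. (norm (d j))\<^sup>2)))) at_top"
proof -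
  define G where "G = (\<Sum>j\<in>UNIV. norm (d j))"
  have G: "\<bar>wave \<omega> d t\<bar> \<le> G" for t unfolding G_def by (rule wave_bound)
  define V where "V = (\<Sum>j\<in>UNIV. (norm (d j))\<^sup>2) / 2"
  define A where "A T = grid_mean T (\<lambda>t. (wave \<omega> d t)\<^sup>2)" for T
  have A: "(A \<longlongrightarrow> V) at_top" unfolding A_def V_def by (rule grid_mean_wave_square[OF assms])
  define u where "u T k = wave \<omega> d (real k / mesh T) / sqrt T" for T k
  define S where "S T = (\<Sum>k<cells T. Ln (\<phi> 1 (u T k)) / of_nat (mesh T))" for T
  have small: "\<forall>\<^sub>F T in at_top. \<forall>k. \<bar>u T k\<bar> \<le> \<delta>" if "0 < \<delta>" for \<delta>
  proof -
    have "((\<lambda>T. G / sqrt T) \<longlongrightarrow> 0) at_top" by real_asymp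
    then have "\<forall>\<^sub>F T in at_top. G / sqrt T < \<delta>" using that by (rule order_tendstoD)
    then show ?thesis using eventually_gt_at_top[of 0]
    proof eventually_elim
      case (elim T)
      then have "\<bar>u T k\<bar> \<le> G / sqrt T" for k
        using G by (simp add: u_def abs_divide divide_right_mono)
      then show ?case using elim by (meson less_imp_le order_trans)
    qed
  qed
  note mesh1 = eventually_mesh_ge[of 1]
  have A_eq: "A T = (\<Sum>k<cells T. (u T k)\<^sup>2) / mesh T" if "0 < T" for T
    using that by (simp add: A_def u_def grid_mean_def power_divide sum_divide_distrib[symmetric] field_simps)
  have S_err: "\<forall>\<^sub>F T in at_top. norm (S T + of_real (\<sigma>\<^sup>2 / 2 * A T)) \<le> \<epsilon> * A T" if \<epsilon>: "0 < \<epsilon>" for \<epsilon>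
  proof -
    obtain \<delta> where \<delta>: "\<delta> > 0" "\<And>u. \<bar>u\<bar> \<le> \<delta> \<Longrightarrow> norm (Ln (\<phi> 1 u) + of_real (\<sigma>\<^sup>2 * u\<^sup>2 / 2)) \<le> \<epsilon> * u\<^sup>2"
      using Ln_\<phi>_quadratic[OF \<epsilon>] by blast
    show ?thesis using small[OF \<delta>(1)] mesh1 eventually_gt_at_top[of 0]
    proof eventually_elim
      case (elim T)
      have "S T + of_real (\<sigma>\<^sup>2 / 2 * A T) 
          = (\<Sum>k<cells T. (Ln (\<phi> 1 (u T k)) + of_real (\<sigma>\<^sup>2 * (u T k)\<^sup>2 / 2)) / of_nat (mesh T))"
        using elim by (simp add: S_def A_eq sum.distrib add_divide_distrib sum_divide_distrib sum_distrib_left)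
      also have "norm \<dots> \<le> (\<Sum>k<cells T. \<epsilon> * (u T k)\<^sup>2 / mesh T)"
        using elim \<delta>(2) by (intro sum_norm_le) (simp add: norm_divide divide_right_mono)
      also have "\<dots> = \<epsilon> * A T" using elim by (simp add: A_eq sum_divide_distrib sum_distrib_left)
      finally show ?case .
    qed
  qed
  have "((\<lambda>T. S T + of_real (\<sigma>\<^sup>2 / 2 * A T)) \<longlongrightarrow> 0) at_top"
  proof (rule tendstoI)
    fix e :: real assume e: "0 < e"
    have V: "0 \<le> V" by (simp add: V_def sum_nonneg)
    then have "\<forall>\<^sub>F T in at_top. A T < V + 1" using A by (intro order_tendstoD) auto
    moreover have "0 < e / (2 * (V + 1))" using e V by simp
    note S_err[OF this]
    ultimately show "\<forall>\<^sub>F T in at_top. dist (S T + of_real (\<sigma>\<^sup>2 / 2 * A T)) 0 < e"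
    proof eventually_elim
      case (elim T)
      have "e / (2 * (V + 1)) * A T \<le> e / (2 * (V + 1)) * (V + 1)"
        using elim e V by (intro mult_left_mono) auto
      also have "\<dots> = e / 2" using V by (simp add: field_simps)
      finally have "norm (S T + of_real (\<sigma>\<^sup>2 / 2 * A T)) \<le> e / 2" using elim by linarith
      then show ?case using e by simp
    qed
  qed
  moreover have "((\<lambda>T. complex_of_real (\<sigma>\<^sup>2 / 2 * A T)) \<longlongrightarrow> of_real (\<sigma>\<^sup>2 / 2 * V)) at_top"
    by (intro tendsto_intros A)
  ultimately have "((\<lambda>T. S T + of_real (\<sigma>\<^sup>2 / 2 * A T) - of_real (\<sigma>\<^sup>2 / 2 * A T)) \<longlongrightarrow> 0 - of_real (\<sigma>\<^sup>2 / 2 * V)) at_top"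
    by (rule tendsto_diff)
  then have "(S \<longlongrightarrow> - of_real (\<sigma>\<^sup>2 / 2 * V)) at_top" by simp
  then have "((\<lambda>T. exp (S T)) \<longlongrightarrow> exp (- of_real (\<sigma>\<^sup>2 / 2 * V))) at_top" by (rule tendsto_exp)
  also have "exp (- of_real (\<sigma>\<^sup>2 / 2 * V)) = complex_of_real (exp (- \<sigma>\<^sup>2 / 4 * (\<Sum>j\<in>UNIV. (norm (d j))\<^sup>2)))"
    unfolding V_def exp_of_real[symmetric] by simp
  finally show ?thesis
  proof (rule Lim_transform_eventually)
    \<comment> \<open>From some \<open>T\<close> on, all arguments are so small that the exact \<open>m\<close>-th root is available.\<close>
    have "0 < 1 / (2 * (\<bar>\<sigma>\<bar> + 1))" by simp
    from small[OF this] mesh1 eventually_gt_at_top[of 0]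
    show "\<forall>\<^sub>F T in at_top. exp (S T) = (LINT x|M. iexp (wave_sum L \<omega> d T x / sqrt T))"
    proof eventually_elim
      case (elim T)
      define m where "m = mesh T"
      have m: "0 < m" using elim by (simp add: m_def)
      have root: "\<phi> (1 / real m) (u T k) = exp (Ln (\<phi> 1 (u T k)) / of_nat m)" for k
      proof (rule \<phi>_root[OF _ m])
        have "\<bar>u T k\<bar> * \<bar>\<sigma>\<bar> \<le> (1 / (2 * (\<bar>\<sigma>\<bar> + 1))) * (\<bar>\<sigma>\<bar> + 1)"
          using elim by (intro mult_mono) auto
        also have "\<dots> = 1/2" by (simp add: field_simps)
        finally show "\<bar>u T k\<bar> * \<bar>\<sigma>\<bar> \<le> 1/2" .
      qed
      have "exp (S T) = (\<Prod>k<cells T. \<phi> (1 / real m) (u T k))"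
        unfolding S_def root m_def[symmetric] by (rule exp_sum) simp
      also have "\<dots> = (LINT x|M. iexp (\<Sum>k<cells T. u T k * (L (real (Suc k) * (1 / real m)) x - L (real k * (1 / real m)) x)))"
        by (rule iexp_increments[symmetric]) simp
      also have "(\<lambda>x. \<Sum>k<cells T. u T k * (L (real (Suc k) * (1 / real m)) x - L (real k * (1 / real m)) x))
          = (\<lambda>x. wave_sum L \<omega> d T x / sqrt T)"
        by (simp add: fun_eq_iff wave_sum_def u_def m_def sum_divide_distrib)
      finally show ?case .
    qed
  qed
qed

section \<open>Transforms of the state equation along a path\<close>

abbreviation exp_kernel :: "complex \<Rightarrow> real \<Rightarrow> complex" where
  "exp_kernel \<xi> t \<equiv> exp (- (\<xi> * of_real t))"

lemma exp_has_vector_derivative: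
  "((\<lambda>t. - exp_kernel \<xi> t) has_vector_derivative \<xi> * exp_kernel \<xi> t) (at t within S)"
  for \<xi> :: complex
proof -
  have "((\<lambda>w. - exp (- (\<xi> * w))) has_field_derivative \<xi> * exp (- (\<xi> * w))) (at w)" for w
    by (auto intro!: derivative_eq_intros)
  from has_vector_derivative_real_field[OF this] show ?thesis .
qed

lemma continuous_on_exp_wave: "continuous_on S (\<lambda>t::real. exp (- ((\<xi>::complex) * of_real t)))"
  by (intro continuous_intros)

lemma borel_measurable_exp_wave[measurable]: 
  "(\<lambda>t::real. exp (- ((\<xi>::complex) * of_real t))) \<in> borel_measurable borel"
  by (intro borel_measurable_continuous_onI continuous_on_exp_wave)

lemma LINT_exp_Icc:
  fixes \<xi> :: complex
  assumes "s \<le> t"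
  shows "(LINT r:{s..t}|lborel. \<xi> * exp_kernel \<xi> r) = exp_kernel \<xi> s - exp_kernel \<xi> t"
  using integral_FTC_Icc[OF assms exp_has_vector_derivative, of \<xi>]
  unfolding set_lebesgue_integral_def by (simp add: continuous_on_exp_wave continuous_on_mult_left)

lemma set_integrable_exp_mult:
  fixes f :: "real \<Rightarrow> complex"
  assumes "set_integrable lborel {s..t} f"
  shows "set_integrable lborel {s..t} (\<lambda>r. exp_kernel \<xi> r * f r)"
proof -
  have "compact ((\<lambda>r::real. exp_kernel \<xi> r) ` {s..t})"
    by (intro compact_continuous_image continuous_on_exp_wave) simp
  then obtain B where B: "\<And>r. r \<in> {s..t} \<Longrightarrow> norm (exp_kernel \<xi> r) \<le> B"
    using compact_imp_bounded[of "(\<lambda>r::real. exp_kernel \<xi> r) ` {s..t}"] unfolding bounded_iff by blast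
  have "integrable lborel (\<lambda>r. B * norm (indicator {s..t} r *\<^sub>R f r))"
    using assms unfolding set_integrable_def by (intro integrable_mult_right integrable_norm)
  then show ?thesis
    unfolding set_integrable_def
  proof (rule Bochner_Integration.integrable_bound)
    have [measurable]: "(\<lambda>r. indicator {s..t} r *\<^sub>R f r) \<in> borel_measurable lborel"
      using assms unfolding set_integrable_def by (rule borel_measurable_integrable)
    have "(\<lambda>r. exp_kernel \<xi> r * (indicator {s..t} r *\<^sub>R f r)) \<in> borel_measurable lborel"
      by measurable
    then show "(\<lambda>r. indicator {s..t} r *\<^sub>R (exp_kernel \<xi> r * f r)) \<in> borel_measurable lborel"
      by simp
    show "AE r in lborel. norm (indicator {s..t} r *\<^sub>R (exp_kernel \<xi> r * f r))
        \<le> norm (B * norm (indicator {s..t} r *\<^sub>R f r))"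
    proof (intro AE_I2)
      fix r
      have "norm (exp_kernel \<xi> r) * norm (f r) \<le> \<bar>B\<bar> * norm (f r)" if "r \<in> {s..t}"
        by (intro mult_right_mono order_trans[OF B[OF that] abs_ge_self]) simp
      then show "norm (indicator {s..t} r *\<^sub>R (exp_kernel \<xi> r * f r))
          \<le> norm (B * norm (indicator {s..t} r *\<^sub>R f r))"
        unfolding norm_mult norm_scaleR real_norm_def by (cases "r \<in> {s..t}") (simp_all add: abs_mult)
    qed
  qed
qed

text \<open>Integration by parts for the primitive of a function that is merely integrable, by
  Fubini on the triangle \<open>s \<le> t\<close>.\<close>

lemma exp_integral_of_primitive:
  fixes z :: "real \<Rightarrow> complex"
  assumes z: "set_integrable lborel {0..T} z"
  shows "(LINT t:{0..T}|lborel. \<xi> * exp_kernel \<xi> t * (LINT s:{0..t}|lborel. z s))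
     = (LINT s:{0..T}|lborel. exp_kernel \<xi> s * z s) - exp_kernel \<xi> T * (LINT s:{0..T}|lborel. z s)"
proof -
  \<comment> \<open>The integrand on the triangle is \<open>F\<close>; it is dominated by the product of the integrable functions \<open>g\<close> and \<open>h\<close>.\<close>
  define g where "g t = indicator {0..T} t *\<^sub>R (\<xi> * exp_kernel \<xi> t)" for t
  define h where "h s = indicator {0..T} s *\<^sub>R z s" for s
  define F where "F t s = (if s \<le> t then g t * h s else 0)" for t s
  have g: "integrable lborel g"
    using borel_integrable_compact[of "{0..T}" "\<lambda>t. \<xi> * exp_kernel \<xi> t"]
    unfolding g_def by (simp add: continuous_on_exp_wave continuous_on_mult_left)
  have h: "integrable lborel h" using z unfolding h_def set_integrable_def .
  have [measurable]: "g \<in> borel_measurable borel" "h \<in> borel_measurable borel"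
    using borel_measurable_integrable[OF g] borel_measurable_integrable[OF h] by auto
  have "integrable (lborel \<Otimes>\<^sub>M lborel) (\<lambda>(t, s). g t * h s)"
  proof (rule lborel_pair.Fubini_integrable)
    show "integrable lborel (\<lambda>t. LINT s|lborel. norm (case (t, s) of (t, s) \<Rightarrow> g t * h s))"
      using g h by (simp add: norm_mult)
    show "AE t in lborel. integrable lborel (\<lambda>s. case (t, s) of (t, s) \<Rightarrow> g t * h s)"
      using h by simp
  qed simp
  then have F: "integrable (lborel \<Otimes>\<^sub>M lborel) (\<lambda>(t, s). F t s)"
    by (rule Bochner_Integration.integrable_bound) (auto simp: F_def)
  have "(LINT t:{0..T}|lborel. \<xi> * exp_kernel \<xi> t * (LINT s:{0..t}|lborel. z s))
      = (LINT t|lborel. LINT s|lborel. F t s)"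
    unfolding set_lebesgue_integral_def
  proof (rule Bochner_Integration.integral_cong[OF refl])
    fix t
    have "(LINT s|lborel. F t s) = (LINT s|lborel. g t * (indicator {0..t} s *\<^sub>R z s))"
      by (rule Bochner_Integration.integral_cong) (auto simp: F_def g_def h_def indicator_def)
    also have "\<dots> = g t * (LINT s|lborel. indicator {0..t} s *\<^sub>R z s)" by (rule integral_mult_right_zero)
    finally show "indicator {0..T} t *\<^sub>R (\<xi> * exp_kernel \<xi> t * (LINT s|lborel. indicator {0..t} s *\<^sub>R z s))
        = (LINT s|lborel. F t s)"
      by (simp only: g_def mult_scaleR_left)
  qed
  also have "\<dots> = (LINT s|lborel. LINT t|lborel. F t s)"
    by (rule lborel_pair.Fubini_integral[OF F, symmetric])
  also have "\<dots> = (LINT s:{0..T}|lborel. exp_kernel \<xi> s * z s - exp_kernel \<xi> T * z s)"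
    unfolding set_lebesgue_integral_def
  proof (rule Bochner_Integration.integral_cong[OF refl])
    fix s
    show "(LINT t|lborel. F t s) = indicator {0..T} s *\<^sub>R (exp_kernel \<xi> s * z s - exp_kernel \<xi> T * z s)"
    proof (cases "s \<in> {0..T}")
      case True
      have "(LINT t|lborel. F t s) = (LINT t|lborel. (indicator {s..T} t *\<^sub>R (\<xi> * exp_kernel \<xi> t)) * z s)"
        using True by (intro Bochner_Integration.integral_cong) (auto simp: F_def g_def h_def indicator_def)
      also have "\<dots> = (LINT t:{s..T}|lborel. \<xi> * exp_kernel \<xi> t) * z s"
        unfolding set_lebesgue_integral_def by (rule integral_mult_left_zero)
      also have "\<dots> = (exp_kernel \<xi> s - exp_kernel \<xi> T) * z s"
        using True by (subst LINT_exp_Icc) auto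
      finally show ?thesis using True by (simp add: algebra_simps)
    next
      case False
      then have "F t s = 0" for t by (auto simp: F_def h_def)
      then show ?thesis using False by simp
    qed
  qed
  also have "\<dots> = (LINT s:{0..T}|lborel. exp_kernel \<xi> s * z s) - exp_kernel \<xi> T * (LINT s:{0..T}|lborel. z s)"
    using z set_integrable_exp_mult[OF z] by simp
  finally show ?thesis .
qed

text \<open>The integral of \<open>exp (- \<xi> t)\<close> against \<open>dl(t)\<close> over \<open>[0, T]\<close> for \<open>l(0) = 0\<close>, defined by
  partial integration. This makes sense path by path and requires no stochastic integral.\<close>

definition noise_transform :: "(real \<Rightarrow> real) \<Rightarrow> complex \<Rightarrow> real \<Rightarrow> complex" where
  "noise_transform l \<xi> T = exp_kernel \<xi> T * of_real (l T)
      + (LINT t:{0..T}|lborel. \<xi> * exp_kernel \<xi> t * of_real (l t))"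

lemma set_integrable_of_real:
  "set_integrable lborel A f \<Longrightarrow> set_integrable lborel A (\<lambda>t. complex_of_real (f t))"
  unfolding set_integrable_def by (drule integrable_of_real[where 'a=complex]) (simp add: scaleR_conv_of_real)

lemma set_integrable_exp_of_real:
  assumes "set_integrable lborel {s..t} l"
  shows "set_integrable lborel {s..t} (\<lambda>r. \<xi> * exp_kernel \<xi> r * complex_of_real (l r))"
  using set_integrable_mult_right[of \<xi>, OF set_integrable_exp_mult[OF set_integrable_of_real[OF assms], of \<xi>]]
  by (simp only: mult.assoc)

lemma exp_integration_by_parts:
  fixes y z :: "real \<Rightarrow> complex" and l :: "real \<Rightarrow> real"
  assumes "0 \<le> T" and z: "set_integrable lborel {0..T} z" and l: "set_integrable lborel {0..T} l"
    and y: "\<And>t. 0 \<le> t \<Longrightarrow> t \<le> T \<Longrightarrow> y t = y0 + (LINT s:{0..t}|lborel. z s) + c * of_real (l t)"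
  shows "exp_kernel \<xi> T * y T - y0
     = (LINT t:{0..T}|lborel. exp_kernel \<xi> t * (z t - \<xi> * y t)) + c * noise_transform l \<xi> T"
proof -
  let ?E = "\<lambda>t::real. exp_kernel \<xi> t"
  define v where "v t = (LINT s:{0..t}|lborel. z s)" for t
  have "set_integrable lborel {0..T} (\<lambda>t. \<xi> * ?E t * v t)"
  proof -
    have "continuous_on {0..T} v"
    proof -
      have "v t = integral {0..t} z" if "t \<in> {0..T}" for t
        unfolding v_def using that
        by (intro set_borel_integral_eq_integral set_integrable_subset[OF z]) auto
      moreover have "continuous_on {0..T} (\<lambda>t. integral {0..t} z)"
        by (intro indefinite_integral_continuous_1 set_borel_integral_eq_integral z)
      ultimately show ?thesis by (metis (no_types, lifting) continuous_on_eq)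
    qed
    then show ?thesis
      unfolding set_integrable_def
      by (intro borel_integrable_compact continuous_on_mult continuous_on_exp_wave continuous_on_const) auto
  qed
  note v = this
  have E: "set_integrable lborel {0..T} (\<lambda>t. \<xi> * ?E t * y0)"
    unfolding set_integrable_def
    by (intro borel_integrable_compact continuous_on_mult continuous_on_exp_wave continuous_on_const) auto
  note L = set_integrable_exp_of_real[OF l, of \<xi>]
  have "(LINT t:{0..T}|lborel. ?E t * (z t - \<xi> * y t))
      = (LINT t:{0..T}|lborel. ?E t * z t - (\<xi> * ?E t * y0 + (\<xi> * ?E t * v t + c * (\<xi> * ?E t * of_real (l t)))))"
    using y by (intro set_lebesgue_integral_cong) (auto simp: v_def algebra_simps)
  also have "\<dots> = (LINT t:{0..T}|lborel. ?E t * z t) - ((LINT t:{0..T}|lborel. \<xi> * ?E t * y0)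
      + ((LINT t:{0..T}|lborel. \<xi> * ?E t * v t) + c * (LINT t:{0..T}|lborel. \<xi> * ?E t * of_real (l t))))"
    using E v L set_integrable_exp_mult[OF z, of \<xi>]
    by (simp only: set_integral_diff set_integral_add set_integral_mult_right set_integrable_mult_right simp_thms)
  also have "(LINT t:{0..T}|lborel. \<xi> * ?E t * y0) = (1 - ?E T) * y0"
    using LINT_exp_Icc[OF assms(1), of \<xi>] by (simp add: set_integral_mult_left)
  also have "(LINT t:{0..T}|lborel. \<xi> * ?E t * v t) = (LINT s:{0..T}|lborel. ?E s * z s) - ?E T * v T"
    unfolding v_def by (rule exp_integral_of_primitive[OF z])
  finally show ?thesis
    using y[OF assms(1)] by (simp add: noise_transform_def v_def algebra_simps)
qed

lemma set_integrable_exp_const: "set_integrable lborel {s..t} (\<lambda>r. \<xi> * exp_kernel \<xi> r * (w :: complex))"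
  unfolding set_integrable_def
  by (intro borel_integrable_compact continuous_on_mult continuous_on_exp_wave continuous_on_const) auto

text \<open>Centring \<open>l\<close> at the left end point makes both terms small on short intervals.\<close>

lemma noise_transform_increment:
  assumes "0 \<le> s" "s \<le> t" and l: "set_integrable lborel {0..t} l"
  shows "noise_transform l \<xi> t - noise_transform l \<xi> s
     = exp_kernel \<xi> t * of_real (l t - l s)
       + (LINT r:{s..t}|lborel. \<xi> * exp_kernel \<xi> r * of_real (l r - l s))"
proof -
  let ?f = "\<lambda>r. \<xi> * exp_kernel \<xi> r * complex_of_real (l r)"
  have f: "set_integrable lborel {0..t} ?f" by (rule set_integrable_exp_of_real[OF l])
  have split: "(LINT r:{0..t}|lborel. ?f r) = (LINT r:{0..s}|lborel. ?f r) + (LINT r:{s..t}|lborel. ?f r)"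
  proof -
    have "integral {0..t} ?f = integral {0..s} ?f + integral {s..t} ?f"
      using assms by (intro Henstock_Kurzweil_Integration.integral_combine[symmetric] set_borel_integral_eq_integral f) auto
    moreover have "(LINT r:{u..w}|lborel. ?f r) = integral {u..w} ?f" if "0 \<le> u" "w \<le> t" for u w
      using that by (intro set_borel_integral_eq_integral set_integrable_subset[OF f]) auto
    ultimately show ?thesis using assms by simp
  qed
  have fs: "set_integrable lborel {s..t} ?f" using assms by (intro set_integrable_subset[OF f]) auto
  have "(LINT r:{s..t}|lborel. \<xi> * exp_kernel \<xi> r * of_real (l r - l s))
      = (LINT r:{s..t}|lborel. ?f r - \<xi> * exp_kernel \<xi> r * of_real (l s))"
    by (simp add: algebra_simps)
  also have "\<dots> = (LINT r:{s..t}|lborel. ?f r) - (LINT r:{s..t}|lborel. \<xi> * exp_kernel \<xi> r * of_real (l s))"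
    by (intro set_integral_diff fs set_integrable_exp_const)
  also have "(LINT r:{s..t}|lborel. \<xi> * exp_kernel \<xi> r * of_real (l s))
      = (exp_kernel \<xi> s - exp_kernel \<xi> t) * of_real (l s)"
    using LINT_exp_Icc[OF assms(2), of \<xi>] by (simp only: set_integral_mult_left)
  finally show ?thesis
    unfolding noise_transform_def split by (simp add: algebra_simps)
qed

text \<open>Centring at the right end point: after multiplication by \<open>exp (\<xi> T)\<close> the weight decays
  in the time lag \<open>T - t\<close>, at the same time as the increment over that lag grows.\<close>

lemma noise_transform_backward:
  assumes "0 \<le> T" and l: "set_integrable lborel {0..T} l"
  shows "noise_transform l \<xi> T = of_real (l T)
      - (LINT t:{0..T}|lborel. \<xi> * exp_kernel \<xi> t * of_real (l T - l t))"
proof -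
  let ?f = "\<lambda>r. \<xi> * exp_kernel \<xi> r * complex_of_real (l r)"
  have f: "set_integrable lborel {0..T} ?f" by (rule set_integrable_exp_of_real[OF l])
  have "(LINT r:{0..T}|lborel. \<xi> * exp_kernel \<xi> r * of_real (l T - l r))
      = (LINT r:{0..T}|lborel. \<xi> * exp_kernel \<xi> r * of_real (l T) - ?f r)"
    by (simp add: algebra_simps)
  also have "\<dots> = (LINT r:{0..T}|lborel. \<xi> * exp_kernel \<xi> r * of_real (l T)) - (LINT r:{0..T}|lborel. ?f r)"
    by (intro set_integral_diff f set_integrable_exp_const)
  also have "(LINT r:{0..T}|lborel. \<xi> * exp_kernel \<xi> r * of_real (l T))
      = (1 - exp_kernel \<xi> T) * of_real (l T)"
    using LINT_exp_Icc[OF assms(1), of \<xi>] by (simp add: set_integral_mult_left)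
  finally show ?thesis
    unfolding noise_transform_def by (simp add: algebra_simps)
qed

definition state_poly :: "nat \<Rightarrow> complex poly \<Rightarrow> (nat \<Rightarrow> real \<Rightarrow> real) \<Rightarrow> real \<Rightarrow> complex" where
  "state_poly p c X t = (\<Sum>k<p. coeff c k * of_real (X k t))"

text \<open>The state equation along one path. The noise path starts at \<open>0\<close> (which the equation at
  \<open>t = 0\<close> enforces), so \<open>l t\<close> is its increment over \<open>[0, t]\<close>.\<close>

definition companion_path :: "nat \<Rightarrow> real poly \<Rightarrow> (nat \<Rightarrow> real \<Rightarrow> real) \<Rightarrow> (real \<Rightarrow> real) \<Rightarrow> bool" where
  "companion_path p a X l \<longleftrightarrow> (\<forall>t\<ge>0. \<forall>i<p. set_integrable lborel {0..t} (X i) \<and>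
     X i t = X i 0 + (LINT s:{0..t}|lborel. if i + 1 < p then X (i + 1) s else - (\<Sum>j<p. coeff a j * X j s))
       + (if i + 1 = p then l t else 0))"

text \<open>The remainder of \<open>(z - \<xi>) c\<close> modulo the monic polynomial \<open>a\<close> of degree \<open>p\<close>, for \<open>c\<close> of
  degree less than \<open>p\<close>.\<close>

abbreviation mult_mod :: "nat \<Rightarrow> real poly \<Rightarrow> complex \<Rightarrow> complex poly \<Rightarrow> complex poly" where
  "mult_mod p a \<xi> c \<equiv> [:- \<xi>, 1:] * c - Polynomial.smult (coeff c (p - 1)) (map_poly of_real a)"

text \<open>The transposed companion matrix is multiplication by the variable \<open>z\<close> modulo \<open>a\<close>.\<close>

lemma state_poly_shift:
  assumes "0 < p"
  shows "(\<Sum>k<p. coeff c k * of_real (if k + 1 < p then X (k + 1) s else - (\<Sum>j<p. coeff a j * X j s)))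
     = state_poly p (pCons 0 c - Polynomial.smult (coeff c (p - 1)) (map_poly of_real a)) X s"
proof -
  obtain n where p: "p = Suc n" using assms by (metis gr0_implies_Suc)
  have "state_poly p (pCons 0 c) X s = (\<Sum>k<n. coeff c k * of_real (X (Suc k) s))"
    unfolding state_poly_def p by (subst sum.lessThan_Suc_shift) simp
  moreover have "state_poly p (pCons 0 c - Polynomial.smult (coeff c (p - 1)) (map_poly of_real a)) X s
      = state_poly p (pCons 0 c) X s - coeff c n * (\<Sum>j<p. of_real (coeff a j) * of_real (X j s))"
    by (simp add: state_poly_def p coeff_map_poly left_diff_distrib sum_subtractf sum_distrib_left mult.assoc algebra_simps)
  moreover have "(\<Sum>k<p. coeff c k * of_real (if k + 1 < p then X (k + 1) s else - R))
      = (\<Sum>k<n. coeff c k * of_real (X (Suc k) s)) - coeff c n * of_real R" for R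
    by (simp add: p)
  ultimately show ?thesis
    by (simp add: p of_real_sum del: sum.lessThan_Suc)
qed

context
  fixes p :: nat and a :: "real poly" and X :: "nat \<Rightarrow> real \<Rightarrow> real" and l :: "real \<Rightarrow> real"
  assumes p: "0 < p" and path: "companion_path p a X l"
begin

lemma set_integrable_state_poly: 
  assumes "0 \<le> t" shows "set_integrable lborel {0..t} (state_poly p c X)"
proof -
  have "set_integrable lborel {0..t} (\<lambda>s. complex_of_real (X k s))" if "k < p" for k
    using path assms that unfolding companion_path_def by (intro set_integrable_of_real) auto
  then show ?thesis
    unfolding state_poly_def set_integrable_def scaleR_sum_right
    by (intro Bochner_Integration.integrable_sum) (auto simp flip: mult_scaleR_right)
qed

lemma set_integrable_row:
  assumes "0 \<le> t" "i < p" 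
  shows "set_integrable lborel {0..t} (\<lambda>s. if i + 1 < p then X (i + 1) s else - (\<Sum>j<p. coeff a j * X j s))"
proof (cases "i + 1 < p")
  case True
  then show ?thesis using path assms unfolding companion_path_def by auto
next
  case False
  have "set_integrable lborel {0..t} (\<lambda>s. coeff a k * X k s)" if "k < p" for k
    using path assms that unfolding companion_path_def by (intro set_integrable_mult_right) auto
  then have "set_integrable lborel {0..t} (\<lambda>s. - (\<Sum>j<p. coeff a j * X j s))"
    unfolding set_integrable_def scaleR_minus_right scaleR_sum_right
    by (intro Bochner_Integration.integrable_minus Bochner_Integration.integrable_sum) auto
  then show ?thesis using False by simp
qed

text \<open>The last state equation expresses \<open>l\<close> by integrable terms.\<close>

lemma set_integrable_noise:
  assumes "0 \<le> t" shows "set_integrable lborel {0..t} l"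
proof -
  let ?r = "\<lambda>s. - (\<Sum>j<p. coeff a j * X j s)"
  have r: "set_integrable lborel {0..t} ?r"
    using set_integrable_row[OF assms, of "p - 1"] p by simp
  have X: "set_integrable lborel {0..t} (X (p - 1))"
    using path assms p unfolding companion_path_def by auto
  have l_eq: "l s = X (p - 1) s - (X (p - 1) 0 + integral {0..s} ?r)" if "s \<in> {0..t}" for s
  proof -
    have "(LINT u:{0..s}|lborel. ?r u) = integral {0..s} ?r"
      using that by (intro set_borel_integral_eq_integral set_integrable_subset[OF r]) auto
    then show ?thesis
      using path[unfolded companion_path_def, rule_format, of s "p - 1"] that p by simp
  qed
  have "continuous_on {0..t} (\<lambda>s. X (p - 1) 0 + integral {0..s} ?r)"
    by (intro continuous_intros indefinite_integral_continuous_1 set_borel_integral_eq_integral r)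
  then have "set_integrable lborel {0..t} (\<lambda>s. X (p - 1) 0 + integral {0..s} ?r)"
    unfolding set_integrable_def by (intro borel_integrable_compact) auto
  from set_integral_diff(1)[OF X this] show ?thesis
    by (subst set_integrable_cong[OF refl refl]) (simp_all add: l_eq)
qed

lemma state_poly_equation:
  assumes t: "0 \<le> t"
  shows "state_poly p c X t = state_poly p c X 0
      + (LINT s:{0..t}|lborel. state_poly p (pCons 0 c - Polynomial.smult (coeff c (p - 1)) (map_poly of_real a)) X s)
      + coeff c (p - 1) * of_real (l t)"
proof -
  define r where "r i s = (if i + 1 < p then X (i + 1) s else - (\<Sum>j<p. coeff a j * X j s))" for i s
  have r: "set_integrable lborel {0..t} (r i)" if "i < p" for i
    using set_integrable_row[OF t that] unfolding r_def .
  have X: "X i t = X i 0 + (LINT s:{0..t}|lborel. r i s) + (if i + 1 = p then l t else 0)" if "i < p" for i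
    using path t that unfolding companion_path_def r_def by blast
  have "(LINT s:{0..t}|lborel. state_poly p (pCons 0 c - Polynomial.smult (coeff c (p - 1)) (map_poly of_real a)) X s)
      = (LINT s:{0..t}|lborel. (\<Sum>k<p. coeff c k * of_real (r k s)))"
    unfolding state_poly_shift[OF p, symmetric] r_def ..
  also have "\<dots> = (\<Sum>k<p. LINT s:{0..t}|lborel. coeff c k * of_real (r k s))"
    unfolding set_lebesgue_integral_def scaleR_sum_right
  proof (rule Bochner_Integration.integral_sum)
    fix k assume "k \<in> {..<p}"
    then show "integrable lborel (\<lambda>s. indicator {0..t} s *\<^sub>R (coeff c k * complex_of_real (r k s)))"
      unfolding set_integrable_def[symmetric] by (intro set_integrable_mult_right set_integrable_of_real r) simp
  qed
  also have "\<dots> = (\<Sum>k<p. coeff c k * of_real (LINT s:{0..t}|lborel. r k s))"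
    by (simp add: set_lebesgue_integral_def scaleR_conv_of_real of_real_mult[symmetric] del: of_real_mult flip: integral_complex_of_real)
  finally have int: "(LINT s:{0..t}|lborel. state_poly p (pCons 0 c - Polynomial.smult (coeff c (p - 1)) (map_poly of_real a)) X s)
      = (\<Sum>k<p. coeff c k * of_real (LINT s:{0..t}|lborel. r k s))" .
  have noise: "(\<Sum>k<p. coeff c k * of_real (if k + 1 = p then l t else 0)) = coeff c (p - 1) * of_real (l t)"
  proof -
    have "(\<Sum>k<p. coeff c k * of_real (if k + 1 = p then l t else 0))
        = (\<Sum>k<p. if k = p - 1 then coeff c k * of_real (l t) else 0)"
      using p by (intro sum.cong) auto
    then show ?thesis using p by simp
  qed
  have "state_poly p c X t = (\<Sum>k<p. coeff c k * of_real (X k 0 + (LINT s:{0..t}|lborel. r k s) + (if k + 1 = p then l t else 0)))"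
    unfolding state_poly_def by (intro sum.cong) (simp_all only: X lessThan_iff)
  also have "\<dots> = state_poly p c X 0 + (\<Sum>k<p. coeff c k * of_real (LINT s:{0..t}|lborel. r k s))
     + (\<Sum>k<p. coeff c k * of_real (if k + 1 = p then l t else 0))"
    unfolding of_real_add distrib_left sum.distrib state_poly_def ..
  finally show ?thesis unfolding int noise .
qed

text \<open>The core identity: transforming with \<open>exp (- \<xi> t)\<close> multiplies \<open>c\<close> by \<open>z - \<xi>\<close> modulo \<open>a\<close>.\<close>

lemma state_poly_exp:
  assumes T: "0 \<le> T"
  shows "exp_kernel \<xi> T * state_poly p c X T - state_poly p c X 0
     = (LINT t:{0..T}|lborel. exp_kernel \<xi> t *
          state_poly p (mult_mod p a \<xi> c) X t)
       + coeff c (p - 1) * noise_transform l \<xi> T"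
proof -
  have "state_poly p (mult_mod p a \<xi> c) X t
     = state_poly p (pCons 0 c - Polynomial.smult (coeff c (p - 1)) (map_poly of_real a)) X t - \<xi> * state_poly p c X t" for t
    by (simp add: state_poly_def sum_distrib_left algebra_simps flip: sum_subtractf)
  then show ?thesis
    using exp_integration_by_parts[OF T set_integrable_state_poly[OF T] set_integrable_noise[OF T] state_poly_equation]
    by simp
qed

lemma fourier_state_poly:
  assumes c: "mult_mod p a \<xi> c = Polynomial.smult u b"
    and T: "0 \<le> T"
  shows "u * (LINT t:{0..T}|lborel. exp_kernel \<xi> t * state_poly p b X t)
      = exp_kernel \<xi> T * state_poly p c X T - state_poly p c X 0 - coeff c (p - 1) * noise_transform l \<xi> T"
proof -
  have S: "exp_kernel \<xi> t * state_poly p (mult_mod p a \<xi> c) X t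
      = u * (exp_kernel \<xi> t * state_poly p b X t)" for t
    unfolding c by (simp add: state_poly_def sum_distrib_left mult_ac)
  show ?thesis
    using state_poly_exp[OF T, of \<xi> c] unfolding S unfolding set_integral_mult_right by simp
qed

end

text \<open>The quotient of \<open>a(\<xi>) b - b(\<xi>) a\<close> by \<open>z - \<xi>\<close>. It depends on the frequency only, so the
  same \<open>c\<close> serves all paths.\<close>

lemma fourier_divisor:
  assumes p: "0 < p" and a: "degree a = p" "lead_coeff a = 1" and b: "degree b < p"
  obtains c where
    "mult_mod p a \<xi> c = Polynomial.smult (poly (map_poly of_real a) \<xi>) b"
    "coeff c (p - 1) = - poly b (\<xi> :: complex)"
proof -
  define ac :: "complex poly" where "ac = map_poly of_real a"
  have ac: "degree ac = p" "coeff ac p = 1" using a by (simp_all add: ac_def degree_map_poly coeff_map_poly)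
  define d where "d = Polynomial.smult (poly ac \<xi>) b - Polynomial.smult (poly b \<xi>) ac"
  have "poly d \<xi> = 0" by (simp add: d_def)
  then obtain c where c: "d = [:- \<xi>, 1:] * c" by (auto simp: poly_eq_0_iff_dvd)
  have deg_d: "degree d \<le> p" using b ac by (auto simp: d_def intro!: degree_diff_le degree_smult_le[THEN order_trans])
  have deg_c: "degree c < p"
  proof (cases "c = 0")
    case False
    have "degree d = 1 + degree c" unfolding c using False by (subst degree_mult_eq) auto
    then show ?thesis using deg_d by simp
  qed (use p in simp)
  have "coeff d p = - poly b \<xi>" using b ac by (simp add: d_def coeff_eq_0)
  moreover have "coeff d p = coeff c (p - 1)"
    using deg_c p unfolding c by (cases p) (simp_all add: coeff_eq_0)
  ultimately have cp: "coeff c (p - 1) = - poly b \<xi>" by simp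
  have "[:- \<xi>, 1:] * c - Polynomial.smult (coeff c (p - 1)) ac = Polynomial.smult (poly ac \<xi>) b"
    unfolding c[symmetric] cp by (simp add: d_def)
  then show thesis using that cp unfolding ac_def by blast
qed

section \<open>Moment bounds for the state and for the noise transform\<close>

text \<open>The \<open>L\<^sup>1\<close> norm of the restriction of \<open>f\<close> to the event \<open>E\<close>. Values in \<^typ>\<open>ennreal\<close> allow
  estimates without proofs of integrability.\<close>

definition l1_norm :: "'a measure \<Rightarrow> 'a set \<Rightarrow> ('a \<Rightarrow> complex) \<Rightarrow> ennreal" where
  "l1_norm M E f = (\<integral>\<^sup>+x\<in>E. ennreal (norm (f x)) \<partial>M)"

lemma l1_norm_mono_set: "E \<subseteq> E' \<Longrightarrow> l1_norm M E f \<le> l1_norm M E' f"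
  unfolding l1_norm_def by (intro nn_integral_mono mult_left_mono) (auto simp: indicator_def)

lemma l1_norm_mono: "(\<And>x. x \<in> space M \<Longrightarrow> x \<in> E \<Longrightarrow> norm (f x) \<le> norm (g x)) \<Longrightarrow> l1_norm M E f \<le> l1_norm M E g"
  unfolding l1_norm_def by (intro nn_integral_mono) (auto simp: indicator_def ennreal_leI)

lemma l1_norm_cong: "(\<And>x. x \<in> space M \<Longrightarrow> x \<in> E \<Longrightarrow> f x = g x) \<Longrightarrow> l1_norm M E f = l1_norm M E g"
  unfolding l1_norm_def by (intro nn_integral_cong) (auto simp: indicator_def)

lemma l1_norm_add:
  assumes "f \<in> borel_measurable M" "g \<in> borel_measurable M" "E \<in> sets M"
  shows "l1_norm M E (\<lambda>x. f x + g x) \<le> l1_norm M E f + l1_norm M E g"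
proof -
  note [measurable] = assms
  have "l1_norm M E (\<lambda>x. f x + g x) \<le> (\<integral>\<^sup>+x. ennreal (norm (f x)) * indicator E x + ennreal (norm (g x)) * indicator E x \<partial>M)"
    unfolding l1_norm_def
    by (intro nn_integral_mono) 
       (auto simp: indicator_def norm_triangle_ineq ennreal_leI simp flip: ennreal_plus)
  also have "\<dots> = l1_norm M E f + l1_norm M E g"
    unfolding l1_norm_def by (intro nn_integral_add) measurable
  finally show ?thesis .
qed

lemma l1_norm_cmult:
  assumes "f \<in> borel_measurable M" "E \<in> sets M"
  shows "l1_norm M E (\<lambda>x. c * f x) = ennreal (norm c) * l1_norm M E f"
proof -
  note [measurable] = assms
  show ?thesis unfolding l1_norm_def norm_mult ennreal_mult'[OF norm_ge_zero] mult.assoc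
    by (rule nn_integral_cmult) measurable
qed

lemma l1_norm_add_le:
  assumes "l1_norm M E f \<le> ennreal A" "l1_norm M E g \<le> ennreal B" "0 \<le> A" "0 \<le> B"
    and "f \<in> borel_measurable M" "g \<in> borel_measurable M" "E \<in> sets M"
  shows "l1_norm M E (\<lambda>x. f x + g x) \<le> ennreal (A + B)"
  using order_trans[OF l1_norm_add[OF assms(5-7)] add_mono[OF assms(1,2)]] assms(3,4) by simp

lemma l1_norm_cmult_le:
  assumes "l1_norm M E f \<le> ennreal B" "norm c \<le> r" "0 \<le> B"
    and "f \<in> borel_measurable M" "E \<in> sets M"
  shows "l1_norm M E (\<lambda>x. c * f x) \<le> ennreal (r * B)"
proof -
  have "0 \<le> r" using assms(2) norm_ge_zero order_trans by blast
  have "l1_norm M E (\<lambda>x. c * f x) \<le> ennreal r * ennreal B"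
    unfolding l1_norm_cmult[OF assms(4,5)] by (intro mult_mono assms(1) ennreal_leI assms(2)) auto
  then show ?thesis using \<open>0 \<le> r\<close> assms(3) by (simp add: ennreal_mult)
qed

lemma l1_norm_sum:
  assumes "finite I" "\<And>i. i \<in> I \<Longrightarrow> f i \<in> borel_measurable M" "E \<in> sets M"
  shows "l1_norm M E (\<lambda>x. \<Sum>i\<in>I. f i x) \<le> (\<Sum>i\<in>I. l1_norm M E (f i))"
  using assms(1,2)
proof (induction I rule: finite_induct)
  case empty
  show ?case by (simp add: l1_norm_def)
next
  case (insert j I)
  have "l1_norm M E (\<lambda>x. f j x + (\<Sum>i\<in>I. f i x)) \<le> l1_norm M E (f j) + l1_norm M E (\<lambda>x. \<Sum>i\<in>I. f i x)"
    using insert.prems assms(3) by (intro l1_norm_add borel_measurable_sum) auto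
  also have "\<dots> \<le> l1_norm M E (f j) + (\<Sum>i\<in>I. l1_norm M E (f i))"
    using insert by (intro add_left_mono) auto
  finally show ?case using insert by simp
qed

lemma norm_LINT_le_nn_integral: "ennreal (norm (LINT x|M. f x)) \<le> (\<integral>\<^sup>+x. ennreal (norm (f x)) \<partial>M)"
  for f :: "'a \<Rightarrow> complex"
  by (cases "integrable M f") (auto intro: integral_norm_bound_ennreal simp: not_integrable_integral_eq)

text \<open>Minkowski's inequality for integrals, by Tonelli's theorem.\<close>

lemma (in sigma_finite_measure) l1_norm_LINT:
  fixes f :: "real \<Rightarrow> 'a \<Rightarrow> complex"
  assumes f: "(\<lambda>(t, x). f t x) \<in> borel_measurable (borel \<Otimes>\<^sub>M M)" and E: "E \<in> sets M"
    and h: "\<And>t. s \<le> t \<Longrightarrow> t \<le> u \<Longrightarrow> l1_norm M E (f t) \<le> ennreal (h t)"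
  shows "l1_norm M E (\<lambda>x. LINT t:{s..u}|lborel. f t x) \<le> (\<integral>\<^sup>+t\<in>{s..u}. ennreal (h t) \<partial>lborel)"
proof -
  interpret P: pair_sigma_finite M lborel ..
  have f'[measurable]: "(\<lambda>p. f (snd p) (fst p)) \<in> borel_measurable (M \<Otimes>\<^sub>M borel)"
    using measurable_compose[OF measurable_pair_swap' f] by (simp add: case_prod_beta comp_def)
  note [measurable] = E
  have "l1_norm M E (\<lambda>x. LINT t:{s..u}|lborel. f t x)
      \<le> (\<integral>\<^sup>+x. (\<integral>\<^sup>+t. ennreal (norm (f t x)) * indicator {s..u} t * indicator E x \<partial>lborel) \<partial>M)"
    unfolding l1_norm_def
  proof (rule nn_integral_mono)
    fix x assume x: "x \<in> space M"
    have [measurable]: "(\<lambda>t. f t x) \<in> borel_measurable borel"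
      using measurable_compose[OF measurable_Pair1'[OF x] f'] by simp
    have "ennreal (norm (LINT t:{s..u}|lborel. f t x)) \<le> (\<integral>\<^sup>+t. ennreal (norm (f t x)) * indicator {s..u} t \<partial>lborel)"
      unfolding set_lebesgue_integral_def
      by (rule order_trans[OF norm_LINT_le_nn_integral]) 
         (auto intro!: nn_integral_mono simp: indicator_def)
    then have "ennreal (norm (LINT t:{s..u}|lborel. f t x)) * indicator E x
        \<le> (\<integral>\<^sup>+t. ennreal (norm (f t x)) * indicator {s..u} t \<partial>lborel) * indicator E x"
      by (rule mult_right_mono) simp
    also have "\<dots> = (\<integral>\<^sup>+t. ennreal (norm (f t x)) * indicator {s..u} t * indicator E x \<partial>lborel)"
      by (rule nn_integral_multc[symmetric]) measurable
    finally show "ennreal (norm (LINT t:{s..u}|lborel. f t x)) * indicator E x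
        \<le> (\<integral>\<^sup>+t. ennreal (norm (f t x)) * indicator {s..u} t * indicator E x \<partial>lborel)" .
  qed
  also have "\<dots> = (\<integral>\<^sup>+t. (\<integral>\<^sup>+x. ennreal (norm (f t x)) * indicator {s..u} t * indicator E x \<partial>M) \<partial>lborel)"
    by (intro P.Fubini'[symmetric]) measurable
  also have "\<dots> \<le> (\<integral>\<^sup>+t\<in>{s..u}. ennreal (h t) \<partial>lborel)"
  proof (rule nn_integral_mono)
    fix t :: real
    have "(\<integral>\<^sup>+x. ennreal (norm (f t x)) * indicator {s..u} t * indicator E x \<partial>M) = (if t \<in> {s..u} then l1_norm M E (f t) else 0)"
      unfolding l1_norm_def by auto
    then show "(\<integral>\<^sup>+x. ennreal (norm (f t x)) * indicator {s..u} t * indicator E x \<partial>M) \<le> ennreal (h t) * indicator {s..u} t"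
      using h[of t] by auto
  qed
  finally show ?thesis .
qed

lemma nn_integral_exp_decay_le:
  assumes "0 < \<rho>" "0 \<le> C" "0 \<le> T"
  shows "(\<integral>\<^sup>+t\<in>{0..T}. ennreal (C * exp (- \<rho> * (T - t))) \<partial>lborel) \<le> ennreal (C / \<rho>)"
proof -
  have "(\<integral>\<^sup>+t. ennreal (C * exp (- \<rho> * (T - t))) * indicator {0..T} t \<partial>lborel)
      = ennreal (C / \<rho> * exp (- \<rho> * (T - T)) - C / \<rho> * exp (- \<rho> * (T - 0)))"
    using assms by (intro nn_integral_FTC_Icc) (auto intro!: derivative_eq_intros)
  also have "\<dots> \<le> ennreal (C / \<rho>)" using assms by (intro ennreal_leI) simp
  finally show ?thesis .
qed

text \<open>Versions of noise and state for which the pathwise equation holds for every point of the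
  sample space and which are jointly measurable in time and sample point. The only
  probabilistic input is the first absolute moment of the increments.\<close>

locale carma_paths = prob_space M for M :: "'a measure" +
  fixes L :: "real \<Rightarrow> 'a \<Rightarrow> real" and \<sigma> :: real
    and p :: nat and a :: "real poly" and X :: "nat \<Rightarrow> real \<Rightarrow> 'a \<Rightarrow> real"
  assumes measurable_L: "(\<lambda>(t, x). L t x) \<in> borel_measurable (borel \<Otimes>\<^sub>M M)"
    and measurable_X: "\<And>k. k < p \<Longrightarrow> (\<lambda>(t, x). X k t x) \<in> borel_measurable (borel \<Otimes>\<^sub>M M)"
    and L_0: "\<And>x. x \<in> space M \<Longrightarrow> L 0 x = 0"
    and L_increment: "\<And>s t. 0 \<le> s \<Longrightarrow> s \<le> t \<Longrightarrow>
      l1_norm M (space M) (\<lambda>x. of_real (L t x - L s x)) \<le> ennreal (\<bar>\<sigma>\<bar> * sqrt (t - s))"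
    and path: "\<And>x. x \<in> space M \<Longrightarrow> companion_path p a (\<lambda>k t. X k t x) (\<lambda>t. L t x)"
    and degree_a: "degree a = p" and monic_a: "lead_coeff a = 1" and p: "0 < p"
    and stable: "\<And>z. poly (map_poly of_real a) z = 0 \<Longrightarrow> Re z < 0"
begin

lemma measurable_L'[measurable (raw)]:
  "f \<in> N \<rightarrow>\<^sub>M borel \<Longrightarrow> g \<in> N \<rightarrow>\<^sub>M M \<Longrightarrow> (\<lambda>y. L (f y) (g y)) \<in> borel_measurable N"
  using measurable_compose[OF measurable_Pair[of f N borel g M] measurable_L] by simp

lemma measurable_X':
  "k < p \<Longrightarrow> f \<in> N \<rightarrow>\<^sub>M borel \<Longrightarrow> g \<in> N \<rightarrow>\<^sub>M M \<Longrightarrow> (\<lambda>y. X k (f y) (g y)) \<in> borel_measurable N"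
  using measurable_compose[OF measurable_Pair[of f N borel g M] measurable_X] by simp

abbreviation S :: "complex poly \<Rightarrow> real \<Rightarrow> 'a \<Rightarrow> complex" where
  "S c t x \<equiv> state_poly p c (\<lambda>k t. X k t x) t"

abbreviation noise :: "complex \<Rightarrow> real \<Rightarrow> 'a \<Rightarrow> complex" where
  "noise \<xi> t x \<equiv> noise_transform (\<lambda>t. L t x) \<xi> t"

lemma measurable_S[measurable (raw)]:
  "f \<in> N \<rightarrow>\<^sub>M borel \<Longrightarrow> g \<in> N \<rightarrow>\<^sub>M M \<Longrightarrow> (\<lambda>y. S c (f y) (g y)) \<in> borel_measurable N"
  unfolding state_poly_def
  by (intro borel_measurable_sum borel_measurable_times borel_measurable_const
      measurable_compose[OF measurable_X' borel_measurable_of_real]) auto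

lemma measurable_noise[measurable]: "noise \<xi> t \<in> borel_measurable M"
  unfolding noise_transform_def set_lebesgue_integral_def by measurable

lemma set_integrable_L: "x \<in> space M \<Longrightarrow> 0 \<le> t \<Longrightarrow> set_integrable lborel {0..t} (\<lambda>t. L t x)"
  using set_integrable_noise[OF p path] by blast

lemma L_increment_on:
  assumes "E \<in> sets M" "0 \<le> s" "s \<le> t"
  shows "l1_norm M E (\<lambda>x. of_real (L t x - L s x)) \<le> ennreal (\<bar>\<sigma>\<bar> * sqrt (t - s))"
  using l1_norm_mono_set[OF sets.sets_into_space[OF assms(1)]] L_increment[OF assms(2,3)] order_trans by blast

lemma sqrt_exp_decay:
  assumes "0 < \<rho>" "0 \<le> (s::real)"
  shows "sqrt s * exp (- \<rho> * s) \<le> (1 + 2 / \<rho>) * exp (- (\<rho> / 2) * s)"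
proof -
  have "sqrt s \<le> 1 + s" using assms by (intro real_le_lsqrt) (auto simp: power2_eq_square algebra_simps)
  also have "1 + s \<le> (1 + 2 / \<rho>) * (1 + \<rho> / 2 * s)" using assms by (simp add: field_simps)
  also have "\<dots> \<le> (1 + 2 / \<rho>) * exp (\<rho> / 2 * s)"
    using assms by (intro mult_left_mono exp_ge_add_one_self) auto
  finally have "sqrt s * exp (- \<rho> * s) \<le> (1 + 2 / \<rho>) * exp (\<rho> / 2 * s) * exp (- \<rho> * s)"
    by (rule mult_right_mono) simp
  also have "\<dots> = (1 + 2 / \<rho>) * exp (- (\<rho> / 2) * s)"
    by (simp add: mult.assoc exp_add[symmetric] field_simps)
  finally show ?thesis .
qed

text \<open>In the backward form of the transform the increment over a lag \<open>s\<close> has \<open>L\<^sup>1\<close> norm at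
  most \<open>\<bar>\<sigma>\<bar> * sqrt s\<close>, and this is integrable against \<open>exp (Re \<xi> * s)\<close>.\<close>

lemma stable_noise_bounded:
  assumes \<xi>: "Re \<xi> < 0"
  shows "\<exists>C\<ge>0. \<forall>T\<ge>0. \<forall>E\<in>sets M. l1_norm M E (\<lambda>x. exp (\<xi> * of_real T) * noise \<xi> T x) \<le> ennreal C"
proof -
  define \<rho> where "\<rho> = - Re \<xi>"
  have \<rho>: "0 < \<rho>" using \<xi> by (simp add: \<rho>_def)
  \<comment> \<open>Half of the exponential decay is spent on absorbing the square root.\<close>
  define B where "B = \<bar>\<sigma>\<bar> * (1 + 2 / \<rho>)"
  have B: "0 \<le> B" using \<rho> by (simp add: B_def)
  have decay: "\<bar>\<sigma>\<bar> * sqrt s * exp (- \<rho> * s) \<le> B * exp (- (\<rho> / 2) * s)" if "0 \<le> s" for s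
    using mult_left_mono[OF sqrt_exp_decay[OF \<rho> that], of "\<bar>\<sigma>\<bar>"] by (simp add: B_def mult.assoc)
  show ?thesis
  proof (intro exI[of _ "B + norm \<xi> * B / (\<rho> / 2)"] conjI allI impI ballI)
    show "0 \<le> B + norm \<xi> * B / (\<rho> / 2)" using B \<rho> by simp
    fix T :: real and E assume T: "0 \<le> T" and E: "E \<in> sets M"
    define f where "f t x = - \<xi> * exp (\<xi> * of_real (T - t)) * of_real (L T x - L t x)" for t x
    have f_meas: "(\<lambda>(t, x). f t x) \<in> borel_measurable (borel \<Otimes>\<^sub>M M)"
      unfolding f_def by measurable
    have decomp: "exp (\<xi> * of_real T) * noise \<xi> T x
        = exp (\<xi> * of_real T) * of_real (L T x - L 0 x) + (LINT t:{0..T}|lborel. f t x)" if x: "x \<in> space M" for x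
    proof -
      have "f t x = (- exp (\<xi> * of_real T)) * (\<xi> * exp_kernel \<xi> t * of_real (L T x - L t x))" for t
        by (simp add: f_def exp_diff exp_minus field_simps)
      then have "(LINT t:{0..T}|lborel. f t x)
          = (- exp (\<xi> * of_real T)) * (LINT t:{0..T}|lborel. \<xi> * exp_kernel \<xi> t * of_real (L T x - L t x))"
        by (simp only: set_integral_mult_right)
      then show ?thesis
        unfolding noise_transform_backward[OF T set_integrable_L[OF x T], of \<xi>] 
        unfolding L_0[OF x] right_diff_distrib by (simp only: diff_zero mult_minus_left diff_conv_add_uminus[symmetric])
    qed
    have fb: "l1_norm M E (f t) \<le> ennreal (norm \<xi> * B * exp (- (\<rho> / 2) * (T - t)))" if t: "0 \<le> t" "t \<le> T" for t
    proof -
      have "l1_norm M E (f t) \<le> ennreal (norm \<xi> * exp (- \<rho> * (T - t)) * (\<bar>\<sigma>\<bar> * sqrt (T - t)))"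
        unfolding f_def using t E by (intro l1_norm_cmult_le L_increment_on) (auto simp: norm_mult \<rho>_def)
      also have "\<dots> = ennreal (norm \<xi> * (\<bar>\<sigma>\<bar> * sqrt (T - t) * exp (- \<rho> * (T - t))))"
        by (simp only: mult_ac)
      also have "\<dots> \<le> ennreal (norm \<xi> * (B * exp (- (\<rho> / 2) * (T - t))))"
        using t by (intro ennreal_leI mult_left_mono decay) auto
      finally show ?thesis by (simp add: mult.assoc)
    qed
    have "l1_norm M E (\<lambda>x. exp (\<xi> * of_real T) * noise \<xi> T x)
        = l1_norm M E (\<lambda>x. exp (\<xi> * of_real T) * of_real (L T x - L 0 x) + (LINT t:{0..T}|lborel. f t x))"
      by (rule l1_norm_cong) (rule decomp)
    also have "\<dots> \<le> ennreal (B + norm \<xi> * B / (\<rho> / 2))"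
    proof (rule l1_norm_add_le)
      have "l1_norm M E (\<lambda>x. exp (\<xi> * of_real T) * of_real (L T x - L 0 x)) \<le> ennreal (exp (- \<rho> * T) * (\<bar>\<sigma>\<bar> * sqrt (T - 0)))"
        using T E by (intro l1_norm_cmult_le L_increment_on) (auto simp: \<rho>_def)
      also have "\<dots> \<le> ennreal (B * exp (- (\<rho> / 2) * T))"
        using decay[OF T] by (intro ennreal_leI) (simp add: mult_ac)
      also have "\<dots> \<le> ennreal (B * 1)" using B T \<rho> by (intro ennreal_leI mult_left_mono) auto
      finally show "l1_norm M E (\<lambda>x. exp (\<xi> * of_real T) * of_real (L T x - L 0 x)) \<le> ennreal B" by simp
      show "l1_norm M E (\<lambda>x. LINT t:{0..T}|lborel. f t x) \<le> ennreal (norm \<xi> * B / (\<rho> / 2))"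
        using \<rho> B T by (intro order_trans[OF l1_norm_LINT[OF f_meas E fb] nn_integral_exp_decay_le]) auto
      show "(\<lambda>x. LINT t:{0..T}|lborel. f t x) \<in> borel_measurable M"
        unfolding f_def set_lebesgue_integral_def by measurable
    qed (use B \<rho> E in \<open>simp_all, measurable\<close>)
    finally show "l1_norm M E (\<lambda>x. exp (\<xi> * of_real T) * noise \<xi> T x) \<le> ennreal (B + norm \<xi> * B / (\<rho> / 2))" .
  qed
qed

text \<open>The initial state need not have moments, so estimates are made on these events, which
  exhaust the sample space.\<close>

definition initial_bounded :: "real \<Rightarrow> 'a set" where
  "initial_bounded K = {x \<in> space M. \<forall>k<p. \<bar>X k 0 x\<bar> \<le> K}"

lemma sets_initial_bounded[measurable]: "initial_bounded K \<in> sets M"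
proof -
  have "initial_bounded K = {x \<in> space M. \<forall>k\<in>{..<p}. \<bar>X k 0 x\<bar> \<le> K}" by (auto simp: initial_bounded_def)
  also have "\<dots> \<in> sets M"
    using measurable_X'[of _ "\<lambda>_. 0" M "\<lambda>x. x"] by (intro sets.sets_Collect_finite_All) auto
  finally show ?thesis .
qed

text \<open>Induction on the degree of \<open>r\<close>, a polynomial that annihilates \<open>c\<close> modulo \<open>a\<close>. For a root
  \<open>\<xi>\<close> of \<open>r\<close>, the functional of \<open>c\<close> is a stable convolution of the functional of
  \<open>c' = (z - \<xi>) c mod a\<close>, plus the effects of the initial value and of the noise. The
  remaining factor of \<open>r\<close> annihilates \<open>c'\<close>. This replaces decay estimates for the matrix
  exponential, and multiple roots need no special treatment.\<close>

lemma state_bounded_aux: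
  assumes "r \<noteq> 0" "\<And>z. poly r z = 0 \<Longrightarrow> Re z < 0" "degree c < p" "map_poly of_real a dvd r * c"
  shows "\<exists>C\<ge>0. \<forall>T\<ge>0. l1_norm M (initial_bounded K) (S c T) \<le> ennreal C"
  using assms
proof (induction "degree r" arbitrary: r c)
  case 0
  define ac :: "complex poly" where "ac = map_poly of_real a"
  obtain r0 where r: "r = [:r0:]" using degree_eq_zeroE[OF 0(1)[symmetric]] .
  have r0: "r0 \<noteq> 0" using r 0(2) by auto
  have "[:r0:] * c = Polynomial.smult r0 c" by simp
  then have "ac dvd c" using 0(5) r0 dvd_smult_cancel[of ac r0 c] unfolding r ac_def[symmetric] by metis
  moreover have "degree c < degree ac" using 0(4) degree_a by (simp add: ac_def degree_map_poly)
  ultimately have "c = 0" using dvd_imp_degree_le[of ac c] by (cases "c = 0") simp_all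
  then show ?case by (auto simp: l1_norm_def state_poly_def)
next
  case (Suc n)
  let ?E = "initial_bounded K"
  define ac :: "complex poly" where "ac = map_poly of_real a"
  have ac: "degree ac = p" "coeff ac p = 1"
    using degree_a monic_a by (simp_all add: ac_def degree_map_poly coeff_map_poly)
  have "\<not> constant (poly r)" using Suc(2) by (simp add: constant_degree)
  then obtain \<xi> where root: "poly r \<xi> = 0" using fundamental_theorem_of_algebra by blast
  have \<xi>: "Re \<xi> < 0" by (rule Suc.prems(2)[OF root])
  obtain r' where r: "r = [:- \<xi>, 1:] * r'" using root by (auto simp: poly_eq_0_iff_dvd)
  have r': "r' \<noteq> 0" using Suc.prems(1) r by auto
  have deg_r': "degree r' = n" using Suc(2) r' unfolding r by (subst (asm) degree_mult_eq) auto
  define \<kappa> where "\<kappa> = coeff c (p - 1)"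
  define c' where "c' = [:- \<xi>, 1:] * c - Polynomial.smult \<kappa> ac"
  have "degree c' < p"
  proof -
    have "degree ([:- \<xi>, 1:] * c) \<le> p"
      using degree_mult_le[of "[:- \<xi>, 1:]" c] Suc.prems(3) by simp
    then have "degree c' \<le> p" unfolding c'_def
      using ac by (intro degree_diff_le) (auto intro: degree_smult_le[THEN order_trans])
    moreover have "coeff c' p = 0"
      using p ac Suc.prems(3) by (cases p) (simp_all add: c'_def \<kappa>_def coeff_eq_0)
    ultimately show ?thesis using p
      by (cases "degree c' = p") auto
  qed
  moreover have "ac dvd r' * c'"
  proof -
    have "r' * c' = r * c - ac * Polynomial.smult \<kappa> r'"
      by (simp add: c'_def r algebra_simps)
    then show ?thesis using Suc.prems(4) unfolding ac_def[symmetric] by (simp only:) (intro dvd_diff dvd_triv_left)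
  qed
  ultimately obtain C' where C': "C' \<ge> 0" "\<And>T. 0 \<le> T \<Longrightarrow> l1_norm M ?E (S c' T) \<le> ennreal C'"
    using Suc(1)[of r' c'] deg_r' r' Suc.prems(2) unfolding ac_def r by auto
  obtain N where N: "N \<ge> 0" "\<And>T. 0 \<le> T \<Longrightarrow> l1_norm M ?E (\<lambda>x. exp (\<xi> * of_real T) * noise \<xi> T x) \<le> ennreal N"
    using stable_noise_bounded[OF \<xi>] sets_initial_bounded by blast
  define \<rho> where "\<rho> = - Re \<xi>"
  have \<rho>: "0 < \<rho>" using \<xi> by (simp add: \<rho>_def)
  define D where "D = (\<Sum>k<p. norm (coeff c k)) * \<bar>K\<bar>"
  have D: "0 \<le> D" by (simp add: D_def sum_nonneg)
  show ?case
  proof (intro exI[of _ "D + C' / \<rho> + norm \<kappa> * N"] conjI allI impI)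
    show "0 \<le> D + C' / \<rho> + norm \<kappa> * N" using D C' N \<rho> by simp
    fix T :: real assume T: "0 \<le> T"
    define f where "f t x = exp (\<xi> * of_real (T - t)) * S c' t x" for t x
    have f_meas: "(\<lambda>(t, x). f t x) \<in> borel_measurable (borel \<Otimes>\<^sub>M M)"
      unfolding f_def by measurable
    have decomp: "S c T x = exp (\<xi> * of_real T) * S c 0 x + (LINT t:{0..T}|lborel. f t x)
        + \<kappa> * (exp (\<xi> * of_real T) * noise \<xi> T x)" if x: "x \<in> space M" for x
    proof -
      have "f t x = exp (\<xi> * of_real T) * (exp_kernel \<xi> t * S c' t x)" for t
        by (simp add: f_def exp_diff exp_minus field_simps)
      then have "(LINT t:{0..T}|lborel. f t x)
          = exp (\<xi> * of_real T) * (LINT t:{0..T}|lborel. exp_kernel \<xi> t * S c' t x)"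
        by (simp only: set_integral_mult_right)
      also have "(LINT t:{0..T}|lborel. exp_kernel \<xi> t * S c' t x)
          = exp_kernel \<xi> T * S c T x - S c 0 x - \<kappa> * noise \<xi> T x"
        using state_poly_exp[OF p path[OF x] T, of \<xi> c] by (simp add: c'_def \<kappa>_def ac_def)
      finally have "(LINT t:{0..T}|lborel. f t x)
          = exp (\<xi> * of_real T) * (exp_kernel \<xi> T * S c T x - S c 0 x - \<kappa> * noise \<xi> T x)" .
      moreover have "exp (\<xi> * of_real T) * exp_kernel \<xi> T = 1" by (simp add: exp_minus)
      moreover have "s = e * s0 + g + k * (e * n)" if "g = e * (i * s - s0 - k * n)" "e * i = 1"
        for e i s s0 g k n :: complex
      proof -
        have "g = (e * i) * s - e * s0 - k * (e * n)" unfolding that(1) by (simp add: algebra_simps)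
        then show ?thesis unfolding that(2) by simp
      qed
      ultimately show ?thesis by blast
    qed
    have fb: "l1_norm M ?E (f t) \<le> ennreal (C' * exp (- \<rho> * (T - t)))" if t: "0 \<le> t" "t \<le> T" for t
    proof -
      have "l1_norm M ?E (f t) \<le> ennreal (exp (- \<rho> * (T - t)) * C')"
        unfolding f_def using t C' by (intro l1_norm_cmult_le C') (auto simp: \<rho>_def)
      then show ?thesis by (simp only: mult.commute)
    qed
    have "l1_norm M ?E (S c T) = l1_norm M ?E (\<lambda>x. exp (\<xi> * of_real T) * S c 0 x + (LINT t:{0..T}|lborel. f t x)
        + \<kappa> * (exp (\<xi> * of_real T) * noise \<xi> T x))"
      by (rule l1_norm_cong) (rule decomp)
    also have "\<dots> \<le> ennreal (D + C' / \<rho> + norm \<kappa> * N)"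
    proof (intro l1_norm_add_le)
      have "norm (exp (\<xi> * of_real T) * S c 0 x) \<le> norm (of_real D :: complex)" if "x \<in> ?E" for x
      proof -
        have "norm (S c 0 x) \<le> (\<Sum>k<p. norm (coeff c k) * \<bar>K\<bar>)"
          unfolding state_poly_def using that
          by (intro sum_norm_le) (auto simp: norm_mult initial_bounded_def intro!: mult_left_mono)
        then have "norm (S c 0 x) \<le> D" by (simp add: D_def sum_distrib_right)
        moreover have "norm (exp (\<xi> * of_real T)) \<le> 1" using \<xi> T by (simp add: mult_le_0_iff)
        ultimately have "norm (exp (\<xi> * of_real T)) * norm (S c 0 x) \<le> 1 * D" by (intro mult_mono) auto
        then show ?thesis using D by (simp add: norm_mult)
      qed
      then have "l1_norm M ?E (\<lambda>x. exp (\<xi> * of_real T) * S c 0 x) \<le> l1_norm M ?E (\<lambda>x. of_real D)"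
        by (intro l1_norm_mono)
      also have "\<dots> = ennreal D * emeasure M ?E"
        unfolding l1_norm_def using D by (simp add: nn_integral_cmult_indicator)
      also have "\<dots> \<le> ennreal D * 1"
        by (intro mult_left_mono emeasure_le_1) simp
      finally show "l1_norm M ?E (\<lambda>x. exp (\<xi> * of_real T) * S c 0 x) \<le> ennreal D" by simp
      show "l1_norm M ?E (\<lambda>x. LINT t:{0..T}|lborel. f t x) \<le> ennreal (C' / \<rho>)"
        using \<rho> C' T
        by (intro order_trans[OF l1_norm_LINT[OF f_meas sets_initial_bounded fb] nn_integral_exp_decay_le]) auto
      show "l1_norm M ?E (\<lambda>x. \<kappa> * (exp (\<xi> * of_real T) * noise \<xi> T x)) \<le> ennreal (norm \<kappa> * N)"
        by (intro l1_norm_cmult_le N T) auto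
      show LINT_meas: "(\<lambda>x. LINT t:{0..T}|lborel. f t x) \<in> borel_measurable M"
        unfolding f_def set_lebesgue_integral_def by measurable
      show "(\<lambda>x. exp (\<xi> * of_real T) * S c 0 x + (LINT t:{0..T}|lborel. f t x)) \<in> borel_measurable M"
        using LINT_meas by measurable
    qed (use D C' N \<rho> in auto)
    finally show "l1_norm M ?E (S c T) \<le> ennreal (D + C' / \<rho> + norm \<kappa> * N)" .
  qed
qed

text \<open>Every polynomial is annihilated by \<open>a\<close> modulo \<open>a\<close>.\<close>

lemma state_bounded:
  "\<exists>C\<ge>0. \<forall>T\<ge>0. l1_norm M (initial_bounded K) (S c T) \<le> ennreal C"
proof -
  \<comment> \<open>Only the coefficients below \<open>p\<close> enter the functional.\<close>
  define c' where "c' = poly_cutoff p c"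
  have S: "S c T = S c' T" for T
    by (simp add: fun_eq_iff state_poly_def c'_def coeff_poly_cutoff)
  have "degree c' < p" 
    unfolding c'_def using p by (intro degree_lessI) (auto simp: coeff_poly_cutoff)
  moreover have "map_poly complex_of_real a \<noteq> 0" using p degree_a by auto
  ultimately show ?thesis
    unfolding S using stable by (intro state_bounded_aux[of "map_poly of_real a"]) auto
qed


lemma norm_wave_diff_le:
  "norm (exp_kernel (\<i> * of_real w) t - exp_kernel (\<i> * of_real w) s) \<le> \<bar>w\<bar> * \<bar>t - s\<bar>"
proof -
  have "exp_kernel (\<i> * of_real w) t - exp_kernel (\<i> * of_real w) s 
      = exp_kernel (\<i> * of_real w) s * (iexp (- (w * (t - s))) - 1)"
    by (simp add: right_diff_distrib exp_add[symmetric] algebra_simps)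
  moreover have "norm (iexp (- (w * (t - s))) - 1) \<le> \<bar>w\<bar> * \<bar>t - s\<bar>"
    using iexp_approx1[of "- (w * (t - s))" 0] by (simp add: abs_mult)
  ultimately show ?thesis by (simp add: norm_mult)
qed

text \<open>Both the variation of the wave and the oscillation of the noise over the interval enter
  the error, which gives the exponent \<open>3/2\<close> of its length.\<close>

lemma noise_increment_approx:
  assumes st: "0 \<le> s" "s \<le> t"
  shows "l1_norm M (space M) (\<lambda>x. noise (\<i> * of_real w) t x - noise (\<i> * of_real w) s x
      - exp_kernel (\<i> * of_real w) s * of_real (L t x - L s x))
    \<le> ennreal (2 * \<bar>w\<bar> * \<bar>\<sigma>\<bar> * (t - s) * sqrt (t - s))"
proof -
  define \<xi> where "\<xi> = \<i> * complex_of_real w"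
  have norm_\<xi>: "norm \<xi> = \<bar>w\<bar>" by (simp add: \<xi>_def norm_mult)
  define g where "g = exp_kernel \<xi> t - exp_kernel \<xi> s"
  have g: "norm g \<le> \<bar>w\<bar> * (t - s)" using norm_wave_diff_le[of w t s] st by (simp add: g_def \<xi>_def)
  define f where "f r x = \<xi> * exp_kernel \<xi> r * of_real (L r x - L s x)" for r x
  have f_meas: "(\<lambda>(t, x). f t x) \<in> borel_measurable (borel \<Otimes>\<^sub>M M)"
    unfolding f_def by measurable
  let ?B = "\<bar>w\<bar> * (\<bar>\<sigma>\<bar> * sqrt (t - s))"
  have fb: "l1_norm M (space M) (f r) \<le> ennreal ?B" if r: "s \<le> r" "r \<le> t" for r
  proof -
    have "l1_norm M (space M) (f r) \<le> ennreal (\<bar>w\<bar> * (\<bar>\<sigma>\<bar> * sqrt (r - s)))"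
      unfolding f_def using r st
      by (intro l1_norm_cmult_le L_increment) (auto simp: norm_mult norm_\<xi> \<xi>_def)
    also have "\<dots> \<le> ennreal ?B" using r by (intro ennreal_leI mult_left_mono) auto
    finally show ?thesis .
  qed
  have "l1_norm M (space M) (\<lambda>x. noise \<xi> t x - noise \<xi> s x - exp_kernel \<xi> s * of_real (L t x - L s x))
      = l1_norm M (space M) (\<lambda>x. g * of_real (L t x - L s x) + (LINT r:{s..t}|lborel. f r x))"
  proof (rule l1_norm_cong)
    fix x assume x: "x \<in> space M"
    have "0 \<le> t" using st by simp
    then show "noise \<xi> t x - noise \<xi> s x - exp_kernel \<xi> s * of_real (L t x - L s x)
       = g * of_real (L t x - L s x) + (LINT r:{s..t}|lborel. f r x)"
      unfolding noise_transform_increment[OF st set_integrable_L[OF x \<open>0 \<le> t\<close>]] g_def f_def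
      by (simp add: left_diff_distrib)
  qed
  also have "\<dots> \<le> ennreal (\<bar>w\<bar> * (t - s) * (\<bar>\<sigma>\<bar> * sqrt (t - s)) + ?B * (t - s))"
  proof (rule l1_norm_add_le)
    show "l1_norm M (space M) (\<lambda>x. g * of_real (L t x - L s x)) \<le> ennreal (\<bar>w\<bar> * (t - s) * (\<bar>\<sigma>\<bar> * sqrt (t - s)))"
      using st by (intro l1_norm_cmult_le L_increment g) auto
    have "l1_norm M (space M) (\<lambda>x. LINT r:{s..t}|lborel. f r x) \<le> (\<integral>\<^sup>+r\<in>{s..t}. ennreal ?B \<partial>lborel)"
      by (rule l1_norm_LINT[OF f_meas sets.top fb])
    then show "l1_norm M (space M) (\<lambda>x. LINT r:{s..t}|lborel. f r x) \<le> ennreal (?B * (t - s))"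
      using st by (simp add: nn_integral_cmult_indicator ennreal_mult)
    show "(\<lambda>x. LINT r:{s..t}|lborel. f r x) \<in> borel_measurable M"
      unfolding f_def set_lebesgue_integral_def by measurable
  qed (use st in auto)
  also have "\<dots> = ennreal (2 * \<bar>w\<bar> * \<bar>\<sigma>\<bar> * (t - s) * sqrt (t - s))"
    by (simp add: algebra_simps)
  finally show ?thesis unfolding \<xi>_def .
qed

definition noise_sum :: "real \<Rightarrow> real \<Rightarrow> 'a \<Rightarrow> complex" where
  "noise_sum w T x = (\<Sum>k<cells T. exp_kernel (\<i> * of_real w) (real k / mesh T) *
      of_real (L (real (Suc k) / mesh T) x - L (real k / mesh T) x))"

lemma measurable_noise_sum[measurable]: "noise_sum w T \<in> borel_measurable M"
  unfolding noise_sum_def by measurable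

lemma noise_0:
  assumes "x \<in> space M" shows "noise \<xi> 0 x = 0"
proof -
  have "(LINT t:{0..0}|lborel. \<xi> * exp_kernel \<xi> t * complex_of_real (L t x))
      = integral {0..0} (\<lambda>t. \<xi> * exp_kernel \<xi> t * complex_of_real (L t x))"
    by (intro set_borel_integral_eq_integral set_integrable_exp_of_real set_integrable_L assms) simp
  then show ?thesis using L_0[OF assms] by (simp add: noise_transform_def)
qed

text \<open>There are \<open>n * m\<close> cells with an error of order \<open>m\<close> to the power \<open>- 3/2\<close> each. For
  \<open>m = n\<^sup>2\<close> the total is of order \<open>1\<close>, and so is the contribution of the incomplete last unit
  interval.\<close>

lemma noise_near_noise_sum:
  assumes T: "1 \<le> T"
  shows "l1_norm M (space M) (\<lambda>x. noise (\<i> * of_real w) T x - noise_sum w T x) \<le> ennreal (4 * \<bar>w\<bar> * \<bar>\<sigma>\<bar> + \<bar>\<sigma>\<bar>)"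
proof -
  define \<xi> where "\<xi> = \<i> * complex_of_real w"
  define n where "n = nat \<lfloor>T\<rfloor>"
  have n: "1 \<le> n" "real n \<le> T" "T - real n \<le> 1" using T unfolding n_def by linarith+
  define m where "m = mesh T"
  have m: "m = n\<^sup>2" "cells T = n * m" by (simp_all add: m_def n_def mesh_def cells_def)
  have m1: "1 \<le> m" using n by (simp add: m)
  define t where "t k = real k / real m" for k
  have t: "0 \<le> t k" "t k \<le> t (Suc k)" "t (Suc k) - t k = 1 / real m" for k
    using m1 by (simp_all add: t_def field_simps)
  have tn: "t (cells T) = real n" using m1 by (simp add: t_def m)
  define cell where "cell k x = noise \<xi> (t (Suc k)) x - noise \<xi> (t k) x
      - exp_kernel \<xi> (t k) * of_real (L (t (Suc k)) x - L (t k) x)" for k x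
  define rest where "rest x = noise \<xi> T x - noise \<xi> (real n) x - exp_kernel \<xi> (real n) * of_real (L T x - L (real n) x)" for x
  define last where "last x = exp_kernel \<xi> (real n) * complex_of_real (L T x - L (real n) x)" for x
  have [measurable]: "cell k \<in> borel_measurable M" "rest \<in> borel_measurable M" "last \<in> borel_measurable M" for k
    unfolding cell_def rest_def last_def by measurable
  have "l1_norm M (space M) (\<lambda>x. noise \<xi> T x - noise_sum w T x)
      = l1_norm M (space M) (\<lambda>x. (\<Sum>k<cells T. cell k x) + (rest x + last x))"
  proof (rule l1_norm_cong)
    fix x assume x: "x \<in> space M"
    have "(\<Sum>k<cells T. noise \<xi> (t (Suc k)) x - noise \<xi> (t k) x) = noise \<xi> (t (cells T)) x - noise \<xi> (t 0) x"
      by (rule sum_lessThan_telescope)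
    also have "\<dots> = noise \<xi> (real n) x" using noise_0[OF x] unfolding tn by (simp add: t_def)
    finally show "noise \<xi> T x - noise_sum w T x = (\<Sum>k<cells T. cell k x) + (rest x + last x)"
      unfolding cell_def rest_def last_def noise_sum_def m_def[symmetric] t_def[symmetric] \<xi>_def[symmetric]
      by (simp add: sum_subtractf)
  qed
  also have "\<dots> \<le> ennreal (2 * \<bar>w\<bar> * \<bar>\<sigma>\<bar> + (2 * \<bar>w\<bar> * \<bar>\<sigma>\<bar> + \<bar>\<sigma>\<bar>))"
  proof (intro l1_norm_add_le)
    have "l1_norm M (space M) (cell k) \<le> ennreal (2 * \<bar>w\<bar> * \<bar>\<sigma>\<bar> * (1 / real m) * sqrt (1 / real m))" for k
      using noise_increment_approx[OF t(1,2)[of k], of w] unfolding cell_def \<xi>_def t(3) .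
    then have "l1_norm M (space M) (\<lambda>x. \<Sum>k<cells T. cell k x) \<le> (\<Sum>k<cells T. ennreal (2 * \<bar>w\<bar> * \<bar>\<sigma>\<bar> * (1 / real m) * sqrt (1 / real m)))"
      by (intro order_trans[OF l1_norm_sum sum_mono]) auto
    also have "\<dots> = ennreal (real (cells T) * (2 * \<bar>w\<bar> * \<bar>\<sigma>\<bar> * (1 / real m) * sqrt (1 / real m)))"
      by (subst ennreal_mult) (simp_all add: ennreal_of_nat_eq_real_of_nat)
    also have "real (cells T) * (2 * \<bar>w\<bar> * \<bar>\<sigma>\<bar> * (1 / real m) * sqrt (1 / real m)) = 2 * \<bar>w\<bar> * \<bar>\<sigma>\<bar>"
      using n by (simp add: m real_sqrt_divide field_simps)
    finally show "l1_norm M (space M) (\<lambda>x. \<Sum>k<cells T. cell k x) \<le> ennreal (2 * \<bar>w\<bar> * \<bar>\<sigma>\<bar>)" .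
    have "l1_norm M (space M) rest \<le> ennreal (2 * \<bar>w\<bar> * \<bar>\<sigma>\<bar> * (T - real n) * sqrt (T - real n))"
      unfolding rest_def \<xi>_def using n by (intro noise_increment_approx) auto
    also have "\<dots> \<le> ennreal (2 * \<bar>w\<bar> * \<bar>\<sigma>\<bar> * 1 * 1)"
      using n by (intro ennreal_leI mult_mono) auto
    finally show "l1_norm M (space M) rest \<le> ennreal (2 * \<bar>w\<bar> * \<bar>\<sigma>\<bar>)" by simp
    have "l1_norm M (space M) last \<le> ennreal (1 * (\<bar>\<sigma>\<bar> * sqrt (T - real n)))"
      unfolding last_def using n by (intro l1_norm_cmult_le L_increment) (auto simp: \<xi>_def)
    also have "\<dots> \<le> ennreal \<bar>\<sigma>\<bar>" using n by (intro ennreal_leI) (simp add: mult_left_le)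
    finally show "l1_norm M (space M) last \<le> ennreal \<bar>\<sigma>\<bar>" .
  qed auto
  also have "\<dots> = ennreal (4 * \<bar>w\<bar> * \<bar>\<sigma>\<bar> + \<bar>\<sigma>\<bar>)" by (simp add: algebra_simps)
  finally show ?thesis unfolding \<xi>_def .
qed

lemma fourier_near_noise_sum:
  assumes b: "degree b < p"
  shows "\<exists>C\<ge>0. \<forall>T\<ge>1. l1_norm M (initial_bounded K) (\<lambda>x.
      poly (map_poly of_real a) (\<i> * of_real w) * (LINT t:{0..T}|lborel. exp_kernel (\<i> * of_real w) t * S b t x)
      - poly b (\<i> * of_real w) * noise_sum w T x) \<le> ennreal C"
proof -
  let ?E = "initial_bounded K"
  define \<xi> where "\<xi> = \<i> * complex_of_real w"
  obtain c where c: "mult_mod p a \<xi> c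
        = Polynomial.smult (poly (map_poly of_real a) \<xi>) b"
    and cp: "coeff c (p - 1) = - poly b \<xi>"
    using fourier_divisor[OF p degree_a monic_a b] by blast
  obtain C where C: "C \<ge> 0" "\<And>T. 0 \<le> T \<Longrightarrow> l1_norm M ?E (S c T) \<le> ennreal C"
    using state_bounded by blast
  define N where "N = 4 * \<bar>w\<bar> * \<bar>\<sigma>\<bar> + \<bar>\<sigma>\<bar>"
  have N: "0 \<le> N" by (simp add: N_def)
  show ?thesis
  proof (intro exI[of _ "C + C + norm (poly b \<xi>) * N"] conjI allI impI)
    show "0 \<le> C + C + norm (poly b \<xi>) * N" using C N by simp
    fix T :: real assume T: "1 \<le> T"
    have T0: "0 \<le> T" using T by simp
    have "l1_norm M ?E (\<lambda>x. poly (map_poly of_real a) \<xi> * (LINT t:{0..T}|lborel. exp_kernel \<xi> t * S b t x)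
        - poly b \<xi> * noise_sum w T x)
      = l1_norm M ?E (\<lambda>x. (exp_kernel \<xi> T * S c T x + (- 1) * S c 0 x) + poly b \<xi> * (noise \<xi> T x - noise_sum w T x))"
    proof (rule l1_norm_cong)
      fix x assume x: "x \<in> space M"
      show "poly (map_poly of_real a) \<xi> * (LINT t:{0..T}|lborel. exp_kernel \<xi> t * S b t x)
        - poly b \<xi> * noise_sum w T x
        = (exp_kernel \<xi> T * S c T x + (- 1) * S c 0 x) + poly b \<xi> * (noise \<xi> T x - noise_sum w T x)"
        unfolding fourier_state_poly[OF p path[OF x] c T0] cp by (simp add: algebra_simps)
    qed
    also have "\<dots> \<le> ennreal (1 * C + 1 * C + norm (poly b \<xi>) * N)"
    proof (intro l1_norm_add_le l1_norm_cmult_le)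
      have "l1_norm M ?E (\<lambda>x. noise \<xi> T x - noise_sum w T x) \<le> l1_norm M (space M) (\<lambda>x. noise \<xi> T x - noise_sum w T x)"
        by (intro l1_norm_mono_set sets.sets_into_space sets_initial_bounded)
      also have "\<dots> \<le> ennreal N" unfolding N_def \<xi>_def by (rule noise_near_noise_sum[OF T])
      finally show "l1_norm M ?E (\<lambda>x. noise \<xi> T x - noise_sum w T x) \<le> ennreal N" .
    qed (use C N T0 in \<open>auto simp: \<xi>_def\<close>)
    also have "\<dots> = ennreal (C + C + norm (poly b \<xi>) * N)" by simp
    finally show "l1_norm M ?E (\<lambda>x. poly (map_poly of_real a) (\<i> * of_real w) * (LINT t:{0..T}|lborel. exp_kernel (\<i> * of_real w) t * S b t x)
      - poly b (\<i> * of_real w) * noise_sum w T x) \<le> ennreal (C + C + norm (poly b \<xi>) * N)" unfolding \<xi>_def .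
  qed
qed

end

section \<open>Regular versions of the noise and of the state\<close>

text \<open>A process with right-continuous paths is the limit of its values at the next point of a
  grid strictly to the right.\<close>

lemma borel_measurable_pair_right_continuous:
  fixes f :: "real \<Rightarrow> 'a \<Rightarrow> real"
  assumes meas: "\<And>t. f t \<in> borel_measurable M"
    and right: "\<And>t x. x \<in> space M \<Longrightarrow> continuous (at_right t) (\<lambda>s. f s x)"
  shows "(\<lambda>(t, x). f t x) \<in> borel_measurable (borel \<Otimes>\<^sub>M M)"
proof -
  define r where "r n t = (real_of_int \<lfloor>t * real (Suc n)\<rfloor> + 1) / real (Suc n)" for n and t :: real
  have r_gt: "t < r n t" and r_le: "r n t \<le> t + 1 / real (Suc n)" for n t
  proof -
    have "t * real (Suc n) < real_of_int \<lfloor>t * real (Suc n)\<rfloor> + 1" by linarith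
    then show "t < r n t" unfolding r_def by (simp add: pos_less_divide_eq del: of_nat_Suc)
    have "real_of_int \<lfloor>t * real (Suc n)\<rfloor> + 1 \<le> (t + 1 / real (Suc n)) * real (Suc n)"
      by (simp add: distrib_right del: of_nat_Suc)
    then show "r n t \<le> t + 1 / real (Suc n)" unfolding r_def by (simp add: pos_divide_le_eq del: of_nat_Suc)
  qed
  show ?thesis
  proof (rule borel_measurable_LIMSEQ_real)
    fix n
    define g where "g = (\<lambda>i::int. f ((real_of_int i + 1) / real (Suc n)))"
    have "(\<lambda>p. g \<lfloor>fst p * real (Suc n)\<rfloor> (snd p)) \<in> borel_measurable (borel \<Otimes>\<^sub>M M)"
    proof (rule measurable_compose_countable[where f="\<lambda>i p. g i (snd p)"])
      show "(\<lambda>p. g i (snd p)) \<in> borel_measurable (borel \<Otimes>\<^sub>M M)" for i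
        unfolding g_def by (rule measurable_compose[OF measurable_snd meas])
      show "(\<lambda>p. \<lfloor>fst p * real (Suc n)\<rfloor>) \<in> borel \<Otimes>\<^sub>M M \<rightarrow>\<^sub>M count_space UNIV"
        by measurable
    qed
    then show "(\<lambda>(t, x). f (r n t) x) \<in> borel_measurable (borel \<Otimes>\<^sub>M M)"
      by (simp add: g_def r_def case_prod_beta)
  next
    fix p :: "real \<times> 'a" assume "p \<in> space (borel \<Otimes>\<^sub>M M)"
    then obtain t x where p: "p = (t, x)" "x \<in> space M" by (auto simp: space_pair_measure)
    have r_neq: "r n t \<noteq> t" for n using r_gt[of t n] by simp
    have "(\<lambda>n. r n t) \<longlonglongrightarrow> t"
    proof (rule tendsto_sandwich[OF _ _ tendsto_const])
      show "\<forall>\<^sub>F n in sequentially. t \<le> r n t" by (intro always_eventually allI less_imp_le r_gt)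
      show "\<forall>\<^sub>F n in sequentially. r n t \<le> t + 1 / real (Suc n)" by (intro always_eventually allI r_le)
      show "(\<lambda>n. t + 1 / real (Suc n)) \<longlonglongrightarrow> t" by real_asymp
    qed
    then have "filterlim (\<lambda>n. r n t) (at_right t) sequentially"
      unfolding filterlim_at by (simp add: r_gt r_neq)
    moreover have "((\<lambda>s. f s x) \<longlongrightarrow> f t x) (at_right t)"
      using right[OF p(2), of t] by (simp add: continuous_within)
    ultimately show "(\<lambda>n. (case p of (t, x) \<Rightarrow> f (r n t) x)) \<longlonglongrightarrow> (case p of (t, x) \<Rightarrow> f t x)"
      unfolding p(1) prod.case by (rule filterlim_compose[rotated])
  qed
qed

lemma continuous_at_right_max_0:
  fixes h :: "real \<Rightarrow> real"
  assumes "\<And>t. 0 \<le> t \<Longrightarrow> continuous (at_right t) h"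
  shows "continuous (at_right t) (\<lambda>s. h (max 0 s))"
proof (cases "0 \<le> t")
  case True
  have "(h \<longlongrightarrow> h t) (at_right t)" using assms[OF True] by (simp add: continuous_within)
  moreover have "\<forall>\<^sub>F s in at_right t. h s = h (max 0 s)"
    using eventually_at_right_less[of t] by eventually_elim (use True in simp)
  ultimately have "((\<lambda>s. h (max 0 s)) \<longlongrightarrow> h t) (at_right t)" by (rule Lim_transform_eventually)
  then show ?thesis using True by (simp add: continuous_within)
next
  case False
  then have "\<forall>\<^sub>F s in at_right t. h 0 = h (max 0 s)"
    using eventually_at_right_real[of t 0] by (auto elim!: eventually_mono)
  then have "((\<lambda>s. h (max 0 s)) \<longlongrightarrow> h 0) (at_right t)" by (rule Lim_transform_eventually[OF tendsto_const])
  then show ?thesis using False by (simp add: continuous_within)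
qed

lemma companion_path_right_continuous:
  assumes p: "0 < p" and path: "companion_path p a X l" and l: "\<And>t. 0 \<le> t \<Longrightarrow> continuous (at_right t) l"
    and "0 \<le> t" "k < p"
  shows "continuous (at_right t) (X k)"
proof -
  let ?r = "\<lambda>s. if k + 1 < p then X (k + 1) s else - (\<Sum>j<p. coeff a j * X j s)"
  have r: "set_integrable lborel {0..t + 1} ?r"
    using set_integrable_row[OF p path] assms by simp
  have X: "X k s = X k 0 + integral {0..s} ?r + (if k + 1 = p then l s else 0)" if "s \<in> {0..t + 1}" for s
  proof -
    have "(LINT u:{0..s}|lborel. ?r u) = integral {0..s} ?r"
      using that by (intro set_borel_integral_eq_integral set_integrable_subset[OF r]) auto
    then show ?thesis using path[unfolded companion_path_def, rule_format, of s k] that \<open>k < p\<close> by simp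
  qed
  have "continuous_on {0..t + 1} (\<lambda>s. integral {0..s} ?r)"
    by (intro indefinite_integral_continuous_1 set_borel_integral_eq_integral r)
  then have "((\<lambda>s. integral {0..s} ?r) \<longlongrightarrow> integral {0..t} ?r) (at t within {0..t + 1})"
    using \<open>0 \<le> t\<close> by (simp add: continuous_on_def)
  then have int: "((\<lambda>s. integral {0..s} ?r) \<longlongrightarrow> integral {0..t} ?r) (at t within {t..t + 1})"
    by (rule tendsto_within_subset) (use \<open>0 \<le> t\<close> in auto)
  have at: "at t within {t..t + 1} = at_right t" by (rule at_within_Icc_at_right) simp
  have "(l \<longlongrightarrow> l t) (at_right t)" using l[OF \<open>0 \<le> t\<close>] by (simp add: continuous_within)
  then have "((\<lambda>s. X k 0 + integral {0..s} ?r + (if k + 1 = p then l s else 0))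
      \<longlongrightarrow> X k 0 + integral {0..t} ?r + (if k + 1 = p then l t else 0)) (at_right t)"
    using int unfolding at by (intro tendsto_intros) auto
  moreover have "\<forall>\<^sub>F s in at_right t. X k 0 + integral {0..s} ?r + (if k + 1 = p then l s else 0) = X k s"
    using eventually_at_right_real[of t "t + 1"]
  proof (rule eventually_mono)
    show "X k 0 + integral {0..s} ?r + (if k + 1 = p then l s else 0) = X k s" if "s \<in> {t<..<t + 1}" for s
      by (rule X[symmetric]) (use that \<open>0 \<le> t\<close> in auto)
  qed simp
  ultimately have "(X k \<longlongrightarrow> X k 0 + integral {0..t} ?r + (if k + 1 = p then l t else 0)) (at_right t)"
    by (rule Lim_transform_eventually)
  also have "X k 0 + integral {0..t} ?r + (if k + 1 = p then l t else 0) = X k t"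
    by (rule X[symmetric]) (use \<open>0 \<le> t\<close> in auto)
  finally show ?thesis by (simp add: continuous_within)
qed

lemma companion_path_cong:
  assumes "companion_path p a X l" "\<And>k t. 0 \<le> t \<Longrightarrow> X' k t = X k t" "\<And>t. 0 \<le> t \<Longrightarrow> l' t = l t"
  shows "companion_path p a X' l'"
  unfolding companion_path_def
proof (intro allI impI conjI)
  fix t :: real and i assume ti: "0 \<le> t" "i < p"
  have "set_integrable lborel {0..t} (X i)" using assms(1) ti by (auto simp: companion_path_def)
  then show "set_integrable lborel {0..t} (X' i)"
    using assms(2) by (subst set_integrable_cong[OF refl refl, of _ _ "X i"]) auto
  have "(LINT s:{0..t}|lborel. if i + 1 < p then X' (i + 1) s else - (\<Sum>j<p. coeff a j * X' j s))
      = (LINT s:{0..t}|lborel. if i + 1 < p then X (i + 1) s else - (\<Sum>j<p. coeff a j * X j s))"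
    using assms(2) by (intro set_lebesgue_integral_cong) auto
  then show "X' i t = X' i 0 + (LINT s:{0..t}|lborel. if i + 1 < p then X' (i + 1) s else - (\<Sum>j<p. coeff a j * X' j s))
      + (if i + 1 = p then l' t else 0)"
    using assms(1)[unfolded companion_path_def, rule_format, OF ti] assms(2,3) ti(1) by simp
qed

lemma companion_path_0: "companion_path p a (\<lambda>k t. 0) (\<lambda>t. 0)"
  by (auto simp: companion_path_def set_integrable_def)

lemma index_companion_mult:
  assumes "x \<in> carrier_vec p" "i < p"
  shows "vec_index (companion_matrix p a *\<^sub>v x) i
     = (if i + 1 < p then vec_index x (i + 1) else - (\<Sum>j<p. coeff a j * vec_index x j))"
proof -
  have "vec_index (companion_matrix p a *\<^sub>v x) i
      = (\<Sum>j<p. (if i + 1 < p then (if j = i + 1 then 1 else 0) else - coeff a j) * vec_index x j)"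
    using assms by (simp add: companion_matrix_def scalar_prod_def lessThan_atLeast0)
  then show ?thesis
    by (auto simp: sum_negf if_distrib[where f="\<lambda>y. y * c" for c] cong: if_cong)
qed

lemma companion_path_of_sde:
  assumes X: "\<And>t. 0 \<le> t \<Longrightarrow> X t \<in> carrier_vec p"
    and sde: "\<forall>t\<ge>0. \<forall>i<p. set_integrable lborel {0..t} (\<lambda>s. vec_index (X s) i) \<and>
       vec_index (X t) i = vec_index (X 0) i
         + (LINT s:{0..t}|lborel. vec_index (companion_matrix p a *\<^sub>v X s) i)
         + vec_index (noise_vector p) i * (l t - l 0)"
    and l0: "l 0 = 0"
  shows "companion_path p a (\<lambda>k t. vec_index (X t) k) l"
  unfolding companion_path_def
proof (intro allI impI conjI)
  fix t :: real and i assume ti: "0 \<le> t" "i < p"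
  then show "set_integrable lborel {0..t} (\<lambda>t. vec_index (X t) i)" using sde by blast
  have "(LINT s:{0..t}|lborel. vec_index (companion_matrix p a *\<^sub>v X s) i)
      = (LINT s:{0..t}|lborel. if i + 1 < p then vec_index (X s) (i + 1) else - (\<Sum>j<p. coeff a j * vec_index (X s) j))"
    using X ti by (intro set_lebesgue_integral_cong) (auto simp: index_companion_mult)
  moreover have "vec_index (noise_vector p) i = (if i + 1 = p then 1 else 0)"
    using ti by (auto simp: noise_vector_def unit_vec_def)
  ultimately show "vec_index (X t) i = vec_index (X 0) i
      + (LINT s:{0..t}|lborel. if i + 1 < p then vec_index (X s) (i + 1) else - (\<Sum>j<p. coeff a j * vec_index (X s) j))
      + (if i + 1 = p then l t else 0)"
    using sde[rule_format, OF ti] l0 by simp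
qed

text \<open>The vector of powers \<open>(1, z, \<dots>, z\<^sup>p\<^sup>-\<^sup>1)\<close> is an eigenvector of the companion matrix for
  each root \<open>z\<close> of \<open>a\<close>.\<close>

lemma eigenvalue_companion:
  assumes p: "0 < p" and a: "degree a = p" "lead_coeff a = 1" and z: "poly (map_poly of_real a) z = 0"
  shows "eigenvalue (map_mat complex_of_real (companion_matrix p a)) z"
proof -
  define v where "v = Matrix.vec p (\<lambda>i. z ^ i)"
  let ?A = "map_mat complex_of_real (companion_matrix p a)"
  have dim: "dim_row ?A = p" "?A \<in> carrier_mat p p" by (simp_all add: companion_matrix_def)
  have "(\<Sum>j\<le>p. of_real (coeff a j) * z ^ j) = 0"
    using z a(1) by (simp add: poly_altdef degree_map_poly coeff_map_poly)
  then have "(\<Sum>j<p. of_real (coeff a j) * z ^ j) + z ^ p = 0"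
    using a by (simp add: lessThan_Suc_atMost[symmetric])
  then have zp: "z ^ p = - (\<Sum>j<p. of_real (coeff a j) * z ^ j)"
    by (simp add: eq_neg_iff_add_eq_0 add.commute)
  have "eigenvector ?A v z"
    unfolding eigenvector_def dim(1)
  proof (intro conjI)
    show "v \<in> carrier_vec p" by (simp add: v_def)
    show "v \<noteq> 0\<^sub>v p"
    proof
      assume "v = 0\<^sub>v p"
      then have "vec_index v 0 = vec_index (0\<^sub>v p) 0" by simp
      then show False using p by (simp add: v_def)
    qed
    show "?A *\<^sub>v v = z \<cdot>\<^sub>v v"
    proof (rule eq_vecI)
      fix i assume "i < dim_vec (z \<cdot>\<^sub>v v)"
      then have i: "i < p" by (simp add: v_def)
      have "vec_index (?A *\<^sub>v v) i
          = (\<Sum>j<p. of_real (if i + 1 < p then (if j = i + 1 then 1 else 0) else - coeff a j) * z ^ j)"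
        using i by (simp add: companion_matrix_def scalar_prod_def lessThan_atLeast0 v_def)
      also have "\<dots> = z * z ^ i"
      proof (cases "i + 1 < p")
        case True
        then show ?thesis by (simp add: if_distrib[where f=complex_of_real] if_distrib[where f="\<lambda>y. y * c" for c] cong: if_cong)
      next
        case False
        then have "Suc i = p" using i by simp
        then have "z * z ^ i = z ^ p" by (metis power_Suc)
        then show ?thesis using False zp by (simp add: sum_negf)
      qed
      finally show "vec_index (?A *\<^sub>v v) i = vec_index (z \<cdot>\<^sub>v v) i" using i by (simp add: v_def)
    qed (simp add: v_def companion_matrix_def)
  qed
  then show ?thesis unfolding eigenvalue_def by blast
qed

text \<open>The paths are set to \<open>0\<close> off an event of probability one on which all pathwise
  requirements hold; the zero path solves the equation, too. Negative times are mapped to \<open>0\<close>,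
  so that right-continuity holds on the whole line. Joint measurability follows since the
  noise is right-continuous and the state inherits this from its equation.\<close>

lemma (in centered_levy_process) regular_version:
  fixes X :: "real \<Rightarrow> 'a \<Rightarrow> real Matrix.vec"
  assumes p: "0 < p" and a: "degree a = p" "lead_coeff a = 1"
    and sde: "solves_linear_sde M p (companion_matrix p a) (noise_vector p) L X"
    and stable: "\<And>z. eigenvalue (map_mat complex_of_real (companion_matrix p a)) z \<Longrightarrow> Re z < 0"
  obtains L' X' where "carma_paths M L' \<sigma> p a X'"
    and "AE x in M. \<forall>t\<ge>0. L' t x = L t x \<and> (\<forall>k<p. X' k t x = vec_index (X t x) k)"
proof -
  define good where "good x \<longleftrightarrow> L 0 x = 0 \<and> cadlag (\<lambda>t. L t x) \<and> (\<forall>t\<ge>0. \<forall>i<p.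
       set_integrable lborel {0..t} (\<lambda>s. vec_index (X s x) i) \<and>
       vec_index (X t x) i = vec_index (X 0 x) i
         + (LINT s:{0..t}|lborel. vec_index (companion_matrix p a *\<^sub>v X s x) i)
         + vec_index (noise_vector p) i * (L t x - L 0 x))" for x
  have X_dim: "\<And>t x. 0 \<le> t \<Longrightarrow> x \<in> space M \<Longrightarrow> X t x \<in> carrier_vec p"
    and X_meas: "\<And>t i. 0 \<le> t \<Longrightarrow> i < p \<Longrightarrow> (\<lambda>x. vec_index (X t x) i) \<in> borel_measurable M"
    using sde unfolding solves_linear_sde_def by blast+
  have sde_AE: "AE x in M. \<forall>t\<ge>0. \<forall>i<p.
       set_integrable lborel {0..t} (\<lambda>s. vec_index (X s x) i) \<and>
       vec_index (X t x) i = vec_index (X 0 x) i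
         + (LINT s:{0..t}|lborel. vec_index (companion_matrix p a *\<^sub>v X s x) i)
         + vec_index (noise_vector p) i * (L t x - L 0 x)"
    using sde unfolding solves_linear_sde_def by (elim conjE)
  have AE_good: "AE x in M. good x"
    using starts_at_zero cadlag_paths sde_AE by eventually_elim (unfold good_def, intro conjI)
  obtain N where N: "\<And>x. x \<in> space M - N \<Longrightarrow> good x" "N \<in> null_sets M"
    using AE_E3[OF AE_good] by metis
  define G where "G = space M - N"
  have G_sets[measurable]: "G \<in> sets M" using N(2) by (auto simp: G_def)
  have G: "x \<in> space M" "good x" if "x \<in> G" for x
    using that N(1)[of x] by (simp_all add: G_def)
  have AE_G: "AE x in M. x \<in> G" using AE_not_in[OF N(2)] AE_space by eventually_elim (simp add: G_def)
  define L' where "L' t x = (if x \<in> G then L (max 0 t) x else 0)" for t x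
  define X' where "X' k t x = (if x \<in> G then vec_index (X (max 0 t) x) k else 0)" for k t x
  have path_G: "companion_path p a (\<lambda>k t. vec_index (X t x) k) (\<lambda>t. L t x)" if "x \<in> G" for x
  proof (rule companion_path_of_sde)
    show "\<And>t. 0 \<le> t \<Longrightarrow> X t x \<in> carrier_vec p" by (rule X_dim[OF _ G(1)[OF that]])
  qed (use G(2)[OF that] in \<open>unfold good_def, blast\<close>)+
  have L_right: "continuous (at_right t) (\<lambda>t. L t x)" if "x \<in> G" "0 \<le> t" for x t
    using G(2)[OF that(1)] that(2) unfolding good_def cadlag_def by blast
  have X_right: "continuous (at_right t) (\<lambda>t. vec_index (X t x) k)" if "x \<in> G" "0 \<le> t" "k < p" for x t k
    using companion_path_right_continuous[OF p path_G[OF that(1)] L_right[OF that(1)] that(2,3)] .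
  have version: "AE x in M. \<forall>t\<ge>0. L' t x = L t x \<and> (\<forall>k<p. X' k t x = vec_index (X t x) k)"
    using AE_G by eventually_elim (simp add: L'_def X'_def max_absorb2)
  have "carma_paths M L' \<sigma> p a X'"
  proof unfold_locales
    show "(\<lambda>(t, x). L' t x) \<in> borel_measurable (borel \<Otimes>\<^sub>M M)"
    proof (rule borel_measurable_pair_right_continuous)
      show "L' t \<in> borel_measurable M" for t
        unfolding L'_def using measurable_L[of "max 0 t"] by (intro measurable_If_set) (auto simp: G_sets)
      show "continuous (at_right t) (\<lambda>s. L' s x)" if "x \<in> space M" for t x
        using continuous_at_right_max_0[OF L_right] by (cases "x \<in> G") (simp_all add: L'_def)
    qed
    show "(\<lambda>(t, x). X' k t x) \<in> borel_measurable (borel \<Otimes>\<^sub>M M)" if "k < p" for k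
    proof (rule borel_measurable_pair_right_continuous)
      show "X' k t \<in> borel_measurable M" for t
        unfolding X'_def using X_meas[of "max 0 t" k] that by (intro measurable_If_set) (auto simp: G_sets)
      show "continuous (at_right t) (\<lambda>s. X' k s x)" if "x \<in> space M" for t x
        using continuous_at_right_max_0[OF X_right] \<open>k < p\<close> by (cases "x \<in> G") (simp_all add: X'_def)
    qed
    have "L 0 x = 0" if "x \<in> G" for x using G(2)[OF that] unfolding good_def by blast
    then show "L' 0 x = 0" for x by (simp add: L'_def)
    show "l1_norm M (space M) (\<lambda>x. complex_of_real (L' t x - L' s x)) \<le> ennreal (\<bar>\<sigma>\<bar> * sqrt (t - s))"
      if st: "0 \<le> s" "s \<le> t" for s t
    proof -
      have "l1_norm M (space M) (\<lambda>x. complex_of_real (L' t x - L' s x)) = (\<integral>\<^sup>+x. ennreal \<bar>L' t x - L' s x\<bar> \<partial>M)"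
        unfolding l1_norm_def by (intro nn_integral_cong) (simp only: norm_of_real indicator_simps mult_1_right)
      also have "\<dots> = (\<integral>\<^sup>+x. ennreal \<bar>L t x - L s x\<bar> \<partial>M)"
      proof (rule nn_integral_cong_AE)
        have t: "0 \<le> t" using st by simp
        from version show "AE x in M. ennreal \<bar>L' t x - L' s x\<bar> = ennreal \<bar>L t x - L s x\<bar>"
          by eventually_elim (use st t in simp)
      qed
      also have "\<dots> = ennreal (expectation (\<lambda>x. \<bar>L t x - L s x\<bar>))"
        using first_absolute_moment_increment(1)[OF st] by (intro nn_integral_eq_integral) auto
      also have "\<dots> \<le> ennreal (\<bar>\<sigma>\<bar> * sqrt (t - s))"
        by (intro ennreal_leI first_absolute_moment_increment(2) st)
      finally show ?thesis .
    qed
    show "companion_path p a (\<lambda>k t. X' k t x) (\<lambda>t. L' t x)" if "x \<in> space M" for x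
    proof (cases "x \<in> G")
      case True
      show ?thesis by (rule companion_path_cong[OF path_G[OF True]]) (simp_all add: X'_def L'_def True max_absorb2)
    next
      case False
      then show ?thesis by (simp add: X'_def L'_def companion_path_0)
    qed
    show "Re z < 0" if "poly (map_poly of_real a) z = 0" for z
      using eigenvalue_companion[OF p a that] stable by blast
  qed (use p a in auto)
  then show thesis using version that by blast
qed

section \<open>The limit of the truncated Fourier transform\<close>

context carma_paths
begin

definition fourier_integral :: "complex poly \<Rightarrow> real \<Rightarrow> real \<Rightarrow> 'a \<Rightarrow> complex" where
  "fourier_integral b w T x = (LINT t:{0..T}|lborel. exp_kernel (\<i> * of_real w) t * S b t x)"

lemma measurable_fourier_integral[measurable]: "fourier_integral b w T \<in> borel_measurable M"
  unfolding fourier_integral_def set_lebesgue_integral_def by measurable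

lemma initial_bounded_tendsto: "(\<lambda>n. prob (initial_bounded (real n))) \<longlonglongrightarrow> 1"
proof -
  have "(\<lambda>n. prob (initial_bounded (real n))) \<longlonglongrightarrow> prob (\<Union>n. initial_bounded (real n))"
  proof (rule finite_Lim_measure_incseq)
    show "incseq (\<lambda>n. initial_bounded (real n))"
      by (rule incseq_SucI) (auto simp: initial_bounded_def intro: order_trans)
  qed auto
  also have "(\<Union>n. initial_bounded (real n)) = space M"
  proof (intro equalityI subsetI)
    fix x assume x: "x \<in> space M"
    define B where "B = (\<Sum>k<p. \<bar>X k 0 x\<bar>)"
    obtain n where n: "B \<le> real n" using real_arch_simple by blast
    have "\<bar>X k 0 x\<bar> \<le> real n" if "k < p" for k
    proof -
      have "\<bar>X k 0 x\<bar> \<le> B" unfolding B_def using that by (intro member_le_sum) auto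
      then show ?thesis using n by simp
    qed
    then show "x \<in> (\<Union>n. initial_bounded (real n))" using x by (auto simp: initial_bounded_def)
  qed (auto simp: initial_bounded_def)
  finally show ?thesis by (simp add: prob_space)
qed

text \<open>The difference of two unimodular numbers is at most \<open>2\<close> off the event and at most the
  difference of the exponents on it.\<close>

lemma norm_iexp_diff_le:
  fixes U W :: "'a \<Rightarrow> real"
  assumes [measurable]: "U \<in> borel_measurable M" "W \<in> borel_measurable M"
    and "0 \<le> C" and C: "l1_norm M (initial_bounded K) (\<lambda>x. of_real (U x - W x)) \<le> ennreal C"
  shows "norm ((LINT x|M. iexp (U x)) - (LINT x|M. iexp (W x))) \<le> 2 * (1 - prob (initial_bounded K)) + C"
proof -
  let ?E = "initial_bounded K"
  have "norm ((LINT x|M. iexp (U x)) - (LINT x|M. iexp (W x))) = norm (LINT x|M. iexp (U x) - iexp (W x))"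
    by (simp add: integrable_iexp)
  then have "ennreal (norm ((LINT x|M. iexp (U x)) - (LINT x|M. iexp (W x)))) \<le> (\<integral>\<^sup>+x. ennreal (norm (iexp (U x) - iexp (W x))) \<partial>M)"
    using norm_LINT_le_nn_integral[of M "\<lambda>x. iexp (U x) - iexp (W x)"] by simp
  also have "\<dots> \<le> (\<integral>\<^sup>+x. 2 * indicator (space M - ?E) x + ennreal (norm (complex_of_real (U x - W x))) * indicator ?E x \<partial>M)"
  proof (rule nn_integral_mono)
    fix x assume x: "x \<in> space M"
    have "norm (iexp (U x) - iexp (W x)) \<le> 2"
      using norm_triangle_ineq4[of "iexp (U x)" "iexp (W x)"] by simp
    then have "ennreal (norm (iexp (U x) - iexp (W x))) \<le> ennreal 2" by (rule ennreal_leI)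
    moreover have "norm (iexp (U x) - iexp (W x)) \<le> \<bar>U x - W x\<bar>"
    proof -
      have "iexp (U x) - iexp (W x) = iexp (W x) * (iexp (U x - W x) - 1)"
        by (simp add: right_diff_distrib exp_add[symmetric])
      then show ?thesis using iexp_approx1[of "U x - W x" 0] by (simp add: norm_mult)
    qed
    then have "ennreal (norm (iexp (U x) - iexp (W x))) \<le> ennreal (norm (complex_of_real (U x - W x)))"
      unfolding norm_of_real by (rule ennreal_leI)
    ultimately show "ennreal (norm (iexp (U x) - iexp (W x)))
        \<le> 2 * indicator (space M - ?E) x + ennreal (norm (complex_of_real (U x - W x))) * indicator ?E x"
      using x by (cases "x \<in> ?E") (simp_all del: of_real_diff)
  qed
  also have "\<dots> = 2 * emeasure M (space M - ?E) + l1_norm M ?E (\<lambda>x. of_real (U x - W x))"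
    unfolding l1_norm_def by (subst nn_integral_add) (simp_all add: nn_integral_cmult_indicator)
  also have "\<dots> \<le> 2 * ennreal (1 - prob ?E) + ennreal C"
    using C by (intro add_mono mult_left_mono) (simp_all add: emeasure_eq_measure prob_compl)
  also have "\<dots> = ennreal (2 * (1 - prob ?E) + C)"
    using ennreal_plus[of "2 * (1 - prob ?E)" C] ennreal_mult[of 2 "1 - prob ?E"] \<open>0 \<le> C\<close> prob_le_1[of ?E] by simp
  finally show ?thesis
    using \<open>0 \<le> C\<close> by (subst (asm) ennreal_le_iff) (auto intro!: add_nonneg_nonneg)
qed

text \<open>A form of Slutsky's theorem for errors that are \<open>O(1 / sqrt T)\<close> in \<open>L\<^sup>1\<close> on events of
  probability arbitrarily close to \<open>1\<close>.\<close>

lemma iexp_diff_tendsto_0: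
  fixes U W :: "real \<Rightarrow> 'a \<Rightarrow> real"
  assumes meas: "\<And>T. U T \<in> borel_measurable M" "\<And>T. W T \<in> borel_measurable M"
    and C: "\<And>K. \<exists>C\<ge>0. \<forall>T\<ge>1. l1_norm M (initial_bounded K) (\<lambda>x. of_real (U T x - W T x)) \<le> ennreal (C / sqrt T)"
  shows "((\<lambda>T. (LINT x|M. iexp (U T x)) - (LINT x|M. iexp (W T x))) \<longlongrightarrow> 0) at_top"
proof (rule tendstoI)
  fix e :: real assume e: "0 < e"
  have "\<forall>\<^sub>F n in sequentially. 1 - e / 4 < prob (initial_bounded (real n))"
    using initial_bounded_tendsto e by (intro order_tendstoD) auto
  then obtain n where n: "1 - e / 4 < prob (initial_bounded (real n))" by (auto simp: eventually_sequentially)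
  obtain C where C0: "0 \<le> C"
    and C: "\<And>T. 1 \<le> T \<Longrightarrow> l1_norm M (initial_bounded (real n)) (\<lambda>x. of_real (U T x - W T x)) \<le> ennreal (C / sqrt T)"
    using C by blast
  have "((\<lambda>T. C / sqrt T) \<longlongrightarrow> 0) at_top" by real_asymp
  then have "\<forall>\<^sub>F T in at_top. C / sqrt T < e / 2" using e by (intro order_tendstoD) auto
  then show "\<forall>\<^sub>F T in at_top. dist ((LINT x|M. iexp (U T x)) - (LINT x|M. iexp (W T x))) 0 < e"
    using eventually_ge_at_top[of 1]
  proof eventually_elim
    case (elim T)
    have "0 \<le> C / sqrt T" using C0 elim by simp
    note norm_iexp_diff_le[OF meas this C[OF elim(2)]]
    also have "2 * (1 - prob (initial_bounded (real n))) + C / sqrt T < e"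
    proof -
      have "2 * (1 - P) + c < e" if "1 - e / 4 < P" "c < e / 2" for P c :: real using that by argo
      then show ?thesis using n elim(1) .
    qed
    finally show ?case by simp
  qed
qed

text \<open>Every linear functional of the Fourier transforms is, up to a negligible error, a sum of
  noise increments weighted by the real wave with amplitudes \<open>cnj (\<gamma> j) * h j\<close>, where \<open>h j\<close> is
  the value of the transfer function \<open>b / a\<close> at the \<open>j\<close>-th frequency.\<close>

lemma fourier_wave_sum_approx:
  fixes \<omega> :: "'d::finite \<Rightarrow> real" and \<gamma> :: "'d \<Rightarrow> complex"
  assumes b: "degree b < p"
  defines "h \<equiv> \<lambda>j. poly b (\<i> * of_real (\<omega> j)) / poly (map_poly of_real a) (\<i> * of_real (\<omega> j))"
  shows "((\<lambda>T. (LINT x|M. iexp (Re (\<Sum>j\<in>UNIV. cnj (\<gamma> j) * ((1 / sqrt T) *\<^sub>R fourier_integral b (\<omega> j) T x))))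
      - (LINT x|M. iexp (wave_sum L \<omega> (\<lambda>j. cnj (\<gamma> j) * h j) T x / sqrt T))) \<longlongrightarrow> 0) at_top"
proof (rule iexp_diff_tendsto_0)
  let ?a = "\<lambda>j. poly (map_poly of_real a) (\<i> * of_real (\<omega> j)) :: complex"
  let ?b = "\<lambda>j. poly b (\<i> * of_real (\<omega> j))"
  have a: "?a j \<noteq> 0" for j using stable[of "\<i> * of_real (\<omega> j)"] by auto
  fix K
  have "\<forall>j. \<exists>C\<ge>0. \<forall>T\<ge>1. l1_norm M (initial_bounded K)
      (\<lambda>x. ?a j * fourier_integral b (\<omega> j) T x - ?b j * noise_sum (\<omega> j) T x) \<le> ennreal C"
    unfolding fourier_integral_def by (intro allI fourier_near_noise_sum b)
  from choice[OF this] obtain C where C: "\<And>j. 0 \<le> C j" "\<And>j T. 1 \<le> T \<Longrightarrow> l1_norm M (initial_bounded K)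
      (\<lambda>x. ?a j * fourier_integral b (\<omega> j) T x - ?b j * noise_sum (\<omega> j) T x) \<le> ennreal (C j)"
    by blast
  define D where "D = (\<Sum>j\<in>UNIV. norm (cnj (\<gamma> j) / ?a j) * C j)"
  show "\<exists>C\<ge>0. \<forall>T\<ge>1. l1_norm M (initial_bounded K) (\<lambda>x. of_real
      (Re (\<Sum>j\<in>UNIV. cnj (\<gamma> j) * ((1 / sqrt T) *\<^sub>R fourier_integral b (\<omega> j) T x))
      - wave_sum L \<omega> (\<lambda>j. cnj (\<gamma> j) * h j) T x / sqrt T)) \<le> ennreal (C / sqrt T)"
  proof (intro exI[of _ D] conjI allI impI)
    show "0 \<le> D" unfolding D_def using C(1) by (intro sum_nonneg) simp
    fix T :: real assume T: "1 \<le> T"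
    define err where "err j x = ?a j * fourier_integral b (\<omega> j) T x - ?b j * noise_sum (\<omega> j) T x" for j x
    have [measurable]: "err j \<in> borel_measurable M" for j unfolding err_def by measurable
    have wave: "wave_sum L \<omega> (\<lambda>j. cnj (\<gamma> j) * h j) T x
        = Re (\<Sum>j\<in>UNIV. cnj (\<gamma> j) * h j * noise_sum (\<omega> j) T x)" for x
    proof -
      have "(\<Sum>j\<in>UNIV. cnj (\<gamma> j) * h j * noise_sum (\<omega> j) T x)
          = (\<Sum>k<cells T. (\<Sum>j\<in>UNIV. cnj (\<gamma> j) * h j * cis (- (\<omega> j * (real k / mesh T)))) *
               of_real (L (real (Suc k) / mesh T) x - L (real k / mesh T) x))"
        unfolding noise_sum_def sum_distrib_left sum_distrib_right
        by (subst sum.swap) (simp add: cis_conv_exp mult_ac)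
      then show ?thesis by (simp add: wave_sum_def wave_def)
    qed
    have eq: "Re (\<Sum>j\<in>UNIV. cnj (\<gamma> j) * ((1 / sqrt T) *\<^sub>R fourier_integral b (\<omega> j) T x))
        - Re (\<Sum>j\<in>UNIV. cnj (\<gamma> j) * h j * noise_sum (\<omega> j) T x) / sqrt T
        = Re (\<Sum>j\<in>UNIV. (cnj (\<gamma> j) / ?a j) * err j x) / sqrt T" for x
    proof -
      have "(\<Sum>j\<in>UNIV. (cnj (\<gamma> j) / ?a j) * err j x)
          = (\<Sum>j\<in>UNIV. cnj (\<gamma> j) * fourier_integral b (\<omega> j) T x) - (\<Sum>j\<in>UNIV. cnj (\<gamma> j) * h j * noise_sum (\<omega> j) T x)"
        unfolding sum_subtractf[symmetric] using a by (intro sum.cong) (auto simp: err_def h_def field_simps)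
      moreover have "(\<Sum>j\<in>UNIV. cnj (\<gamma> j) * ((1 / sqrt T) *\<^sub>R fourier_integral b (\<omega> j) T x))
          = (1 / sqrt T) *\<^sub>R (\<Sum>j\<in>UNIV. cnj (\<gamma> j) * fourier_integral b (\<omega> j) T x)"
        by (simp add: scaleR_sum_right)
      ultimately show ?thesis by (simp add: diff_divide_distrib)
    qed
    have "l1_norm M (initial_bounded K) (\<lambda>x. of_real
      (Re (\<Sum>j\<in>UNIV. cnj (\<gamma> j) * ((1 / sqrt T) *\<^sub>R fourier_integral b (\<omega> j) T x))
      - wave_sum L \<omega> (\<lambda>j. cnj (\<gamma> j) * h j) T x / sqrt T))
      \<le> l1_norm M (initial_bounded K) (\<lambda>x. of_real (1 / sqrt T) * (\<Sum>j\<in>UNIV. (cnj (\<gamma> j) / ?a j) * err j x))"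
    proof (rule l1_norm_mono)
      fix x
      show "norm (complex_of_real
          (Re (\<Sum>j\<in>UNIV. cnj (\<gamma> j) * ((1 / sqrt T) *\<^sub>R fourier_integral b (\<omega> j) T x))
          - wave_sum L \<omega> (\<lambda>j. cnj (\<gamma> j) * h j) T x / sqrt T))
          \<le> norm (of_real (1 / sqrt T) * (\<Sum>j\<in>UNIV. (cnj (\<gamma> j) / ?a j) * err j x))"
        unfolding wave eq norm_of_real norm_mult using T abs_Re_le_cmod[of "\<Sum>j\<in>UNIV. (cnj (\<gamma> j) / ?a j) * err j x"]
        by (simp add: abs_divide divide_right_mono)
    qed
    also have "\<dots> \<le> ennreal (1 / sqrt T * D)"
    proof (rule l1_norm_cmult_le)
      have err: "l1_norm M (initial_bounded K) (\<lambda>x. (cnj (\<gamma> j) / ?a j) * err j x) \<le> ennreal (norm (cnj (\<gamma> j) / ?a j) * C j)" for j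
        by (rule l1_norm_cmult_le[OF C(2)[OF T, of j, folded err_def] order_refl C(1)]) measurable
      have "l1_norm M (initial_bounded K) (\<lambda>x. \<Sum>j\<in>UNIV. (cnj (\<gamma> j) / ?a j) * err j x)
          \<le> (\<Sum>j\<in>UNIV. l1_norm M (initial_bounded K) (\<lambda>x. (cnj (\<gamma> j) / ?a j) * err j x))"
        by (rule l1_norm_sum) auto
      also have "\<dots> \<le> (\<Sum>j\<in>UNIV. ennreal (norm (cnj (\<gamma> j) / ?a j) * C j))" by (rule sum_mono) (rule err)
      also have "\<dots> = ennreal D" unfolding D_def using C(1) by (intro sum_ennreal mult_nonneg_nonneg) auto
      finally show "l1_norm M (initial_bounded K) (\<lambda>x. \<Sum>j\<in>UNIV. (cnj (\<gamma> j) / ?a j) * err j x) \<le> ennreal D" .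
      show "norm (complex_of_real (1 / sqrt T)) \<le> 1 / sqrt T" using T unfolding norm_of_real by simp
    qed (use \<open>0 \<le> D\<close> in auto)
    also have "1 / sqrt T * D = D / sqrt T" by simp
    finally show "l1_norm M (initial_bounded K) (\<lambda>x. of_real
      (Re (\<Sum>j\<in>UNIV. cnj (\<gamma> j) * ((1 / sqrt T) *\<^sub>R fourier_integral b (\<omega> j) T x))
      - wave_sum L \<omega> (\<lambda>j. cnj (\<gamma> j) * h j) T x / sqrt T)) \<le> ennreal (D / sqrt T)" .
  qed
qed (unfold wave_sum_def wave_def, measurable)

end

text \<open>The squared amplitudes of the wave that belongs to a vector \<open>u\<close> are \<open>\<bar>u\<^sub>j\<bar>\<^sup>2\<close> times the
  power transfer function, where \<open>u\<^sub>j\<close> is the pair of coordinates of \<open>u\<close> at the \<open>j\<close>-th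
  frequency. Hence the limit in \<open>wave_sum_clt\<close> is the characteristic function of the Gaussian
  law.\<close>

lemma (in centered_levy_process) truncated_fourier_normal_limit:
  fixes X :: "real \<Rightarrow> 'a \<Rightarrow> real Matrix.vec" and \<omega> :: "'d::finite \<Rightarrow> real"
  assumes p: "0 < p" and a: "degree a = p" "lead_coeff a = 1" and b: "degree b < p"
    and sde: "solves_linear_sde M p (companion_matrix p a) (noise_vector p) L X"
    and stable: "\<And>z. eigenvalue (map_mat complex_of_real (companion_matrix p a)) z \<Longrightarrow> Re z < 0"
    and \<omega>: "\<And>j. 0 < \<omega> j" "inj \<omega>"
  shows "converges_in_distribution M
      (\<lambda>T x. re_im_vector (\<lambda>j. truncated_fourier T (\<lambda>t. carma p b X t x) (\<omega> j)))
      (gaussian_law (\<lambda>j. \<sigma>\<^sup>2 / 2 * power_transfer a b (\<omega> j))) at_top"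
proof -
  obtain L' X' where "carma_paths M L' \<sigma> p a X'"
    and version: "AE x in M. \<forall>t\<ge>0. L' t x = L t x \<and> (\<forall>k<p. X' k t x = vec_index (X t x) k)"
    by (rule regular_version[OF p a sde stable])
  then interpret P: carma_paths M L' \<sigma> p a X' by simp
  define bc :: "complex poly" where "bc = map_poly of_real b"
  have deg_bc: "degree bc < p" using b by (simp add: bc_def degree_map_poly)
  define v where "v j = \<sigma>\<^sup>2 / 2 * power_transfer a b (\<omega> j)" for j
  have v: "0 \<le> v j" for j by (simp add: v_def power_transfer_def)
  define Z where "Z T x = re_im_vector (\<lambda>j. (1 / sqrt T) *\<^sub>R P.fourier_integral bc (\<omega> j) T x)" for T x
  have Z_meas: "Z T \<in> borel_measurable M" for T
    unfolding Z_def by (rule measurable_re_im_vector) measurable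
  have "converges_in_distribution M Z (gaussian_law v) at_top"
  proof (rule converges_in_distribution_char[OF prob_space_axioms Z_meas prob_space_gaussian_law[of v, OF v] sets_gaussian_law[of v, OF v]])
    fix u :: "real ^ ('d \<times> 2)"
    define \<gamma> where "\<gamma> j = Complex (vec_nth u (j, 1)) (vec_nth u (j, 2))" for j
    define d where "d j = cnj (\<gamma> j) * (poly bc (\<i> * of_real (\<omega> j)) / poly (map_poly of_real a) (\<i> * of_real (\<omega> j)))" for j
    have "((\<lambda>T. (LINT x|M. iexp (inner u (Z T x))) - (LINT x|M. iexp (wave_sum L \<omega> d T x / sqrt T))) \<longlongrightarrow> 0) at_top"
    proof -
      have "(LINT x|M. iexp (wave_sum L' \<omega> d T x / sqrt T))
          = (LINT x|M. iexp (wave_sum L \<omega> d T x / sqrt T))" for T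
      proof (rule integral_cong_AE)
        have L_meas: "L (real k / real (mesh T)) \<in> borel_measurable M" for k by (rule measurable_L) simp
        show "(\<lambda>x. iexp (wave_sum L \<omega> d T x / sqrt T)) \<in> borel_measurable M"
          unfolding wave_sum_def using L_meas by measurable
        show "(\<lambda>x. iexp (wave_sum L' \<omega> d T x / sqrt T)) \<in> borel_measurable M"
          unfolding wave_sum_def by measurable
        from version show "AE x in M. iexp (wave_sum L' \<omega> d T x / sqrt T)
            = iexp (wave_sum L \<omega> d T x / sqrt T)"
          by eventually_elim (simp add: wave_sum_def)
      qed
      then show ?thesis
        using P.fourier_wave_sum_approx[OF deg_bc, where \<omega>=\<omega> and \<gamma>=\<gamma>]
        unfolding Z_def inner_re_im_vector \<gamma>_def[symmetric] d_def[symmetric] by simp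
    qed
    from tendsto_add[OF this wave_sum_clt[OF \<omega>(2,1), of d]]
    have "((\<lambda>T. LINT x|M. iexp (inner u (Z T x))) \<longlongrightarrow> of_real (exp (- \<sigma>\<^sup>2 / 4 * (\<Sum>j\<in>UNIV. (norm (d j))\<^sup>2)))) at_top"
      by simp
    also have "- \<sigma>\<^sup>2 / 4 * (\<Sum>j\<in>UNIV. (norm (d j))\<^sup>2) = - (\<Sum>j\<in>UNIV. v j * ((vec_nth u (j, 1))\<^sup>2 + (vec_nth u (j, 2))\<^sup>2) / 2)"
    proof -
      have "(norm (d j))\<^sup>2 = ((vec_nth u (j, 1))\<^sup>2 + (vec_nth u (j, 2))\<^sup>2) * power_transfer a b (\<omega> j)" for j
        by (simp add: d_def \<gamma>_def norm_mult norm_divide power_mult_distrib power_divide cmod_power2[of "Complex _ _"] power_transfer_def bc_def)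
      then show ?thesis
        unfolding sum_distrib_left sum_negf[symmetric] by (intro sum.cong) (simp_all add: v_def field_simps)
    qed
    finally show "((\<lambda>T. LINT x|M. iexp (inner u (Z T x))) \<longlongrightarrow> (LINT z|gaussian_law v. iexp (inner u z))) at_top"
      unfolding integral_iexp_gaussian_law[of v, OF v] .
  qed
  then show ?thesis
    unfolding v_def[abs_def]
  proof (rule converges_in_distribution_AE_cong[OF complete_measure_axioms])
    show "\<forall>\<^sub>F T in at_top. AE x in M. Z T x = re_im_vector (\<lambda>j. truncated_fourier T (\<lambda>t. carma p b X t x) (\<omega> j))"
    proof (rule always_eventually, rule allI)
      fix T
      have dim: "\<And>t x. 0 \<le> t \<Longrightarrow> x \<in> space M \<Longrightarrow> X t x \<in> carrier_vec p"
        using sde unfolding solves_linear_sde_def by blast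
      from version AE_space show "AE x in M. Z T x = re_im_vector (\<lambda>j. truncated_fourier T (\<lambda>t. carma p b X t x) (\<omega> j))"
      proof eventually_elim
        case (elim x)
        have "of_real (carma p b X t x) = P.S bc t x" if "0 \<le> t" for t
        proof -
          have "dim_vec (X t x) = p" using dim[OF that elim(2)] by simp
          then show ?thesis using elim(1) that
            by (simp add: carma_def ma_vector_def scalar_prod_def state_poly_def bc_def coeff_map_poly lessThan_atLeast0)
        qed
        then have "(1 / sqrt T) *\<^sub>R P.fourier_integral bc (\<omega> j) T x = truncated_fourier T (\<lambda>t. carma p b X t x) (\<omega> j)" for j
          unfolding P.fourier_integral_def truncated_fourier_def
          by (intro arg_cong[where f="\<lambda>z. (1 / sqrt T) *\<^sub>R z"] set_lebesgue_integral_cong) (auto simp: mult_ac)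
        then show ?case unfolding Z_def by simp
      qed
    qed
  qed
qed

theorem theorem3p8:
  fixes M :: "'a measure" and F :: "real \<Rightarrow> 'a measure"
    and L :: "real \<Rightarrow> 'a \<Rightarrow> real" and X :: "real \<Rightarrow> 'a \<Rightarrow> real Matrix.vec"
    and a b :: "real poly" and p q :: nat and \<sigma> :: real
    and \<omega> :: "'d::{finite, linorder} \<Rightarrow> real"
  assumes "q < p"
    and "degree a = p" and "lead_coeff a = 1"
    and "b \<noteq> 0" and "degree b = q"
    and "levy_process M F L"
    and "solves_linear_sde M p (companion_matrix p a) (noise_vector p) L X"
    and "integrable M (L 1)" and "(LINT x|M. L 1 x) = 0"
    and "integrable M (\<lambda>x. \<bar>L 1 x\<bar>\<^sup>2)" and "(LINT x|M. \<bar>L 1 x\<bar>\<^sup>2) = \<sigma>\<^sup>2"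
    and "initial_state_indep M p L X"
    and "\<And>z. eigenvalue (map_mat complex_of_real (companion_matrix p a)) z \<Longrightarrow> Re z < 0"
    and "\<And>j. 0 < \<omega> j" and "strict_mono \<omega>"
  shows "(\<exists>\<mu>. is_multivariate_normal \<mu> 0
               ((\<sigma>\<^sup>2 / 2) *\<^sub>R diag_matrix (\<lambda>k. power_transfer a b (\<omega> (fst k)))) \<and>
             converges_in_distribution M
               (\<lambda>T x. re_im_vector (\<lambda>j. truncated_fourier T (\<lambda>t. carma p b X t x) (\<omega> j)))
               \<mu> at_top) \<and>
         (\<exists>\<nu>. has_independent_coordinates \<nu>
               (\<lambda>j. exponential_law (\<sigma>\<^sup>2 * power_transfer a b (\<omega> j))) \<and>
             converges_in_distribution M
               (\<lambda>T x. \<chi> j. (cmod (truncated_fourier T (\<lambda>t. carma p b X t x) (\<omega> j)))\<^sup>2)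
               \<nu> at_top)"
proof -
  interpret levy_process M F L by fact
  interpret centered_levy_process M F L \<sigma>
    by unfold_locales (use assms(8-11) in simp_all)
  define v where "v j = \<sigma>\<^sup>2 / 2 * power_transfer a b (\<omega> j)" for j
  have v: "0 \<le> v j" for j by (simp add: v_def power_transfer_def)
  have conv: "converges_in_distribution M
      (\<lambda>T x. re_im_vector (\<lambda>j. truncated_fourier T (\<lambda>t. carma p b X t x) (\<omega> j))) (gaussian_law v) at_top"
    unfolding v_def[abs_def]
    using assms by (intro truncated_fourier_normal_limit strict_mono_imp_inj_on) auto
  have "(\<sigma>\<^sup>2 / 2) *\<^sub>R diag_matrix (\<lambda>k :: 'd \<times> 2. power_transfer a b (\<omega> (fst k))) = diag_matrix (\<lambda>k. v (fst k))"
    by (simp add: diag_matrix_def Finite_Cartesian_Product.vec_eq_iff v_def)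
  then have "is_multivariate_normal (gaussian_law v) 0
      ((\<sigma>\<^sup>2 / 2) *\<^sub>R diag_matrix (\<lambda>k. power_transfer a b (\<omega> (fst k))))"
    using is_multivariate_normal_gaussian_law[of v, OF v] by simp
  moreover have "has_independent_coordinates (distr (gaussian_law v) borel squared_moduli)
      (\<lambda>j. exponential_law (\<sigma>\<^sup>2 * power_transfer a b (\<omega> j)))"
    using has_independent_coordinates_squared_moduli[of v, OF v] by (simp add: v_def)
  moreover have "converges_in_distribution M
      (\<lambda>T x. \<chi> j. (cmod (truncated_fourier T (\<lambda>t. carma p b X t x) (\<omega> j)))\<^sup>2)
      (distr (gaussian_law v) borel squared_moduli) at_top"
    using converges_in_distribution_continuous_map[OF conv continuous_squared_moduli[of v, OF v]]
    unfolding squared_moduli_re_im_vector .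
  ultimately show ?thesis using conv by blast
qed

end
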